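(* Let $s,t\geq 1$ be integers and $r,r'\in\mathbb{Z}_2$. (1) If $s+t$ is even, then $\Omega^sV(r)\otimes\Omega^tV(r')\cong\Omega^{s+t}V(r+r')\oplus stP(r+r')$ as $D_4$-modules. (2) If $s+t$ is odd, then $\Omega^sV(r)\otimes\Omega^tV(r')\cong\Omega^{s+t}V(r+r')\oplus stP(r+r'+1)$ as $D_4$-modules.
   Context: Let $k$ be an algebraically closed field with $\mathrm{char}(k)\neq 2$. All modules are finite-dimensional left modules; $\otimes=\otimes_k$; $\mathbb{Z}_2=\mathbb{Z}/2\mathbb{Z}$; $nM$ denotes the direct sum of $n$ copies of $M$. $D_4$ is the $k$-algebra generated by $a,b,c,d$ subject to $ba=-ab$, $db=-bd$, $ca=-ac$, $dc=-cd$, $bc=cb$, $a^2=0$, $b^2=1$, $c^2=1$, $d^2=0$, $da+ad=1-bc$. It is a $16$-dimensional Hopf algebra (isomorphic to the Drinfeld double of Sweedler's 4-dimensional Hopf algebra) with comultiplication $\Delta(a)=a\otimes b+1\otimes a$, $\Delta(b)=b\otimes b$, $\Delta(c)=c\otimes c$, $\Delta(d)=d\otimes c+1\otimes d$, counit $\varepsilon(a)=\varepsilon(d)=0$, $\varepsilon(b)=\varepsilon(c)=1$, antipode $S(a)=-ab$, $S(b)=b$, $S(c)=c$, $S(d)=-dc$. Tensor products of $D_4$-modules are $D_4$-modules via $\Delta$. For $r\in\mathbb{Z}_2$, $V(r)$ is the one-dimensional simple module on which $a,d$ act as $0$ and $b,c$ act as $(-1)^r$, and $P(r)$ is the projective cover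 of $V(r)$ (it is 4-dimensional and is also the injective envelope of $V(r)$). For a module $M$, $\Omega M$ is the kernel of a projective cover $P(M)\to M$, and $\Omega^s$ is the $s$-fold iterate of $\Omega$. *)

theory Defs
  imports
    "HOL-Library.Poly_Mapping"
    "HOL-Library.Z2"
    "HOL-Computational_Algebra.Polynomial"
    "Jordan_Normal_Form.Matrix_Kernel"
begin

section \<open>The algebra \<open>D\<^sub>4\<close>\<close>

datatype gen = GA | GB | GC | GD

text \<open>
  Words in the generators form a monoid under concatenation, written additively because
  \<^theory>\<open>HOL-Library.Poly_Mapping\<close> builds the monoid algebra from a class of additive monoids.
  Hence \<open>word \<Rightarrow>\<^sub>0 'k\<close> is the free associative \<open>k\<close>-algebra on the four generators.
\<close>

datatype word = Word (letters: "gen list")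

instantiation word :: monoid_add
begin

definition zero_word :: word where "0 = Word []"

definition plus_word :: "word \<Rightarrow> word \<Rightarrow> word" where
  "u + v = Word (letters u @ letters v)"

instance
  by standard (simp_all add: zero_word_def plus_word_def)

end

definition free_gen :: "gen \<Rightarrow> word \<Rightarrow>\<^sub>0 'k::field" where
  "free_gen g = Poly_Mapping.single (Word [g]) 1"

definition d4_relators :: "(word \<Rightarrow>\<^sub>0 'k::field) set" where
  "d4_relators =
    (let a = free_gen GA; b = free_gen GB; c = free_gen GC; d = free_gen GD in
     {b * a - (- (a * b)), d * b - (- (b * d)), c * a - (- (a * c)), d * c - (- (c * d)),
      b * c - c * b, a ^ 2, b ^ 2 - 1, c ^ 2 - 1, d ^ 2, (d * a + a * d) - (1 - b * c)})"

text \<open>The two-sided ideal generated by the relators.\<close>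

inductive_set d4_ideal :: "(word \<Rightarrow>\<^sub>0 'k::field) set" where
  zero: "0 \<in> d4_ideal"
| relator: "x \<in> d4_relators \<Longrightarrow> p * x * q \<in> d4_ideal"
| add: "x \<in> d4_ideal \<Longrightarrow> y \<in> d4_ideal \<Longrightarrow> x + y \<in> d4_ideal"

lemma d4_ideal_mult: "x \<in> d4_ideal \<Longrightarrow> p * x * q \<in> d4_ideal"
proof (induction rule: d4_ideal.induct)
  case (relator x p' q')
  have "p * (p' * x * q') * q = (p * p') * x * (q' * q)"
    by (simp add: mult.assoc)
  then show ?case by (metis d4_ideal.relator[OF relator])
qed (auto simp: distrib_left distrib_right intro: d4_ideal.intros)

lemma d4_ideal_uminus: "x \<in> d4_ideal \<Longrightarrow> - x \<in> d4_ideal"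
  using d4_ideal_mult[of x "- 1" 1] by simp

lemma d4_ideal_minus: "x \<in> d4_ideal \<Longrightarrow> y \<in> d4_ideal \<Longrightarrow> x - y \<in> d4_ideal"
  using d4_ideal.add[of x "- y"] d4_ideal_uminus[of y] by simp

definition d4_cong :: "(word \<Rightarrow>\<^sub>0 'k::field) \<Rightarrow> (word \<Rightarrow>\<^sub>0 'k) \<Rightarrow> bool" where
  "d4_cong p q \<longleftrightarrow> p - q \<in> d4_ideal"

lemma equivp_d4_cong: "equivp d4_cong"
proof (rule equivpI)
  show "reflp d4_cong"
    by (auto simp: reflp_def d4_cong_def intro: d4_ideal.zero)
  show "symp d4_cong"
    by (auto simp: symp_def d4_cong_def dest: d4_ideal_uminus)
  show "transp d4_cong"
    using d4_ideal.add by (fastforce simp: transp_def d4_cong_def)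
qed

quotient_type (overloaded) 'k d4 = "word \<Rightarrow>\<^sub>0 ('k::field)" / d4_cong
  by (rule equivp_d4_cong)

text \<open>Non-triviality of the quotient: the counit separates \<open>1\<close> from the ideal.\<close>

definition word_counit :: "word \<Rightarrow> 'k::field" where
  "word_counit w = (if set (letters w) \<subseteq> {GB, GC} then 1 else 0)"

definition free_counit :: "(word \<Rightarrow>\<^sub>0 'k::field) \<Rightarrow> 'k" where
  "free_counit p = (\<Sum>w\<in>Poly_Mapping.keys p. Poly_Mapping.lookup p w * word_counit w)"

lemma free_counit_superset:
  assumes "finite S" "Poly_Mapping.keys p \<subseteq> S"
  shows "free_counit p = (\<Sum>w\<in>S. Poly_Mapping.lookup p w * word_counit w)"
  unfolding free_counit_def
  by (rule sum.mono_neutral_left) (use assms in \<open>auto simp: in_keys_iff\<close>)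

lemma free_counit_add: "free_counit (p + q) = free_counit p + free_counit q"
proof -
  let ?S = "Poly_Mapping.keys p \<union> Poly_Mapping.keys q"
  have S: "finite ?S" by simp
  show ?thesis
    by (simp add: free_counit_superset[OF S] Poly_Mapping.keys_add lookup_add
        distrib_right sum.distrib)
qed

lemma free_counit_single: "free_counit (Poly_Mapping.single w x) = x * word_counit w"
  by (simp add: free_counit_def)

lemma free_counit_mult: "free_counit (p * q) = free_counit p * free_counit q"
proof -
  have induct: "Q p" if "Q 0" "\<And>w x. Q (Poly_Mapping.single w x)"
    "\<And>p q. Q p \<Longrightarrow> Q q \<Longrightarrow> Q (p + q)" for Q and p :: "word \<Rightarrow>\<^sub>0 'a"
  proof (induction p rule: update_induct)
    case (update p w x)
    then have "Poly_Mapping.update w x p = p + Poly_Mapping.single w x"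
      by (intro poly_mapping_eqI) (auto simp: lookup_add lookup_update lookup_single in_keys_iff when_def)
    with update that show ?case by simp
  qed (rule that)
  have single: "free_counit (Poly_Mapping.single u x * q)
      = free_counit (Poly_Mapping.single u x) * free_counit q" for u and x :: 'a
    by (induction q rule: induct)
      (auto simp: mult_single free_counit_single word_counit_def plus_word_def
        distrib_left free_counit_add, simp_all add: free_counit_def)
  show ?thesis
    by (induction p rule: induct)
      (simp_all add: single distrib_right free_counit_add, simp add: free_counit_def)
qed

lemma one_notin_d4_ideal: "(1 :: word \<Rightarrow>\<^sub>0 'k::field) \<notin> d4_ideal"
proof -
  have zero: "free_counit (0 :: word \<Rightarrow>\<^sub>0 'k) = 0"
    by (simp add: free_counit_def)
  have one: "free_counit (1 :: word \<Rightarrow>\<^sub>0 'k) = 1"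
  proof -
    have "word_counit 0 = (1 :: 'k)" by (simp add: word_counit_def zero_word_def)
    then show ?thesis using free_counit_single[of "0 :: word" "1 :: 'k"] by simp
  qed
  have uminus: "free_counit (- p) = - free_counit p" for p :: "word \<Rightarrow>\<^sub>0 'k"
    using free_counit_add[of p "- p"] zero by (simp add: eq_neg_iff_add_eq_0 add.commute)
  have minus: "free_counit (p - q) = free_counit p - free_counit q"
    for p q :: "word \<Rightarrow>\<^sub>0 'k"
    using free_counit_add[of p "- q"] by (simp add: uminus)
  have rel: "free_counit x = 0" if "x \<in> d4_relators" for x :: "word \<Rightarrow>\<^sub>0 'k"
    using that
    by (auto simp: d4_relators_def Let_def free_counit_add free_counit_mult minus uminus one
        power2_eq_square free_gen_def free_counit_single word_counit_def)
  have "free_counit x = 0" if "x \<in> d4_ideal" for x :: "word \<Rightarrow>\<^sub>0 'k"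
    using that by induction (simp_all add: zero rel free_counit_add free_counit_mult)
  with one show ?thesis by fastforce
qed

instantiation d4 :: (field) ring_1
begin

lift_definition zero_d4 :: "'a d4" is 0 .
lift_definition one_d4 :: "'a d4" is 1 .

lift_definition plus_d4 :: "'a d4 \<Rightarrow> 'a d4 \<Rightarrow> 'a d4" is "(+)"
  unfolding d4_cong_def by (subst add_diff_add) (rule d4_ideal.add)

lift_definition uminus_d4 :: "'a d4 \<Rightarrow> 'a d4" is uminus
  unfolding d4_cong_def by (subst minus_diff_minus) (rule d4_ideal_uminus)

lift_definition minus_d4 :: "'a d4 \<Rightarrow> 'a d4 \<Rightarrow> 'a d4" is "(-)"
proof -
  fix p p' q q' :: "word \<Rightarrow>\<^sub>0 'a"
  assume "d4_cong p p'" "d4_cong q q'"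
  then have "(p - p') - (q - q') \<in> d4_ideal"
    unfolding d4_cong_def by (rule d4_ideal_minus)
  then show "d4_cong (p - q) (p' - q')"
    by (simp add: d4_cong_def algebra_simps)
qed

lift_definition times_d4 :: "'a d4 \<Rightarrow> 'a d4 \<Rightarrow> 'a d4" is "(*)"
proof -
  fix p p' q q' :: "word \<Rightarrow>\<^sub>0 'a"
  assume "d4_cong p p'" "d4_cong q q'"
  then have "1 * (p - p') * q + p' * (q - q') * 1 \<in> d4_ideal"
    unfolding d4_cong_def by (intro d4_ideal.add d4_ideal_mult)
  then show "d4_cong (p * q) (p' * q')"
    by (simp add: d4_cong_def algebra_simps)
qed

instance
proof
  fix x y z :: "'a d4"
  note zero = d4_ideal.zero
  show "x + y + z = x + (y + z)" by transfer (simp add: d4_cong_def add.assoc zero)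
  show "x + y = y + x" by transfer (simp add: d4_cong_def add.commute zero)
  show "0 + x = x" by transfer (simp add: d4_cong_def zero)
  show "- x + x = 0" by transfer (simp add: d4_cong_def zero)
  show "x - y = x + - y" by transfer (simp add: d4_cong_def zero)
  show "x * y * z = x * (y * z)" by transfer (simp add: d4_cong_def mult.assoc zero)
  show "1 * x = x" by transfer (simp add: d4_cong_def zero)
  show "x * 1 = x" by transfer (simp add: d4_cong_def zero)
  show "(x + y) * z = x * z + y * z" by transfer (simp add: d4_cong_def distrib_right zero)
  show "x * (y + z) = x * y + x * z" by transfer (simp add: d4_cong_def distrib_left zero)
  show "(0 :: 'a d4) \<noteq> 1"
  proof transfer
    show "\<not> d4_cong (0 :: word \<Rightarrow>\<^sub>0 'a) 1"
      using one_notin_d4_ideal d4_ideal_uminus[of "- 1 :: word \<Rightarrow>\<^sub>0 'a"]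
      by (auto simp: d4_cong_def)
  qed
qed

end

lift_definition d4_scalar :: "'k::field \<Rightarrow> 'k d4" is "Poly_Mapping.single 0" .

lift_definition d4_gen :: "gen \<Rightarrow> 'k::field d4" is free_gen .


section \<open>Finite-dimensional modules\<close>

text \<open>
  A finite-dimensional left module is realised on a coordinate space \<open>k\<^sup>n\<close>, as a homomorphism
  of \<open>k\<close>-algebras from \<open>D\<^sub>4\<close> to the \<open>n \<times> n\<close> matrices acting on column vectors.
  Choosing a basis, every finite-dimensional module is isomorphic to one of this form.
\<close>

type_synonym 'k d4_module = "nat \<times> ('k d4 \<Rightarrow> 'k mat)"

abbreviation mdim :: "'k::field d4_module \<Rightarrow> nat" where
  "mdim \<equiv> fst"

abbreviation action :: "'k::field d4_module \<Rightarrow> 'k d4 \<Rightarrow> 'k mat" where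
  "action \<equiv> snd"

definition is_module :: "'k::field d4_module \<Rightarrow> bool" where
  "is_module M \<longleftrightarrow>
    (\<forall>x. action M x \<in> carrier_mat (mdim M) (mdim M)) \<and>
    (\<forall>x y. action M (x + y) = action M x + action M y) \<and>
    (\<forall>x y. action M (x * y) = action M x * action M y) \<and>
    (\<forall>c. action M (d4_scalar c) = c \<cdot>\<^sub>m 1\<^sub>m (mdim M))"

abbreviation mspace :: "'k::field d4_module \<Rightarrow> 'k vec set" where
  "mspace M \<equiv> carrier_vec (mdim M)"

definition is_hom :: "'k::field d4_module \<Rightarrow> 'k d4_module \<Rightarrow> 'k mat \<Rightarrow> bool" where
  "is_hom M N f \<longleftrightarrow> f \<in> carrier_mat (mdim N) (mdim M) \<and>
    (\<forall>x. f * action M x = action N x * f)"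

definition surj_hom :: "'k::field d4_module \<Rightarrow> 'k d4_module \<Rightarrow> 'k mat \<Rightarrow> bool" where
  "surj_hom M N f \<longleftrightarrow> is_hom M N f \<and> (\<lambda>v. f *\<^sub>v v) ` mspace M = mspace N"

definition inj_hom :: "'k::field d4_module \<Rightarrow> 'k d4_module \<Rightarrow> 'k mat \<Rightarrow> bool" where
  "inj_hom M N f \<longleftrightarrow> is_hom M N f \<and> inj_on (\<lambda>v. f *\<^sub>v v) (mspace M)"

definition module_iso :: "'k::field d4_module \<Rightarrow> 'k d4_module \<Rightarrow> bool"  (infix \<open>\<cong>\<^sub>D\<close> 50) where
  "M \<cong>\<^sub>D N \<longleftrightarrow> is_module M \<and> is_module N \<and>
    (\<exists>f g. is_hom M N f \<and> is_hom N M g \<and> g * f = 1\<^sub>m (mdim M) \<and> f * g = 1\<^sub>m (mdim N))"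

definition is_submodule :: "'k::field vec set \<Rightarrow> 'k d4_module \<Rightarrow> bool" where
  "is_submodule U M \<longleftrightarrow> U \<subseteq> mspace M \<and> 0\<^sub>v (mdim M) \<in> U \<and>
    (\<forall>u\<in>U. \<forall>v\<in>U. u + v \<in> U) \<and> (\<forall>x. \<forall>u\<in>U. action M x *\<^sub>v u \<in> U)"

definition direct_sum :: "'k::field d4_module \<Rightarrow> 'k d4_module \<Rightarrow> 'k d4_module"
    (infixr \<open>\<oplus>\<^sub>D\<close> 65) where
  "M \<oplus>\<^sub>D N = (mdim M + mdim N,
    \<lambda>x. four_block_mat (action M x) (0\<^sub>m (mdim M) (mdim N))
                       (0\<^sub>m (mdim N) (mdim M)) (action N x))"

fun copies :: "nat \<Rightarrow> 'k::field d4_module \<Rightarrow> 'k d4_module" where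
  "copies 0 M = (0, \<lambda>x. 0\<^sub>m 0 0)"
| "copies (Suc n) M = M \<oplus>\<^sub>D copies n M"

text \<open>
  The module structure on \<open>k\<^sup>n\<close> in which each generator \<open>g\<close> acts by the matrix \<open>\<rho> g\<close>.  It is
  unique since the generators generate, and it exists iff the matrices satisfy the defining
  relations of \<open>D\<^sub>4\<close>.
\<close>

definition module_of_gens :: "nat \<Rightarrow> (gen \<Rightarrow> 'k::field mat) \<Rightarrow> 'k d4_module" where
  "module_of_gens n \<rho> =
    (THE M. is_module M \<and> mdim M = n \<and> (\<forall>g. action M (d4_gen g) = \<rho> g))"


section \<open>Tensor products\<close>

text \<open>The matrix of \<open>A \<otimes> B\<close>, where the basis vector \<open>e\<^sub>i \<otimes> e\<^sub>j\<close> has index \<open>i * n + j\<close>,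
  \<open>n\<close> being the dimension of the second space.\<close>

definition kron :: "'k::field mat \<Rightarrow> 'k mat \<Rightarrow> 'k mat" where
  "kron A B = mat (dim_row A * dim_row B) (dim_col A * dim_col B)
    (\<lambda>(i, j). A $$ (i div dim_row B, j div dim_col B) * B $$ (i mod dim_row B, j mod dim_col B))"

text \<open>\<open>\<Delta>(g) = \<Sum>\<^sub>i x\<^sub>i \<otimes> y\<^sub>i\<close> on the generators, as the list of pairs \<open>(x\<^sub>i, y\<^sub>i)\<close>.\<close>

fun comult_gen :: "gen \<Rightarrow> ('k::field d4 \<times> 'k d4) list" where
  "comult_gen GA = [(d4_gen GA, d4_gen GB), (1, d4_gen GA)]"
| "comult_gen GB = [(d4_gen GB, d4_gen GB)]"
| "comult_gen GC = [(d4_gen GC, d4_gen GC)]"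
| "comult_gen GD = [(d4_gen GD, d4_gen GC), (1, d4_gen GD)]"

text \<open>\<open>\<Delta>\<close> is an algebra map, so the action on \<open>M \<otimes> N\<close> through \<open>\<Delta>\<close> is the module structure in
  which a generator with \<open>\<Delta>(g) = \<Sum>\<^sub>i x\<^sub>i \<otimes> y\<^sub>i\<close> acts by the sum of the \<open>x\<^sub>i \<otimes> y\<^sub>i\<close>.\<close>

definition tensor :: "'k::field d4_module \<Rightarrow> 'k d4_module \<Rightarrow> 'k d4_module"
    (infixr \<open>\<otimes>\<^sub>D\<close> 70) where
  "M \<otimes>\<^sub>D N = module_of_gens (mdim M * mdim N)
    (\<lambda>g. foldr (\<lambda>(x, y) A. kron (action M x) (action N y) + A) (comult_gen g)
           (0\<^sub>m (mdim M * mdim N) (mdim M * mdim N)))"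


section \<open>Projective covers and syzygies\<close>

definition projective :: "'k::field d4_module \<Rightarrow> bool" where
  "projective P \<longleftrightarrow> is_module P \<and>
    (\<forall>M N g f. is_module M \<and> is_module N \<and> surj_hom M N g \<and> is_hom P N f \<longrightarrow>
      (\<exists>h. is_hom P M h \<and> g * h = f))"

text \<open>The last clause says that \<open>ker \<pi>\<close> is superfluous: \<open>U + ker \<pi> = P\<close> forces \<open>U = P\<close>.\<close>

definition projective_cover ::
    "'k::field d4_module \<Rightarrow> 'k mat \<Rightarrow> 'k d4_module \<Rightarrow> bool" where
  "projective_cover P \<pi> M \<longleftrightarrow> projective P \<and> surj_hom P M \<pi> \<and>
    (\<forall>U. is_submodule U P \<and> {u + w |u w. u \<in> U \<and> w \<in> mat_kernel \<pi>} = mspace P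
      \<longrightarrow> U = mspace P)"

text \<open>\<open>K\<close> is, via some embedding, the kernel of some projective cover of \<open>M\<close>.\<close>

definition is_syzygy :: "'k::field d4_module \<Rightarrow> 'k d4_module \<Rightarrow> bool" where
  "is_syzygy K M \<longleftrightarrow> is_module K \<and>
    (\<exists>P \<pi> \<iota>. projective_cover P \<pi> M \<and> inj_hom K P \<iota> \<and>
      (\<lambda>v. \<iota> *\<^sub>v v) ` mspace K = mat_kernel \<pi>)"

text \<open>Syzygies and projective covers exist and are unique up to isomorphism; \<open>\<Omega>\<close> and
  \<open>P(r)\<close> are arbitrary choices of representatives.\<close>

definition \<Omega> :: "'k::field d4_module \<Rightarrow> 'k d4_module" where
  "\<Omega> M = (SOME K. is_syzygy K M)"

definition simple_V :: "bit \<Rightarrow> 'k::field d4_module" where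
  "simple_V r = module_of_gens 1
    (\<lambda>g. (if g \<in> {GB, GC} then (if r = 0 then 1 else - 1) else 0) \<cdot>\<^sub>m 1\<^sub>m 1)"

definition proj_P :: "bit \<Rightarrow> 'k::field d4_module" where
  "proj_P r = (SOME Q. \<exists>\<pi>. projective_cover Q \<pi> (simple_V r))"

end

theory Submission
  imports Defs
begin

text \<open>
  The modules \<open>\<Omega>\<^sup>s V(r)\<close> and \<open>P(r)\<close> have explicit matrix models: \<open>\<Omega>\<^sup>s V(r)\<close> is a zigzag with basis
  \<open>e\<^sub>0, \<dots>, e\<^sub>s\<close> (the top) and \<open>f\<^sub>0, \<dots>, f\<^bsub>s-1\<^esub>\<close> (the socle), where \<open>a e\<^sub>i = f\<^sub>i\<close> and \<open>d e\<^sub>i = f\<^bsub>i-1\<^esub>\<close>;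
  the kernel of its projective cover is the next zigzag, and syzygies are unique up to isomorphism.
  In the tensor product of two zigzags the diagonal sums \<open>\<Sum>\<^bsub>i+j=l\<^esub> e\<^sub>i \<otimes> e\<^sub>j\<close> span a copy of the top of the
  zigzag \<open>\<Omega>\<^bsup>s+t\<^esup>\<close>, and the \<open>s t\<close> vectors \<open>e\<^sub>i \<otimes> e\<^sub>j\<close> with \<open>i < s\<close> and \<open>j \<ge> 1\<close> generate projective
  modules.  Together these vectors generate the whole tensor product, so that the resulting map from
  the direct sum is onto, and it is an isomorphism because the dimensions agree:
  \<open>(2s + 1)(2t + 1) = 2(s + t) + 1 + 4st\<close>.
\<close>

section \<open>Linear algebra\<close>

text \<open>The parity of s + t is bookkeeping for a sign. Since a and d anticommute with b and c,
  the sign by which b and c act on the top of the zigzag flips from one syzygy to the next: on the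
  top of \<Omega>^s V(r) it is (-1)^s (-1)^r. Signs multiply under \<otimes>, so every e_i \<otimes>
  e_j carries the product of the two signs. Zigzags are therefore indexed by a length and a sign,
  one decomposition covers both cases, and parity only decides which P(q) has the sign in question.
  The number s t comes from a lattice path. In the grid 0 \<le> i \<le> s, 0 \<le> j \<le> t each of
  the s + t + 1 antidiagonals i + j = l meets the path "j = 0 or i = s" exactly once; the points off
  the path are the free generators, and the diagonal sums recover the points on it. Tensor products,
  \<Omega> and P(r) are given by description or choice operators. Before any matrix can be computed,
  each of them needs an existence and a uniqueness statement, and every construction in the theorem
  has to respect isomorphism.\<close>

lemma mult_unit_vec_index:
  "A \<in> carrier_mat m n \<Longrightarrow> i < m \<Longrightarrow> j < n \<Longrightarrow>
    (A *\<^sub>v unit_vec n j) $ i = (A :: 'k::field mat) $$ (i, j)"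
  by (auto simp: scalar_prod_right_unit[of _ n])

lemma mat_eqI_unit_vec:
  fixes A :: "'k::field mat"
  assumes "A \<in> carrier_mat m n" "B \<in> carrier_mat m n"
    and "\<And>j. j < n \<Longrightarrow> A *\<^sub>v unit_vec n j = B *\<^sub>v unit_vec n j"
  shows "A = B"
proof (rule eq_matI)
  fix i j assume ij: "i < dim_row B" "j < dim_col B"
  have "(A *\<^sub>v unit_vec n j) $ i = (B *\<^sub>v unit_vec n j) $ i"
    using assms ij by auto
  then show "A $$ (i, j) = B $$ (i, j)"
    using assms(1,2) ij mult_unit_vec_index[of A m n i j] mult_unit_vec_index[of B m n i j] by auto
qed (use assms in auto)

text \<open>The coordinates of v are added one at a time, passing over the zero ones. The premise
  \<open>v $ j \<noteq> 0\<close> of the step is what later puts a vector into a submodule that is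
  only known to contain the unit vectors in its support.\<close>

lemma vec_support_induct [consumes 1, case_names zero step]:
  fixes v :: "'k::field vec"
  assumes v: "v \<in> carrier_vec n" and zero: "P (0\<^sub>v n)"
    and step: "\<And>x j. x \<in> carrier_vec n \<Longrightarrow> P x \<Longrightarrow> j < n \<Longrightarrow> v $ j \<noteq> 0
      \<Longrightarrow> P (x + v $ j \<cdot>\<^sub>v unit_vec n j)"
  shows "P v"
proof -
  have "P (vec n (\<lambda>i. if i < k then v $ i else 0))" if "k \<le> n" for k
    using that
  proof (induction k)
    case 0
    then show ?case using zero by (simp add: zero_vec_def)
  next
    case (Suc k)
    let ?x = "vec n (\<lambda>i. if i < k then v $ i else 0)"
    have *: "vec n (\<lambda>i. if i < Suc k then v $ i else 0) = ?x + v $ k \<cdot>\<^sub>v unit_vec n k"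
      using Suc.prems by (auto simp: less_Suc_eq)
    show ?case
    proof (cases "v $ k = 0")
      case True
      then have "vec n (\<lambda>i. if i < Suc k then v $ i else 0) = ?x"
        by (auto simp: less_Suc_eq)
      with Suc show ?thesis by simp
    next
      case False
      with Suc step[of ?x k] show ?thesis unfolding * by simp
    qed
  qed
  from this[of n] have "P (vec n (\<lambda>i. if i < n then v $ i else 0))" by simp
  moreover have "vec n (\<lambda>i. if i < n then v $ i else 0) = v"
    using v by (intro eq_vecI) auto
  ultimately show ?thesis by simp
qed

text \<open>Maps of modules are written below as formulas on coordinates; this predicate is the
  interface from which \<open>linear_map_mat\<close> recovers a matrix.\<close>

definition linear_map :: "nat \<Rightarrow> nat \<Rightarrow> ('k::field vec \<Rightarrow> 'k vec) \<Rightarrow> bool" where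
  "linear_map n m T \<longleftrightarrow> (\<forall>v\<in>carrier_vec n. T v \<in> carrier_vec m) \<and>
    (\<forall>u\<in>carrier_vec n. \<forall>v\<in>carrier_vec n. T (u + v) = T u + T v) \<and>
    (\<forall>c. \<forall>v\<in>carrier_vec n. T (c \<cdot>\<^sub>v v) = c \<cdot>\<^sub>v T v)"

lemma linear_map_mat:
  fixes T :: "'k::field vec \<Rightarrow> 'k vec"
  assumes T: "linear_map n m T"
  obtains A where "A \<in> carrier_mat m n" "\<And>v. v \<in> carrier_vec n \<Longrightarrow> A *\<^sub>v v = T v"
proof
  let ?A = "mat m n (\<lambda>(i, j). T (unit_vec n j) $ i)"
  show A: "?A \<in> carrier_mat m n" by simp
  fix v :: "'k vec" assume v: "v \<in> carrier_vec n"
  have TD: "\<And>v. v \<in> carrier_vec n \<Longrightarrow> T v \<in> carrier_vec m"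
    "\<And>u v. u \<in> carrier_vec n \<Longrightarrow> v \<in> carrier_vec n \<Longrightarrow> T (u + v) = T u + T v"
    "\<And>c v. v \<in> carrier_vec n \<Longrightarrow> T (c \<cdot>\<^sub>v v) = c \<cdot>\<^sub>v T v"
    using T by (auto simp: linear_map_def)
  have unit: "?A *\<^sub>v unit_vec n j = T (unit_vec n j)" if "j < n" for j
  proof (rule eq_vecI)
    fix i assume "i < dim_vec (T (unit_vec n j))"
    then have "i < m" using TD(1)[of "unit_vec n j"] by auto
    then show "(?A *\<^sub>v unit_vec n j) $ i = T (unit_vec n j) $ i"
      using that by (simp add: scalar_prod_right_unit)
  qed (use TD(1)[of "unit_vec n j"] in auto)
  show "?A *\<^sub>v v = T v"
    using v
  proof (induction rule: vec_support_induct)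
    case zero
    have "T (0\<^sub>v n) = T (0 \<cdot>\<^sub>v 0\<^sub>v n)" by (simp add: smult_vec_def zero_vec_def)
    also have "\<dots> = 0\<^sub>v m" using TD(1)[of "0\<^sub>v n"] by (subst TD(3)) auto
    finally show ?case using A by auto
  next
    case (step x j)
    then show ?case
      using TD unit by (simp add: mult_add_distrib_mat_vec[OF A] mult_mat_vec[OF A])
  qed
qed

lemma linear_mapI:
  assumes "\<And>v. v \<in> carrier_vec n \<Longrightarrow> T v \<in> carrier_vec m"
    and "\<And>u v. u \<in> carrier_vec n \<Longrightarrow> v \<in> carrier_vec n \<Longrightarrow> T (u + v) = T u + T v"
    and "\<And>c v. v \<in> carrier_vec n \<Longrightarrow> T (c \<cdot>\<^sub>v v) = c \<cdot>\<^sub>v T v"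
  shows "linear_map n m T"
  using assms by (simp add: linear_map_def)

text \<open>A preimage under g of each vector f e_j serves as the j-th column of k.\<close>

lemma mat_factor:
  fixes f :: "'k::field mat"
  assumes f: "f \<in> carrier_mat n m" and g: "g \<in> carrier_mat n l"
    and sub: "\<And>v. v \<in> carrier_vec m \<Longrightarrow> \<exists>w\<in>carrier_vec l. g *\<^sub>v w = f *\<^sub>v v"
  obtains k where "k \<in> carrier_mat l m" "g * k = f"
proof -
  have "\<exists>w\<in>carrier_vec l. g *\<^sub>v w = f *\<^sub>v unit_vec m j" for j
    by (rule sub) simp
  then obtain w where w: "\<And>j. w j \<in> carrier_vec l" "\<And>j. g *\<^sub>v w j = f *\<^sub>v unit_vec m j"
    by metis
  let ?k = "mat l m (\<lambda>(i, j). w j $ i)"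
  have k: "?k \<in> carrier_mat l m" by simp
  have "?k *\<^sub>v unit_vec m j = w j" if "j < m" for j
    using that w(1)[of j] by (intro eq_vecI) (auto simp: scalar_prod_right_unit)
  then have "g * ?k = f"
    using f g w(2) by (intro mat_eqI_unit_vec[of _ n m]) (auto simp: assoc_mult_mat_vec[OF g k])
  with k show ?thesis by (rule that)
qed

text \<open>Factoring the identity through f yields a right inverse, and this is two-sided because f
  is square.\<close>

lemma surj_mat_inverse:
  fixes f :: "'k::field mat"
  assumes f: "f \<in> carrier_mat n n" and surj: "carrier_vec n \<subseteq> (*\<^sub>v) f ` carrier_vec n"
  obtains g where "g \<in> carrier_mat n n" "f * g = 1\<^sub>m n" "g * f = 1\<^sub>m n"
proof -
  have "\<exists>w\<in>carrier_vec n. f *\<^sub>v w = 1\<^sub>m n *\<^sub>v v" if "v \<in> carrier_vec n" for v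
  proof -
    from that surj obtain w where "w \<in> carrier_vec n" "f *\<^sub>v w = v" by blast
    with that show ?thesis by auto
  qed
  from mat_factor[OF one_carrier_mat f this] obtain g where "g \<in> carrier_mat n n" "f * g = 1\<^sub>m n"
    by blast
  with mat_mult_left_right_inverse[OF f] that show ?thesis by blast
qed

section \<open>Modules over \<open>D\<^sub>4\<close>\<close>

lemma free_algebra_induct [case_names single add]:
  assumes "\<And>w x. Q (Poly_Mapping.single w x)" "\<And>p q. Q p \<Longrightarrow> Q q \<Longrightarrow> Q (p + q)"
  shows "Q (p :: word \<Rightarrow>\<^sub>0 'k::field)"
proof (induction p rule: update_induct)
  case const
  show ?case using assms(1)[of 0 0] by simp
next
  case (update p w x)
  then have "Poly_Mapping.update w x p = p + Poly_Mapping.single w x"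
    by (intro poly_mapping_eqI) (auto simp: lookup_add lookup_update lookup_single in_keys_iff when_def)
  with update assms show ?case by simp
qed

text \<open>Words are products of generators and every element of the free algebra is a sum of
  scaled words, so scalars and generators reach the whole quotient.\<close>

lemma d4_induct [case_names scalar gen add mult]:
  assumes "\<And>c. P (d4_scalar c)" "\<And>g. P (d4_gen g)"
    "\<And>x y. P x \<Longrightarrow> P y \<Longrightarrow> P (x + y)" "\<And>x y. P x \<Longrightarrow> P y \<Longrightarrow> P (x * y)"
  shows "P (x :: 'k::field d4)"
proof (induction x rule: d4.abs_induct)
  fix p :: "word \<Rightarrow>\<^sub>0 'k"
  show "P (abs_d4 p)"
  proof (induction p rule: free_algebra_induct)
    case (single w c)
    have "P (abs_d4 (Poly_Mapping.single (Word gs) c))" for gs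
    proof (induction gs)
      case Nil
      then show ?case using assms(1)[of c] by (simp add: d4_scalar.abs_eq zero_word_def)
    next
      case (Cons g gs)
      have "Poly_Mapping.single (Word (g # gs)) c = free_gen g * Poly_Mapping.single (Word gs) c"
        by (simp add: free_gen_def mult_single plus_word_def)
      then show ?case
        using assms(4)[OF assms(2) Cons, of g]
        by (simp add: d4_gen.abs_eq times_d4.abs_eq)
    qed
    from this[of "letters w"] show ?case by simp
  next
    case (add p q)
    then show ?case using assms(3) by (simp add: plus_d4.abs_eq[symmetric])
  qed
qed

lemma d4_scalar_1: "d4_scalar 1 = 1"
  by transfer (simp add: d4_cong_def d4_ideal.zero)

section \<open>Evaluation of noncommutative polynomials at matrices\<close>

definition word_mat :: "nat \<Rightarrow> (gen \<Rightarrow> 'k::field mat) \<Rightarrow> word \<Rightarrow> 'k mat" where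
  "word_mat n \<rho> w = foldr (\<lambda>g A. \<rho> g * A) (letters w) (1\<^sub>m n)"

definition free_eval :: "nat \<Rightarrow> (gen \<Rightarrow> 'k::field mat) \<Rightarrow> (word \<Rightarrow>\<^sub>0 'k) \<Rightarrow> 'k mat" where
  "free_eval n \<rho> p = mat n n (\<lambda>(i, j).
    \<Sum>w\<in>Poly_Mapping.keys p. Poly_Mapping.lookup p w * word_mat n \<rho> w $$ (i, j))"

text \<open>The relations are imposed on vectors instead of matrices, so that they can rewrite
  iterated actions and be checked coordinate by coordinate.\<close>

definition d4_rep :: "nat \<Rightarrow> (gen \<Rightarrow> 'k::field mat) \<Rightarrow> bool" where
  "d4_rep n \<rho> \<longleftrightarrow> (\<forall>g. \<rho> g \<in> carrier_mat n n) \<and> (\<forall>v\<in>carrier_vec n.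
    \<rho> GB *\<^sub>v (\<rho> GA *\<^sub>v v) = - (\<rho> GA *\<^sub>v (\<rho> GB *\<^sub>v v)) \<and>
    \<rho> GD *\<^sub>v (\<rho> GB *\<^sub>v v) = - (\<rho> GB *\<^sub>v (\<rho> GD *\<^sub>v v)) \<and>
    \<rho> GC *\<^sub>v (\<rho> GA *\<^sub>v v) = - (\<rho> GA *\<^sub>v (\<rho> GC *\<^sub>v v)) \<and>
    \<rho> GD *\<^sub>v (\<rho> GC *\<^sub>v v) = - (\<rho> GC *\<^sub>v (\<rho> GD *\<^sub>v v)) \<and>
    \<rho> GB *\<^sub>v (\<rho> GC *\<^sub>v v) = \<rho> GC *\<^sub>v (\<rho> GB *\<^sub>v v) \<and>
    \<rho> GA *\<^sub>v (\<rho> GA *\<^sub>v v) = 0\<^sub>v n \<and>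
    \<rho> GB *\<^sub>v (\<rho> GB *\<^sub>v v) = v \<and>
    \<rho> GC *\<^sub>v (\<rho> GC *\<^sub>v v) = v \<and>
    \<rho> GD *\<^sub>v (\<rho> GD *\<^sub>v v) = 0\<^sub>v n \<and>
    \<rho> GD *\<^sub>v (\<rho> GA *\<^sub>v v) + \<rho> GA *\<^sub>v (\<rho> GD *\<^sub>v v) = v - \<rho> GB *\<^sub>v (\<rho> GC *\<^sub>v v))"

context
  fixes n :: nat and \<rho> :: "gen \<Rightarrow> 'k::field mat"
  assumes \<rho>: "\<And>g. \<rho> g \<in> carrier_mat n n"
begin

lemma word_mat_carrier: "word_mat n \<rho> w \<in> carrier_mat n n"
proof -
  have "foldr (\<lambda>g A. \<rho> g * A) gs (1\<^sub>m n) \<in> carrier_mat n n" for gs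
    by (induction gs) (auto intro!: mult_carrier_mat[OF \<rho>])
  then show ?thesis by (simp add: word_mat_def)
qed

lemma word_mat_add: "word_mat n \<rho> (u + v) = word_mat n \<rho> u * word_mat n \<rho> v"
proof -
  have "word_mat n \<rho> (Word us + v) = word_mat n \<rho> (Word us) * word_mat n \<rho> v" for us
  proof (induction us)
    case Nil
    show ?case using word_mat_carrier[of v] by (simp add: word_mat_def plus_word_def)
  next
    case (Cons g us)
    have "word_mat n \<rho> (Word (g # us) + v) = \<rho> g * word_mat n \<rho> (Word us + v)"
      by (simp add: word_mat_def plus_word_def)
    also have "\<dots> = (\<rho> g * word_mat n \<rho> (Word us)) * word_mat n \<rho> v"
      unfolding Cons by (rule assoc_mult_mat[symmetric, OF \<rho> word_mat_carrier word_mat_carrier])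
    finally show ?case by (simp add: word_mat_def)
  qed
  from this[of "letters u"] show ?thesis by simp
qed

lemma free_eval_carrier: "free_eval n \<rho> p \<in> carrier_mat n n"
  by (simp add: free_eval_def)

lemma free_eval_superset:
  assumes "finite S" "Poly_Mapping.keys p \<subseteq> S"
  shows "free_eval n \<rho> p =
    mat n n (\<lambda>(i, j). \<Sum>w\<in>S. Poly_Mapping.lookup p w * word_mat n \<rho> w $$ (i, j))"
  unfolding free_eval_def
  by (intro eq_matI) (use assms in \<open>auto simp: in_keys_iff intro!: sum.mono_neutral_left\<close>)

lemma free_eval_add: "free_eval n \<rho> (p + q) = free_eval n \<rho> p + free_eval n \<rho> q"
proof -
  let ?S = "Poly_Mapping.keys p \<union> Poly_Mapping.keys q"
  have S: "finite ?S" by simp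
  show ?thesis
    by (intro eq_matI)
      (auto simp: free_eval_superset[OF S] Poly_Mapping.keys_add lookup_add
        distrib_right sum.distrib)
qed

lemma free_eval_single: "free_eval n \<rho> (Poly_Mapping.single w x) = x \<cdot>\<^sub>m word_mat n \<rho> w"
  using word_mat_carrier[of w] by (intro eq_matI) (auto simp: free_eval_def)

lemma free_eval_mult: "free_eval n \<rho> (p * q) = free_eval n \<rho> p * free_eval n \<rho> q"
proof -
  note c = free_eval_carrier
  have single: "free_eval n \<rho> (Poly_Mapping.single u x * q)
      = free_eval n \<rho> (Poly_Mapping.single u x) * free_eval n \<rho> q" for u x
  proof (induction q rule: free_algebra_induct)
    case (single w y)
    then show ?case
      using word_mat_carrier[of u] word_mat_carrier[of w]
      by (simp add: mult_single free_eval_single word_mat_add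
          mult_smult_assoc_mat mult_smult_distrib) (intro eq_matI, auto)
  next
    case (add p q)
    then show ?case
      by (simp add: distrib_left free_eval_add mult_add_distrib_mat[OF c c c])
  qed
  show ?thesis
    by (induction p rule: free_algebra_induct)
      (simp_all add: single distrib_right free_eval_add add_mult_distrib_mat[OF c c c])
qed

lemma free_eval_gen: "free_eval n \<rho> (free_gen g) = \<rho> g"
  using \<rho>[of g] by (auto simp: free_gen_def free_eval_single word_mat_def)

lemma free_eval_scalar: "free_eval n \<rho> (Poly_Mapping.single 0 c) = c \<cdot>\<^sub>m 1\<^sub>m n"
  by (simp add: free_eval_single word_mat_def zero_word_def)

lemma free_eval_uminus: "free_eval n \<rho> (- p) = - free_eval n \<rho> p"
  by (intro eq_matI) (auto simp: free_eval_def sum_negf)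

end

text \<open>Evaluation is additive and multiplicative and kills every relator, hence the two-sided
  ideal they generate; so it descends to the quotient.\<close>

lemma free_eval_cong:
  fixes \<rho> :: "gen \<Rightarrow> 'k::field mat"
  assumes rep: "d4_rep n \<rho>" and pq: "d4_cong p q"
  shows "free_eval n \<rho> p = free_eval n \<rho> q"
proof -
  have \<rho>: "\<rho> g \<in> carrier_mat n n" for g using rep by (simp add: d4_rep_def)
  have c: "free_eval n \<rho> x \<in> carrier_mat n n" for x by (simp add: free_eval_def)
  have plus: "free_eval n \<rho> (x + y) *\<^sub>v v = free_eval n \<rho> x *\<^sub>v v + free_eval n \<rho> y *\<^sub>v v"
    if "v \<in> carrier_vec n" for x y v
    using that by (simp add: free_eval_add[OF \<rho>] add_mult_distrib_mat_vec[OF c c])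
  have uminus: "free_eval n \<rho> (- x) *\<^sub>v v = - (free_eval n \<rho> x *\<^sub>v v)"
    if "v \<in> carrier_vec n" for x v
    using that c[of x] by (simp add: free_eval_uminus[OF \<rho>])
  have minus: "free_eval n \<rho> (x - y) *\<^sub>v v = free_eval n \<rho> x *\<^sub>v v - free_eval n \<rho> y *\<^sub>v v"
    if "v \<in> carrier_vec n" for x y v
    using plus[OF that, of x "- y"] uminus[OF that, of y] c[of x] c[of y] that
    by (auto simp: minus_add_uminus_vec[of _ n])
  have mult: "free_eval n \<rho> (x * y) *\<^sub>v v = free_eval n \<rho> x *\<^sub>v (free_eval n \<rho> y *\<^sub>v v)"
    if "v \<in> carrier_vec n" for x y v
    using that by (simp add: free_eval_mult[OF \<rho>] assoc_mult_mat_vec[OF c c])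
  have one: "free_eval n \<rho> 1 *\<^sub>v v = v" if "v \<in> carrier_vec n" for v
  proof -
    have "free_eval n \<rho> 1 = 1 \<cdot>\<^sub>m 1\<^sub>m n"
      using free_eval_scalar[of \<rho> n 1] \<rho> by (simp add: single_one)
    also have "\<dots> = 1\<^sub>m n" by (intro eq_matI) auto
    finally show ?thesis using that by simp
  qed
  have cv: "\<rho> g *\<^sub>v v \<in> carrier_vec n" if "v \<in> carrier_vec n" for g v
    using that \<rho>[of g] by auto
  have rels: "\<rho> GB *\<^sub>v (\<rho> GA *\<^sub>v v) = - (\<rho> GA *\<^sub>v (\<rho> GB *\<^sub>v v))"
    "\<rho> GD *\<^sub>v (\<rho> GB *\<^sub>v v) = - (\<rho> GB *\<^sub>v (\<rho> GD *\<^sub>v v))"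
    "\<rho> GC *\<^sub>v (\<rho> GA *\<^sub>v v) = - (\<rho> GA *\<^sub>v (\<rho> GC *\<^sub>v v))"
    "\<rho> GD *\<^sub>v (\<rho> GC *\<^sub>v v) = - (\<rho> GC *\<^sub>v (\<rho> GD *\<^sub>v v))"
    "\<rho> GB *\<^sub>v (\<rho> GC *\<^sub>v v) = \<rho> GC *\<^sub>v (\<rho> GB *\<^sub>v v)"
    "\<rho> GA *\<^sub>v (\<rho> GA *\<^sub>v v) = 0\<^sub>v n" "\<rho> GB *\<^sub>v (\<rho> GB *\<^sub>v v) = v"
    "\<rho> GC *\<^sub>v (\<rho> GC *\<^sub>v v) = v" "\<rho> GD *\<^sub>v (\<rho> GD *\<^sub>v v) = 0\<^sub>v n"
    "\<rho> GD *\<^sub>v (\<rho> GA *\<^sub>v v) + \<rho> GA *\<^sub>v (\<rho> GD *\<^sub>v v) = v - \<rho> GB *\<^sub>v (\<rho> GC *\<^sub>v v)"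
    if "v \<in> carrier_vec n" for v
    using rep that by (simp_all add: d4_rep_def)
  have ideal: "free_eval n \<rho> x *\<^sub>v v = 0\<^sub>v n" if "x \<in> d4_ideal" "v \<in> carrier_vec n" for x v
    using that
  proof (induction arbitrary: v)
    case zero
    have "free_eval n \<rho> 0 = 0\<^sub>m n n" by (intro eq_matI) (auto simp: free_eval_def)
    then show ?case using zero by auto
  next
    case (relator x p q)
    have "free_eval n \<rho> x *\<^sub>v u = 0\<^sub>v n" if u: "u \<in> carrier_vec n" for u
      using relator(1) rels[OF u] u cv[OF u] cv[OF cv[OF u]] unfolding d4_relators_def Let_def
      by (auto simp: minus uminus plus mult one power2_eq_square free_eval_gen[OF \<rho>]
          carrier_matD[OF \<rho>] intro!: eq_vecI)
    then show ?case using relator(2) c[of p] c[of q] by (auto simp: mult) 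
  next
    case (add x y)
    then show ?case by (simp add: plus)
  qed
  show ?thesis
  proof (rule mat_eqI_unit_vec[OF c c])
    fix j
    have "p - q \<in> d4_ideal" using pq by (simp add: d4_cong_def)
    then have "free_eval n \<rho> (p - q) *\<^sub>v unit_vec n j = 0\<^sub>v n" by (simp add: ideal)
    then show "free_eval n \<rho> p *\<^sub>v unit_vec n j = free_eval n \<rho> q *\<^sub>v unit_vec n j"
      using plus[of "unit_vec n j" "p - q" q] mult_mat_vec_carrier[OF c[of q], of "unit_vec n j"] by simp
  qed
qed

section \<open>Modules as matrices satisfying the relations\<close>

lemma is_moduleD:
  assumes "is_module M"
  shows "action M x \<in> carrier_mat (mdim M) (mdim M)"
    and "action M (x + y) = action M x + action M y"
    and "action M (x * y) = action M x * action M y"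
    and "action M (d4_scalar c) = c \<cdot>\<^sub>m 1\<^sub>m (mdim M)"
  using assms by (auto simp: is_module_def)

lemma module_eqI:
  fixes M N :: "'k::field d4_module"
  assumes M: "is_module M" and N: "is_module N" and dim: "mdim M = mdim N"
    and gen: "\<And>g. action M (d4_gen g) = action N (d4_gen g)"
  shows "M = N"
proof (rule prod_eqI[OF dim], rule ext)
  fix x
  show "action M x = action N x"
    by (induction x rule: d4_induct) (simp_all add: is_moduleD[OF M] is_moduleD[OF N] dim gen)
qed

text \<open>This discharges the definite description: evaluation at representatives gives existence,
  and \<open>module_eqI\<close> gives uniqueness because generators determine the action.\<close>

lemma module_of_gens:
  fixes \<rho> :: "gen \<Rightarrow> 'k::field mat"
  assumes rep: "d4_rep n \<rho>"
  shows "is_module (module_of_gens n \<rho>)" "mdim (module_of_gens n \<rho>) = n"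
    "action (module_of_gens n \<rho>) (d4_gen g) = \<rho> g"
proof -
  have \<rho>: "\<rho> g \<in> carrier_mat n n" for g using rep by (simp add: d4_rep_def)
  define M where "M = (n, \<lambda>x. free_eval n \<rho> (rep_d4 x))"
  have act: "action M (abs_d4 p) = free_eval n \<rho> p" for p
    unfolding M_def snd_conv
    by (intro free_eval_cong[OF rep] Quotient_rep_abs[OF Quotient_d4])
      (simp add: d4_cong_def d4_ideal.zero)
  have abs: "\<exists>p. x = abs_d4 p" for x :: "'k d4"
    by (induction x rule: d4.abs_induct) blast
  have M: "is_module M"
    unfolding is_module_def
  proof (intro conjI allI)
    fix x y :: "'k d4" and c :: 'k
    show "action M x \<in> carrier_mat (mdim M) (mdim M)"
      by (simp add: M_def free_eval_def)
    show "action M (x + y) = action M x + action M y"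
      using abs[of x] abs[of y] by (auto simp add: plus_d4.abs_eq act free_eval_add[OF \<rho>])
    show "action M (x * y) = action M x * action M y"
      using abs[of x] abs[of y] by (auto simp add: times_d4.abs_eq act free_eval_mult[OF \<rho>])
    show "action M (d4_scalar c) = c \<cdot>\<^sub>m 1\<^sub>m (mdim M)"
      by (simp add: d4_scalar.abs_eq act free_eval_scalar[OF \<rho>]) (simp add: M_def)
  qed
  have "\<exists>!M. is_module M \<and> mdim M = n \<and> (\<forall>g. action M (d4_gen g) = \<rho> g)"
  proof (rule ex1I[of _ M])
    show "is_module M \<and> mdim M = n \<and> (\<forall>g. action M (d4_gen g) = \<rho> g)"
      using M by (simp add: d4_gen.abs_eq act free_eval_gen[OF \<rho>]) (simp add: M_def)
  qed (use M in \<open>auto intro!: module_eqI simp: d4_gen.abs_eq act free_eval_gen[OF \<rho>], auto simp: M_def\<close>)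
  from theI'[OF this] show "is_module (module_of_gens n \<rho>)" "mdim (module_of_gens n \<rho>) = n"
    "action (module_of_gens n \<rho>) (d4_gen g) = \<rho> g"
    by (auto simp: module_of_gens_def)
qed

text \<open>Negation, zero and one are written through \<open>d4_scalar\<close> because a module is
  specified by its behaviour on sums, products and scalars; in this form the relations can be pushed
  through \<open>action\<close> directly.\<close>

lemma d4_gen_rels:
  "d4_gen GB * d4_gen GA = d4_scalar (- 1) * (d4_gen GA * (d4_gen GB :: 'k::field d4))"
  "d4_gen GD * d4_gen GB = d4_scalar (- 1) * (d4_gen GB * (d4_gen GD :: 'k d4))"
  "d4_gen GC * d4_gen GA = d4_scalar (- 1) * (d4_gen GA * (d4_gen GC :: 'k d4))"
  "d4_gen GD * d4_gen GC = d4_scalar (- 1) * (d4_gen GC * (d4_gen GD :: 'k d4))"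
  "d4_gen GB * d4_gen GC = d4_gen GC * (d4_gen GB :: 'k d4)"
  "d4_gen GA * d4_gen GA = d4_scalar (0 :: 'k)"
  "d4_gen GB * d4_gen GB = d4_scalar (1 :: 'k)"
  "d4_gen GC * d4_gen GC = d4_scalar (1 :: 'k)"
  "d4_gen GD * d4_gen GD = d4_scalar (0 :: 'k)"
  "d4_gen GD * d4_gen GA + d4_gen GA * d4_gen GD =
    d4_scalar 1 + d4_scalar (- 1) * (d4_gen GB * (d4_gen GC :: 'k d4))"
proof -
  have rel: "d4_cong x y" if "x - y \<in> d4_relators" for x y :: "word \<Rightarrow>\<^sub>0 'k"
    using d4_ideal.relator[OF that, of 1 1] by (simp add: d4_cong_def)
  have neg: "Poly_Mapping.single 0 (- 1) = (- 1 :: word \<Rightarrow>\<^sub>0 'k)"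
    by (simp add: single_uminus single_one)
  show "d4_gen GB * d4_gen GA = d4_scalar (- 1) * (d4_gen GA * (d4_gen GB :: 'k::field d4))"
    by transfer (rule rel, simp add: neg d4_relators_def Let_def)
  show "d4_gen GD * d4_gen GB = d4_scalar (- 1) * (d4_gen GB * (d4_gen GD :: 'k d4))"
    by transfer (rule rel, simp add: neg d4_relators_def Let_def)
  show "d4_gen GC * d4_gen GA = d4_scalar (- 1) * (d4_gen GA * (d4_gen GC :: 'k d4))"
    by transfer (rule rel, simp add: neg d4_relators_def Let_def)
  show "d4_gen GD * d4_gen GC = d4_scalar (- 1) * (d4_gen GC * (d4_gen GD :: 'k d4))"
    by transfer (rule rel, simp add: neg d4_relators_def Let_def)
  show "d4_gen GB * d4_gen GC = d4_gen GC * (d4_gen GB :: 'k d4)"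
    by transfer (rule rel, simp add: d4_relators_def Let_def)
  show "d4_gen GA * d4_gen GA = d4_scalar (0 :: 'k)"
    by transfer (rule rel, simp add: d4_relators_def Let_def power2_eq_square)
  show "d4_gen GB * d4_gen GB = d4_scalar (1 :: 'k)"
    by transfer (rule rel, simp add: single_one d4_relators_def Let_def power2_eq_square)
  show "d4_gen GC * d4_gen GC = d4_scalar (1 :: 'k)"
    by transfer (rule rel, simp add: single_one d4_relators_def Let_def power2_eq_square)
  show "d4_gen GD * d4_gen GD = d4_scalar (0 :: 'k)"
    by transfer (rule rel, simp add: d4_relators_def Let_def power2_eq_square)
  show "d4_gen GD * d4_gen GA + d4_gen GA * d4_gen GD =
    d4_scalar 1 + d4_scalar (- 1) * (d4_gen GB * (d4_gen GC :: 'k d4))"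
    by transfer (rule rel, simp add: neg single_one d4_relators_def Let_def)
qed

lemma act_carrier:
  "is_module M \<Longrightarrow> v \<in> mspace M \<Longrightarrow> action M x *\<^sub>v v \<in> mspace M"
  using is_moduleD(1) by (metis mult_mat_vec_carrier)

lemma act_plus:
  "is_module M \<Longrightarrow> v \<in> mspace M \<Longrightarrow>
    action M (x + y) *\<^sub>v v = action M x *\<^sub>v v + action M y *\<^sub>v v"
  by (simp add: is_moduleD(2) add_mult_distrib_mat_vec[OF is_moduleD(1) is_moduleD(1)])

lemma act_mult:
  "is_module M \<Longrightarrow> v \<in> mspace M \<Longrightarrow>
    action M (x * y) *\<^sub>v v = action M x *\<^sub>v (action M y *\<^sub>v v)"
  by (simp add: is_moduleD(3) assoc_mult_mat_vec[OF is_moduleD(1) is_moduleD(1)])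

lemma act_scalar:
  "is_module M \<Longrightarrow> v \<in> mspace M \<Longrightarrow> action M (d4_scalar c) *\<^sub>v v = c \<cdot>\<^sub>v v"
  by (auto simp: is_moduleD(4) intro!: eq_vecI)

lemma act_add_vec:
  "is_module M \<Longrightarrow> u \<in> mspace M \<Longrightarrow> v \<in> mspace M \<Longrightarrow>
    action M x *\<^sub>v (u + v) = action M x *\<^sub>v u + action M x *\<^sub>v v"
  by (rule mult_add_distrib_mat_vec[OF is_moduleD(1)])

lemma act_smult_vec:
  "is_module M \<Longrightarrow> v \<in> mspace M \<Longrightarrow>
    action M x *\<^sub>v (c \<cdot>\<^sub>v v) = c \<cdot>\<^sub>v (action M x *\<^sub>v (v :: 'k::field vec))"
  by (rule mult_mat_vec[OF is_moduleD(1)])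

lemma module_d4_rep:
  assumes M: "is_module M"
  shows "d4_rep (mdim M) (\<lambda>g. action M (d4_gen g))"
proof -
  note r = act_mult[OF M, symmetric] act_scalar[OF M] act_plus[OF M, symmetric] d4_gen_rels
  have neg: "(- 1) \<cdot>\<^sub>v v = - v" for v :: "'a vec" by (intro eq_vecI) auto
  have "action M (d4_gen GD) *\<^sub>v (action M (d4_gen GA) *\<^sub>v v) +
      action M (d4_gen GA) *\<^sub>v (action M (d4_gen GD) *\<^sub>v v) =
      v - action M (d4_gen GB) *\<^sub>v (action M (d4_gen GC) *\<^sub>v v)" if v: "v \<in> mspace M" for v
  proof -
    have "action M (d4_gen GD * d4_gen GA + d4_gen GA * d4_gen GD) *\<^sub>v v =
      action M (d4_scalar 1 + d4_scalar (- 1) * (d4_gen GB * d4_gen GC)) *\<^sub>v v"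
      by (simp only: d4_gen_rels)
    then show ?thesis
      using v by (simp add: act_plus[OF M] act_mult[OF M] act_scalar[OF M] act_carrier[OF M] neg
          minus_add_uminus_vec[of _ "mdim M"])
  qed
  moreover have "action M (d4_gen GA) *\<^sub>v (action M (d4_gen GA) *\<^sub>v v) = 0\<^sub>v (mdim M)"
    "action M (d4_gen GD) *\<^sub>v (action M (d4_gen GD) *\<^sub>v v) = 0\<^sub>v (mdim M)"
    if v: "v \<in> mspace M" for v
    using v by (simp_all add: act_mult[OF M, symmetric] d4_gen_rels act_scalar[OF M])
      (auto intro!: eq_vecI)
  moreover have "action M (d4_gen g) *\<^sub>v (action M (d4_gen h) *\<^sub>v v) =
      - (action M (d4_gen h) *\<^sub>v (action M (d4_gen g) *\<^sub>v v))"
    if v: "v \<in> mspace M" and gh: "d4_gen g * d4_gen h = d4_scalar (- 1) * (d4_gen h * (d4_gen g :: 'a d4))"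
    for v g h
  proof -
    have "action M (d4_gen g) *\<^sub>v (action M (d4_gen h) *\<^sub>v v) = action M (d4_gen g * d4_gen h) *\<^sub>v v"
      using v by (simp add: act_mult[OF M])
    also have "\<dots> = - (action M (d4_gen h) *\<^sub>v (action M (d4_gen g) *\<^sub>v v))"
      unfolding gh using v by (simp add: act_mult[OF M] act_scalar[OF M] act_carrier[OF M] neg)
    finally show ?thesis .
  qed
  moreover have "action M (d4_gen GB) *\<^sub>v (action M (d4_gen GC) *\<^sub>v v) =
      action M (d4_gen GC) *\<^sub>v (action M (d4_gen GB) *\<^sub>v v)"
    "action M (d4_gen GB) *\<^sub>v (action M (d4_gen GB) *\<^sub>v v) = v"
    "action M (d4_gen GC) *\<^sub>v (action M (d4_gen GC) *\<^sub>v v) = v" if v: "v \<in> mspace M" for v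
    using v by (simp_all add: act_mult[OF M, symmetric] d4_gen_rels act_scalar[OF M])
  ultimately show ?thesis
    using d4_gen_rels(1-4) is_moduleD(1)[OF M] unfolding d4_rep_def by blast
qed

lemma is_homD:
  assumes "is_hom M N f" "is_module M" "is_module N"
  shows "f \<in> carrier_mat (mdim N) (mdim M)" "f * action M x = action N x * f"
    and "v \<in> mspace M \<Longrightarrow> f *\<^sub>v v \<in> mspace N"
    and "v \<in> mspace M \<Longrightarrow> f *\<^sub>v (action M x *\<^sub>v v) = action N x *\<^sub>v (f *\<^sub>v v)"
proof -
  show f: "f \<in> carrier_mat (mdim N) (mdim M)" and com: "f * action M x = action N x * f"
    using assms by (auto simp: is_hom_def)
  show "v \<in> mspace M \<Longrightarrow> f *\<^sub>v v \<in> mspace N" using f by auto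
  show "f *\<^sub>v (action M x *\<^sub>v v) = action N x *\<^sub>v (f *\<^sub>v v)" if v: "v \<in> mspace M"
    using arg_cong[OF com, of "\<lambda>A. A *\<^sub>v v"] v
    by (simp add: assoc_mult_mat_vec[OF f is_moduleD(1)[OF assms(2)] v]
        assoc_mult_mat_vec[OF is_moduleD(1)[OF assms(3)] f v])
qed

text \<open>The elements whose action commutes with f are closed under sums and products and contain
  the scalars, so testing the generators is enough.\<close>

lemma is_hom_gensI:
  assumes M: "is_module M" and N: "is_module N" and f: "f \<in> carrier_mat (mdim N) (mdim M)"
    and com: "\<And>g v. v \<in> mspace M \<Longrightarrow>
      f *\<^sub>v (action M (d4_gen g) *\<^sub>v v) = action N (d4_gen g) *\<^sub>v (f *\<^sub>v v)"
  shows "is_hom M N f"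
proof -
  have fv: "f *\<^sub>v v \<in> mspace N" if "v \<in> mspace M" for v using that f by auto
  have *: "f *\<^sub>v (action M x *\<^sub>v v) = action N x *\<^sub>v (f *\<^sub>v v)" if "v \<in> mspace M" for x v
    using that
  proof (induction x arbitrary: v rule: d4_induct)
    case (scalar c)
    then show ?case by (simp add: act_scalar M N fv mult_mat_vec[OF f])
  next
    case (gen g)
    then show ?case by (rule com)
  next
    case (add x y)
    then show ?case by (simp add: act_plus M N fv mult_add_distrib_mat_vec[OF f] act_carrier)
  next
    case (mult x y)
    then show ?case by (simp add: act_mult M N fv act_carrier)
  qed
  have "f * action M x = action N x * f" for x
    using * by (intro mat_eqI_unit_vec[of _ "mdim N" "mdim M"])
      (auto intro!: mult_carrier_mat[OF f is_moduleD(1)] mult_carrier_mat[OF is_moduleD(1) f]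
        simp: assoc_mult_mat_vec[OF f is_moduleD(1)[OF M]] assoc_mult_mat_vec[OF is_moduleD(1)[OF N] f] M N)
  with f show ?thesis by (simp add: is_hom_def)
qed

lemma linear_hom:
  assumes M: "is_module M" and N: "is_module N" and T: "linear_map (mdim M) (mdim N) T"
    and gen: "\<And>g v. v \<in> mspace M \<Longrightarrow>
      T (action M (d4_gen g) *\<^sub>v v) = action N (d4_gen g) *\<^sub>v T v"
  shows "\<exists>f. is_hom M N f \<and> (\<forall>v\<in>mspace M. f *\<^sub>v v = T v)"
proof -
  obtain f where f: "f \<in> carrier_mat (mdim N) (mdim M)" "\<And>v. v \<in> mspace M \<Longrightarrow> f *\<^sub>v v = T v"
    by (rule linear_map_mat[OF T]) blast
  have "is_hom M N f"
    using f gen by (intro is_hom_gensI[OF M N]) (auto simp: act_carrier[OF M])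
  with f(2) show ?thesis by blast
qed

section \<open>Homomorphisms\<close>

lemma is_hom_comp:
  assumes "is_module M" "is_module N" "is_module L" "is_hom M N f" "is_hom N L g"
  shows "is_hom M L (g * f)"
proof (rule is_hom_gensI)
  have f: "f \<in> carrier_mat (mdim N) (mdim M)" and g: "g \<in> carrier_mat (mdim L) (mdim N)"
    using assms by (auto simp: is_hom_def)
  then show "g * f \<in> carrier_mat (mdim L) (mdim M)" by simp
  fix h v assume "v \<in> mspace M"
  then show "g * f *\<^sub>v (action M (d4_gen h) *\<^sub>v v) = action L (d4_gen h) *\<^sub>v (g * f *\<^sub>v v)"
    using assms by (simp add: assoc_mult_mat_vec[OF g f] act_carrier is_homD(3)[of M N] is_homD(4)[of M N] is_homD(4)[of N L])
qed (use assms in auto)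

lemma is_hom_one: "is_module M \<Longrightarrow> is_hom M M (1\<^sub>m (mdim M))"
  by (simp add: is_hom_def left_mult_one_mat[OF is_moduleD(1)] right_mult_one_mat[OF is_moduleD(1)])

lemma is_hom_inverse:
  assumes M: "is_module M" and N: "is_module N" and f: "is_hom M N f"
    and g: "g \<in> carrier_mat (mdim M) (mdim N)"
    and gf: "g * f = 1\<^sub>m (mdim M)" and fg: "f * g = 1\<^sub>m (mdim N)"
  shows "is_hom N M g"
proof (rule is_hom_gensI[OF N M g])
  have f': "f \<in> carrier_mat (mdim N) (mdim M)" using f by (simp add: is_hom_def)
  have gf': "g *\<^sub>v (f *\<^sub>v v) = v" if "v \<in> mspace M" for v
    using that gf by (simp flip: assoc_mult_mat_vec[OF g f'])
  have fg': "f *\<^sub>v (g *\<^sub>v v) = v" if "v \<in> mspace N" for v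
    using that fg by (simp flip: assoc_mult_mat_vec[OF f' g])
  fix h v assume v: "v \<in> mspace N"
  then have gv: "g *\<^sub>v v \<in> mspace M" using g by auto
  have "g *\<^sub>v (action N (d4_gen h) *\<^sub>v v) = g *\<^sub>v (f *\<^sub>v (action M (d4_gen h) *\<^sub>v (g *\<^sub>v v)))"
    using gv v by (simp add: is_homD(4)[OF f M N] fg')
  then show "g *\<^sub>v (action N (d4_gen h) *\<^sub>v v) = action M (d4_gen h) *\<^sub>v (g *\<^sub>v v)"
    using gv by (simp add: gf' act_carrier[OF M])
qed

lemma iso_refl: "is_module M \<Longrightarrow> M \<cong>\<^sub>D M"
  unfolding module_iso_def using is_hom_one[of M]
  by (intro conjI exI[of _ "1\<^sub>m (mdim M)"]) auto

lemma iso_sym: "M \<cong>\<^sub>D N \<Longrightarrow> N \<cong>\<^sub>D M"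
  by (auto simp: module_iso_def)

lemma inverse_comp:
  fixes f :: "'k::field mat"
  assumes c: "f \<in> carrier_mat n m" "g \<in> carrier_mat m n" "f' \<in> carrier_mat l n" "g' \<in> carrier_mat n l"
    and inv: "g * f = 1\<^sub>m m" "g' * f' = 1\<^sub>m n"
  shows "(g * g') * (f' * f) = 1\<^sub>m m"
proof -
  have "(g * g') * (f' * f) = g * (g' * (f' * f))"
    using c by (intro assoc_mult_mat) auto
  also have "g' * (f' * f) = (g' * f') * f"
    using c by (intro assoc_mult_mat[symmetric]) auto
  finally show ?thesis using c inv by simp
qed

lemma iso_trans:
  assumes "M \<cong>\<^sub>D N" "N \<cong>\<^sub>D L"
  shows "M \<cong>\<^sub>D L"
proof -
  from assms obtain f g f' g' where m: "is_module M" "is_module N" "is_module L"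
    and h: "is_hom M N f" "is_hom N M g" "is_hom N L f'" "is_hom L N g'"
    and inv: "g * f = 1\<^sub>m (mdim M)" "f * g = 1\<^sub>m (mdim N)"
      "g' * f' = 1\<^sub>m (mdim N)" "f' * g' = 1\<^sub>m (mdim L)"
    by (auto simp: module_iso_def)
  have c: "f \<in> carrier_mat (mdim N) (mdim M)" "g \<in> carrier_mat (mdim M) (mdim N)"
    "f' \<in> carrier_mat (mdim L) (mdim N)" "g' \<in> carrier_mat (mdim N) (mdim L)"
    using h by (auto simp: is_hom_def)
  have "is_hom M L (f' * f)" "is_hom L M (g * g')"
    by (rule is_hom_comp[of _ N]; fact)+
  moreover have "(g * g') * (f' * f) = 1\<^sub>m (mdim M)" "(f' * f) * (g * g') = 1\<^sub>m (mdim L)"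
    using inverse_comp[OF c inv(1,3)] inverse_comp[OF c(4,3,2,1) inv(4,2)] by auto
  ultimately show ?thesis using m by (auto simp: module_iso_def)
qed

lemma iso_surjI:
  assumes M: "is_module M" and N: "is_module N" and f: "is_hom M N f"
    and dim: "mdim M = mdim N" and surj: "mspace N \<subseteq> (*\<^sub>v) f ` mspace M"
  shows "M \<cong>\<^sub>D N"
proof -
  have f': "f \<in> carrier_mat (mdim N) (mdim N)" using f dim by (simp add: is_hom_def)
  obtain g where g: "g \<in> carrier_mat (mdim N) (mdim N)" "f * g = 1\<^sub>m (mdim N)" "g * f = 1\<^sub>m (mdim N)"
    using surj_mat_inverse[OF f'] surj dim by auto
  then have "is_hom N M g"
    using dim by (intro is_hom_inverse[OF M N f]) auto
  with M N f g dim show ?thesis by (auto simp: module_iso_def)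
qed

lemma inj_mat_cancel:
  fixes f :: "'k::field mat"
  assumes inj: "inj_on ((*\<^sub>v) f) (carrier_vec n)" and c: "f \<in> carrier_mat m n"
    "A \<in> carrier_mat n l" "B \<in> carrier_mat n l" and eq: "f * A = f * B"
  shows "A = B"
proof (rule mat_eqI_unit_vec[OF c(2,3)])
  fix j
  have "f *\<^sub>v (A *\<^sub>v unit_vec l j) = f *\<^sub>v (B *\<^sub>v unit_vec l j)"
    using arg_cong[OF eq, of "\<lambda>A. A *\<^sub>v unit_vec l j"]
    by (simp add: assoc_mult_mat_vec[OF c(1,2)] assoc_mult_mat_vec[OF c(1,3)])
  then show "A *\<^sub>v unit_vec l j = B *\<^sub>v unit_vec l j"
    using inj c(2,3) by (auto dest: inj_onD)
qed

text \<open>Nested images give a linear factor k. It respects the action because f and g do and the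
  injective g can be cancelled on the left.\<close>

lemma hom_factor:
  assumes A: "is_module A" and B: "is_module B" and C: "is_module C"
    and f: "is_hom A C f" and g: "inj_hom B C g"
    and sub: "(*\<^sub>v) f ` mspace A \<subseteq> (*\<^sub>v) g ` mspace B"
  obtains k where "is_hom A B k" "g * k = f"
proof -
  have f': "f \<in> carrier_mat (mdim C) (mdim A)" and gh: "is_hom B C g"
    and g': "g \<in> carrier_mat (mdim C) (mdim B)" and inj: "inj_on ((*\<^sub>v) g) (mspace B)"
    using f g by (auto simp: is_hom_def inj_hom_def)
  have "\<exists>w\<in>mspace B. g *\<^sub>v w = f *\<^sub>v v" if "v \<in> mspace A" for v
    using sub that by force
  then obtain k where k: "k \<in> carrier_mat (mdim B) (mdim A)" "g * k = f"
    by (rule mat_factor[OF f' g'])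
  have kv: "k *\<^sub>v v \<in> mspace B" if "v \<in> mspace A" for v using that k(1) by auto
  have gk: "g *\<^sub>v (k *\<^sub>v v) = f *\<^sub>v v" if "v \<in> mspace A" for v
    using that k(2) by (simp flip: assoc_mult_mat_vec[OF g' k(1)])
  have "is_hom A B k"
  proof (rule is_hom_gensI[OF A B k(1)])
    fix h v assume v: "v \<in> mspace A"
    have "g *\<^sub>v (k *\<^sub>v (action A (d4_gen h) *\<^sub>v v)) = g *\<^sub>v (action B (d4_gen h) *\<^sub>v (k *\<^sub>v v))"
      using v by (simp add: gk act_carrier[OF A] is_homD(4)[OF f A C] is_homD(4)[OF gh B C] kv)
    with inj show "k *\<^sub>v (action A (d4_gen h) *\<^sub>v v) = action B (d4_gen h) *\<^sub>v (k *\<^sub>v v)"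
      by (rule inj_onD) (use v in \<open>simp_all add: kv act_carrier[OF A] act_carrier[OF B]\<close>)
  qed
  with k(2) that show ?thesis by blast
qed

lemma image_submodule:
  assumes M: "is_module M" and N: "is_module N" and f: "is_hom M N f"
  shows "is_submodule ((*\<^sub>v) f ` mspace M) N"
  unfolding is_submodule_def
proof (intro conjI ballI allI)
  have f': "f \<in> carrier_mat (mdim N) (mdim M)" using f by (simp add: is_hom_def)
  show "(*\<^sub>v) f ` mspace M \<subseteq> mspace N" using f' by auto
  show "0\<^sub>v (mdim N) \<in> (*\<^sub>v) f ` mspace M"
    using f' by (intro image_eqI[of _ _ "0\<^sub>v (mdim M)"]) auto
  show "u + v \<in> (*\<^sub>v) f ` mspace M" if "u \<in> (*\<^sub>v) f ` mspace M" "v \<in> (*\<^sub>v) f ` mspace M" for u v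
    using that by (auto simp flip: mult_add_distrib_mat_vec[OF f'])
  show "action N x *\<^sub>v u \<in> (*\<^sub>v) f ` mspace M" if "u \<in> (*\<^sub>v) f ` mspace M" for u x
    using that by (auto simp: act_carrier[OF M] simp flip: is_homD(4)[OF f M N])
qed

section \<open>Projective covers\<close>

lemma projective_coverD:
  assumes "projective_cover P \<pi> M"
  shows "projective P" "is_module P" "is_hom P M \<pi>" "\<pi> \<in> carrier_mat (mdim M) (mdim P)"
    "(*\<^sub>v) \<pi> ` mspace P = mspace M"
proof -
  show P: "projective P" using assms by (simp add: projective_cover_def)
  then show "is_module P" by (simp add: projective_def)
  show "is_hom P M \<pi>" "\<pi> \<in> carrier_mat (mdim M) (mdim P)" "(*\<^sub>v) \<pi> ` mspace P = mspace M"
    using assms by (auto simp: projective_cover_def surj_hom_def is_hom_def)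
qed

text \<open>If \<pi> h is onto, every p differs from some h v by an element of the kernel of \<pi>.
  So the image of h together with that kernel is everything, and superfluity makes the image itself
  everything.\<close>

lemma surj_into_cover:
  assumes cover: "projective_cover P \<pi> M" and M: "is_module M" and Q: "is_module Q"
    and h: "is_hom Q P h"
    and surj: "\<And>m. m \<in> mspace M \<Longrightarrow> \<exists>v\<in>mspace Q. \<pi> *\<^sub>v (h *\<^sub>v v) = m"
  shows "(*\<^sub>v) h ` mspace Q = mspace P"
proof -
  note P = projective_coverD[OF cover]
  have "{u + w |u w. u \<in> (*\<^sub>v) h ` mspace Q \<and> w \<in> mat_kernel \<pi>} = mspace P"
  proof (intro equalityI subsetI)
    fix p assume p: "p \<in> mspace P"
    then have "\<pi> *\<^sub>v p \<in> mspace M" using P(4) by auto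
    from surj[OF this] obtain v where v: "v \<in> mspace Q" "\<pi> *\<^sub>v (h *\<^sub>v v) = \<pi> *\<^sub>v p" by blast
    have hv: "h *\<^sub>v v \<in> mspace P" using v(1) by (rule is_homD(3)[OF h Q P(2)])
    have "\<pi> *\<^sub>v (p - h *\<^sub>v v) = 0\<^sub>v (mdim M)"
      using p hv v P(4) by (auto simp: mult_minus_distrib_mat_vec[OF P(4)])
    then have "p - h *\<^sub>v v \<in> mat_kernel \<pi>"
      using p hv by (intro mat_kernelI[OF P(4)]) auto
    moreover have "p = h *\<^sub>v v + (p - h *\<^sub>v v)"
      using p hv is_homD(1)[OF h Q P(2)] by (intro eq_vecI) auto
    ultimately show "p \<in> {u + w |u w. u \<in> (*\<^sub>v) h ` mspace Q \<and> w \<in> mat_kernel \<pi>}"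
      using v(1) by blast
  qed (use is_homD(3)[OF h Q P(2)] mat_kernel[OF P(4)] in auto)
  with image_submodule[OF Q P(2) h] cover show ?thesis
    unfolding projective_cover_def by blast
qed

text \<open>The covers may lie over two different modules joined by \<phi>, and the square with
  \<phi> is part of the conclusion: comparing kernels over isomorphic modules requires both. The map
  h lifts \<phi> \<pi> through \<pi>' and is onto by superfluity.\<close>

lemma projective_cover_unique:
  assumes P: "projective_cover P \<pi> M" and P': "projective_cover P' \<pi>' M'"
    and M: "is_module M" and M': "is_module M'"
    and \<phi>: "is_hom M M' \<phi>" and \<psi>: "is_hom M' M \<psi>"
    and inv: "\<psi> * \<phi> = 1\<^sub>m (mdim M)" "\<phi> * \<psi> = 1\<^sub>m (mdim M')"
  obtains h h' where "is_hom P P' h" "is_hom P' P h'" "h' * h = 1\<^sub>m (mdim P)"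
    "h * h' = 1\<^sub>m (mdim P')" "\<pi>' * h = \<phi> * \<pi>"
proof -
  note D = projective_coverD[OF P] and D' = projective_coverD[OF P']
  note cphi = is_homD(1)[OF \<phi> M M'] and cpsi = is_homD(1)[OF \<psi> M' M]
  have \<psi>\<phi>: "\<psi> *\<^sub>v (\<phi> *\<^sub>v v) = v" if "v \<in> mspace M" for v
    using that inv(1) by (simp flip: assoc_mult_mat_vec[OF cpsi cphi])
  have \<phi>\<psi>: "\<phi> *\<^sub>v (\<psi> *\<^sub>v v) = v" if "v \<in> mspace M'" for v
    using that inv(2) by (simp flip: assoc_mult_mat_vec[OF cphi cpsi])
  have "is_hom P M' (\<phi> * \<pi>)" by (rule is_hom_comp[OF D(2) M M' D(3) \<phi>])
  moreover have "surj_hom P' M' \<pi>'" using D'(3,5) by (simp add: surj_hom_def)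
  ultimately obtain h where h: "is_hom P P' h" "\<pi>' * h = \<phi> * \<pi>"
    using D(1) D'(2) M' unfolding projective_def by metis
  note ch = is_homD(1)[OF h(1) D(2) D'(2)]
  have comm: "\<pi>' *\<^sub>v (h *\<^sub>v v) = \<phi> *\<^sub>v (\<pi> *\<^sub>v v)" if "v \<in> mspace P" for v
    using arg_cong[OF h(2), of "\<lambda>A. A *\<^sub>v v"] that
    by (simp add: assoc_mult_mat_vec[OF D'(4) ch] assoc_mult_mat_vec[OF cphi D(4)])
  have "\<exists>v\<in>mspace P. \<pi>' *\<^sub>v (h *\<^sub>v v) = m" if m: "m \<in> mspace M'" for m
  proof -
    have "\<psi> *\<^sub>v m \<in> mspace M" using cpsi m by auto
    then obtain v where "v \<in> mspace P" "\<pi> *\<^sub>v v = \<psi> *\<^sub>v m" using D(5) by (metis imageE)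
    then show ?thesis using m by (intro bexI[of _ v]) (simp_all add: comm \<phi>\<psi>)
  qed
  then have "(*\<^sub>v) h ` mspace P = mspace P'"
    by (rule surj_into_cover[OF P' M' D(2) h(1)])
  then have "surj_hom P P' h" using h(1) by (simp add: surj_hom_def)
  \<comment> \<open>Projectivity of P' splits h. The section s is again onto by superfluity, this
    time of the kernel of \<pi>; then h s = 1 gives s h s = s and hence s h = 1.\<close>
  then obtain s where s: "is_hom P' P s" "h * s = 1\<^sub>m (mdim P')"
    using D'(1) D(2) D'(2) is_hom_one[OF D'(2)] unfolding projective_def by metis
  note cs = is_homD(1)[OF s(1) D'(2) D(2)]
  have hs: "h *\<^sub>v (s *\<^sub>v v) = v" if "v \<in> mspace P'" for v
    using that s(2) by (simp flip: assoc_mult_mat_vec[OF ch cs])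
  have "\<exists>v\<in>mspace P'. \<pi> *\<^sub>v (s *\<^sub>v v) = m" if m: "m \<in> mspace M" for m
  proof -
    have "\<phi> *\<^sub>v m \<in> mspace M'" using cphi m by auto
    then obtain v where v: "v \<in> mspace P'" "\<pi>' *\<^sub>v v = \<phi> *\<^sub>v m" using D'(5) by (metis imageE)
    have sv: "s *\<^sub>v v \<in> mspace P" and psv: "\<pi> *\<^sub>v (s *\<^sub>v v) \<in> mspace M"
      using v(1) cs D(4) by auto
    have "\<phi> *\<^sub>v (\<pi> *\<^sub>v (s *\<^sub>v v)) = \<phi> *\<^sub>v m"
      using comm[OF sv] hs[OF v(1)] v(2) by simp
    then have "\<pi> *\<^sub>v (s *\<^sub>v v) = m" using \<psi>\<phi>[OF psv] \<psi>\<phi>[OF m] by argo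
    with v(1) show ?thesis by blast
  qed
  then have surj: "(*\<^sub>v) s ` mspace P' = mspace P"
    by (rule surj_into_cover[OF P M D'(2) s(1)])
  have sh: "s * h = 1\<^sub>m (mdim P)"
  proof (rule mat_eqI_unit_vec[of _ "mdim P" "mdim P"])
    fix j
    obtain v where v: "v \<in> mspace P'" "s *\<^sub>v v = unit_vec (mdim P) j"
      using surj by (metis imageE unit_vec_carrier)
    then show "s * h *\<^sub>v unit_vec (mdim P) j = 1\<^sub>m (mdim P) *\<^sub>v unit_vec (mdim P) j"
      using hs[OF v(1)] by (simp add: assoc_mult_mat_vec[OF cs ch])
  qed (use cs ch in auto)
  from h(1) s(1) sh s(2) h(2) show ?thesis by (rule that)
qed

text \<open>The commuting square carries the kernel of \<pi> into that of \<pi>', so h restricts;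
  \<open>hom_factor\<close> turns the restriction into a map between the abstract modules embedded
  as these kernels.\<close>

lemma syzygy_map:
  assumes K: "is_module K" "inj_hom K P \<iota>" "(*\<^sub>v) \<iota> ` mspace K = mat_kernel \<pi>"
    and K': "is_module K'" "inj_hom K' P' \<iota>'" "(*\<^sub>v) \<iota>' ` mspace K' = mat_kernel \<pi>'"
    and P: "is_module P" and P': "is_module P'"
    and \<pi>: "\<pi> \<in> carrier_mat m (mdim P)" and \<pi>': "\<pi>' \<in> carrier_mat m' (mdim P')"
    and \<phi>: "\<phi> \<in> carrier_mat m' m" and h: "is_hom P P' h" and comm: "\<pi>' * h = \<phi> * \<pi>"
  obtains k where "is_hom K K' k" "\<iota>' * k = h * \<iota>"
proof -
  have \<iota>: "is_hom K P \<iota>" using K(2) by (simp add: inj_hom_def)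
  note ci = is_homD(1)[OF \<iota> K(1) P] and ch = is_homD(1)[OF h P P']
  have "(*\<^sub>v) (h * \<iota>) ` mspace K \<subseteq> (*\<^sub>v) \<iota>' ` mspace K'"
    unfolding K'(3)
  proof safe
    fix v assume v: "v \<in> mspace K"
    then have iv: "\<iota> *\<^sub>v v \<in> mspace P" using ci by auto
    have "\<iota> *\<^sub>v v \<in> mat_kernel \<pi>" using v K(3) by blast
    then have ker: "\<pi> *\<^sub>v (\<iota> *\<^sub>v v) = 0\<^sub>v m" by (rule mat_kernelD[OF \<pi>])
    have "\<pi>' *\<^sub>v (h *\<^sub>v (\<iota> *\<^sub>v v)) = \<phi> *\<^sub>v (\<pi> *\<^sub>v (\<iota> *\<^sub>v v))"
      using arg_cong[OF comm, of "\<lambda>A. A *\<^sub>v (\<iota> *\<^sub>v v)"] iv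
      by (simp add: assoc_mult_mat_vec[OF \<pi>' ch] assoc_mult_mat_vec[OF \<phi> \<pi>])
    then have "\<pi>' *\<^sub>v (h *\<^sub>v (\<iota> *\<^sub>v v)) = 0\<^sub>v m'" using ker \<phi> by auto
    then show "h * \<iota> *\<^sub>v v \<in> mat_kernel \<pi>'"
      using v iv ch by (intro mat_kernelI[OF \<pi>']) (auto simp: assoc_mult_mat_vec[OF ch ci])
  qed
  from hom_factor[OF K(1) K'(1) P' is_hom_comp[OF K(1) P P' \<iota> h] K'(2) this] that
  show ?thesis by blast
qed

lemma syzygy_unique:
  assumes "is_syzygy K M" "is_syzygy K' M'" and iso: "M \<cong>\<^sub>D M'"
  shows "K \<cong>\<^sub>D K'"
proof -
  obtain P \<pi> \<iota> where K: "is_module K" "inj_hom K P \<iota>" "(*\<^sub>v) \<iota> ` mspace K = mat_kernel \<pi>"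
    and P: "projective_cover P \<pi> M"
    using assms(1) by (auto simp: is_syzygy_def)
  obtain P' \<pi>' \<iota>' where K': "is_module K'" "inj_hom K' P' \<iota>'"
      "(*\<^sub>v) \<iota>' ` mspace K' = mat_kernel \<pi>'"
    and P': "projective_cover P' \<pi>' M'"
    using assms(2) by (auto simp: is_syzygy_def)
  obtain \<phi> \<psi> where M: "is_module M" and M': "is_module M'"
    and \<phi>: "is_hom M M' \<phi>" and \<psi>: "is_hom M' M \<psi>"
    and inv: "\<psi> * \<phi> = 1\<^sub>m (mdim M)" "\<phi> * \<psi> = 1\<^sub>m (mdim M')"
    using iso by (auto simp: module_iso_def)
  note D = projective_coverD[OF P] and D' = projective_coverD[OF P']
  note cphi = is_homD(1)[OF \<phi> M M'] and cpsi = is_homD(1)[OF \<psi> M' M]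
  obtain h h' where h: "is_hom P P' h" "is_hom P' P h'" "h' * h = 1\<^sub>m (mdim P)"
    "h * h' = 1\<^sub>m (mdim P')" "\<pi>' * h = \<phi> * \<pi>"
    using projective_cover_unique[OF P P' M M' \<phi> \<psi> inv] by blast
  note ch = is_homD(1)[OF h(1) D(2) D'(2)] is_homD(1)[OF h(2) D'(2) D(2)]
  \<comment> \<open>The square for h' comes from the one for h by composing with \<psi> on the left
    and h' on the right.\<close>
  have "\<psi> * \<pi>' = \<psi> * (\<pi>' * (h * h'))" using h(4) D'(4) by simp
  also have "\<dots> = \<psi> * (\<pi>' * h) * h'"
    using assoc_mult_mat[OF cpsi mult_carrier_mat[OF D'(4) ch(1)] ch(2)]
      assoc_mult_mat[OF D'(4) ch] by simp
  also have "\<psi> * (\<pi>' * h) = (\<psi> * \<phi>) * \<pi>"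
    unfolding h(5) by (rule assoc_mult_mat[symmetric, OF cpsi cphi D(4)])
  also have "(\<psi> * \<phi>) * \<pi> * h' = \<pi> * h'" using inv(1) D(4) by simp
  finally have h5: "\<pi> * h' = \<psi> * \<pi>'" ..
  obtain k where k: "is_hom K K' k" "\<iota>' * k = h * \<iota>"
    by (rule syzygy_map[OF K K' D(2) D'(2) D(4) D'(4) cphi h(1,5)])
  obtain k' where k': "is_hom K' K k'" "\<iota> * k' = h' * \<iota>'"
    by (rule syzygy_map[OF K' K D'(2) D(2) D'(4) D(4) cpsi h(2) h5])
  have ci: "\<iota> \<in> carrier_mat (mdim P) (mdim K)" "\<iota>' \<in> carrier_mat (mdim P') (mdim K')"
    and inj: "inj_on ((*\<^sub>v) \<iota>) (mspace K)" "inj_on ((*\<^sub>v) \<iota>') (mspace K')"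
    using K(2) K'(2) by (auto simp: inj_hom_def is_hom_def)
  note ck = is_homD(1)[OF k(1) K(1) K'(1)] is_homD(1)[OF k'(1) K'(1) K(1)]
  \<comment> \<open>Since the embeddings are injective, H' H = 1 on the covers descends to b a = 1
    on the syzygies. Stated for arbitrary maps so that it serves both composites.\<close>
  have inverse: "b * a = 1\<^sub>m p" if "i * b = H' * i'" "i' * a = H * i" "H' * H = 1\<^sub>m q"
    "a \<in> carrier_mat p' p" "b \<in> carrier_mat p p'" "i \<in> carrier_mat q p" "i' \<in> carrier_mat q' p'"
    "H \<in> carrier_mat q' q" "H' \<in> carrier_mat q q'" "inj_on ((*\<^sub>v) i) (carrier_vec p)"
    for a b i i' H H' :: "'a mat" and p p' q q'
  proof (rule inj_mat_cancel[OF that(10,6)])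
    have "i * (b * a) = (i * b) * a"
      by (rule assoc_mult_mat[symmetric]) (use that in auto)
    also have "\<dots> = H' * (i' * a)"
      unfolding that(1) by (rule assoc_mult_mat) (use that in auto)
    also have "\<dots> = (H' * H) * i"
      unfolding that(2) by (rule assoc_mult_mat[symmetric]) (use that in auto)
    finally show "i * (b * a) = i * 1\<^sub>m p" using that by simp
  qed (use that in auto)
  have "k' * k = 1\<^sub>m (mdim K)"
    by (rule inverse[OF k'(2) k(2) h(3) ck ci ch inj(1)])
  moreover have "k * k' = 1\<^sub>m (mdim K')"
    by (rule inverse[OF k(2) k'(2) h(4) ck(2,1) ci(2,1) ch(2,1) inj(2)])
  ultimately show ?thesis
    using K(1) K'(1) k(1) k'(1) by (auto simp: module_iso_def)
qed

text \<open>The last assumption makes the choice behind \<open>\<Omega> M\<close> meaningful by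
  exhibiting some syzygy of M itself; the comparison is then with a syzygy K of an isomorphic
  M'.\<close>

lemma Omega_iso:
  assumes "is_syzygy K M'" "M \<cong>\<^sub>D M'" "is_syzygy L M"
  shows "\<Omega> M \<cong>\<^sub>D K"
  unfolding \<Omega>_def by (rule syzygy_unique[OF someI[of "\<lambda>K. is_syzygy K M", OF assms(3)] assms(1,2)])

section \<open>Direct sums\<close>

lemma direct_sum_module:
  assumes M: "is_module M" and N: "is_module N"
  shows "is_module (M \<oplus>\<^sub>D N)"
  unfolding is_module_def
proof (intro conjI allI)
  fix x y :: "'a d4" and c :: 'a
  note c = is_moduleD(1)[OF M] is_moduleD(1)[OF N]
  show "action (M \<oplus>\<^sub>D N) x \<in> carrier_mat (mdim (M \<oplus>\<^sub>D N)) (mdim (M \<oplus>\<^sub>D N))"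
    using c by (simp add: direct_sum_def)
  show "action (M \<oplus>\<^sub>D N) (x + y) = action (M \<oplus>\<^sub>D N) x + action (M \<oplus>\<^sub>D N) y"
    using c by (auto simp: direct_sum_def is_moduleD(2)[OF M] is_moduleD(2)[OF N]
        add_four_block_mat[OF c(1) zero_carrier_mat zero_carrier_mat c(2)
          c(1) zero_carrier_mat zero_carrier_mat c(2)])
  show "action (M \<oplus>\<^sub>D N) (x * y) = action (M \<oplus>\<^sub>D N) x * action (M \<oplus>\<^sub>D N) y"
    using mult_carrier_mat[OF c(1) c(1), of x y] mult_carrier_mat[OF c(2) c(2), of x y]
    by (simp add: direct_sum_def is_moduleD(3)[OF M] is_moduleD(3)[OF N]
        left_mult_zero_mat[OF c(1)] right_mult_zero_mat[OF c(1)]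
        left_mult_zero_mat[OF c(2)] right_mult_zero_mat[OF c(2)]
        mult_four_block_mat[OF c(1) zero_carrier_mat zero_carrier_mat c(2)
          c(1) zero_carrier_mat zero_carrier_mat c(2)])
  show "action (M \<oplus>\<^sub>D N) (d4_scalar c) = c \<cdot>\<^sub>m 1\<^sub>m (mdim (M \<oplus>\<^sub>D N))"
    by (simp add: direct_sum_def is_moduleD(4)[OF M] is_moduleD(4)[OF N]) (intro eq_matI, auto)
qed

lemma copies_module: "is_module M \<Longrightarrow> is_module (copies n M)"
proof (induction n)
  case 0
  show ?case by (auto simp: is_module_def)
qed (simp add: direct_sum_module)

lemma mdim_copies: "mdim (copies n M) = n * mdim M"
  by (induction n) (simp_all add: direct_sum_def)

lemma block_diag_mult:
  fixes A :: "'k::field mat"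
  assumes "A \<in> carrier_mat m n" "B \<in> carrier_mat m' n'" "C \<in> carrier_mat n l" "D \<in> carrier_mat n' l'"
  shows "four_block_mat A (0\<^sub>m m n') (0\<^sub>m m' n) B * four_block_mat C (0\<^sub>m n l') (0\<^sub>m n' l) D =
    four_block_mat (A * C) (0\<^sub>m m l') (0\<^sub>m m' l) (B * D)"
  using assms mult_carrier_mat[OF assms(1,3)] mult_carrier_mat[OF assms(2,4)]
  by (simp add: mult_four_block_mat[OF assms(1) zero_carrier_mat zero_carrier_mat assms(2)
        assms(3) zero_carrier_mat zero_carrier_mat assms(4)])

lemma direct_sum_iso:
  assumes "M \<cong>\<^sub>D M'" "N \<cong>\<^sub>D N'"
  shows "M \<oplus>\<^sub>D N \<cong>\<^sub>D M' \<oplus>\<^sub>D N'"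
proof -
  obtain f g where m: "is_module M" "is_module M'" and h: "is_hom M M' f" "is_hom M' M g"
    and inv: "g * f = 1\<^sub>m (mdim M)" "f * g = 1\<^sub>m (mdim M')"
    using assms(1) by (auto simp: module_iso_def)
  obtain f' g' where m': "is_module N" "is_module N'" and h': "is_hom N N' f'" "is_hom N' N g'"
    and inv': "g' * f' = 1\<^sub>m (mdim N)" "f' * g' = 1\<^sub>m (mdim N')"
    using assms(2) by (auto simp: module_iso_def)
  note c = is_homD(1)[OF h(1) m] is_homD(1)[OF h(2) m(2,1)]
    is_homD(1)[OF h'(1) m'] is_homD(1)[OF h'(2) m'(2,1)]
  note d = is_moduleD(1)[OF m(1)] is_moduleD(1)[OF m(2)] is_moduleD(1)[OF m'(1)] is_moduleD(1)[OF m'(2)]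
  let ?F = "four_block_mat f (0\<^sub>m (mdim M') (mdim N)) (0\<^sub>m (mdim N') (mdim M)) f'"
  let ?G = "four_block_mat g (0\<^sub>m (mdim M) (mdim N')) (0\<^sub>m (mdim N) (mdim M')) g'"
  have "is_hom (M \<oplus>\<^sub>D N) (M' \<oplus>\<^sub>D N') ?F"
    using c by (simp add: is_hom_def direct_sum_def block_diag_mult[OF c(1) c(3) d(1) d(3)]
        block_diag_mult[OF d(2) d(4) c(1) c(3)] is_homD(2)[OF h(1) m] is_homD(2)[OF h'(1) m'])
  moreover have "is_hom (M' \<oplus>\<^sub>D N') (M \<oplus>\<^sub>D N) ?G"
    using c by (simp add: is_hom_def direct_sum_def block_diag_mult[OF c(2) c(4) d(2) d(4)]
        block_diag_mult[OF d(1) d(3) c(2) c(4)] is_homD(2)[OF h(2) m(2,1)] is_homD(2)[OF h'(2) m'(2,1)])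
  moreover have "?G * ?F = 1\<^sub>m (mdim (M \<oplus>\<^sub>D N))" "?F * ?G = 1\<^sub>m (mdim (M' \<oplus>\<^sub>D N'))"
    using inv inv' by (simp_all add: direct_sum_def block_diag_mult[OF c(2,4,1,3)] block_diag_mult[OF c(1,3,2,4)])
  ultimately show ?thesis
    using m m' by (auto simp: module_iso_def direct_sum_module)
qed

lemma copies_iso: "M \<cong>\<^sub>D N \<Longrightarrow> copies n M \<cong>\<^sub>D copies n N"
proof (induction n)
  case 0
  show ?case
    using copies_module[of M 0] 0 iso_refl[of "copies 0 M"] by (simp add: module_iso_def)
qed (simp add: direct_sum_iso)

text \<open>The map induced by f and g on the two coordinate segments. Its effect is recorded
  through images because it is used to build surjections.\<close>

lemma direct_sum_hom:
  assumes M: "is_module M" and N: "is_module N" and L: "is_module L"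
    and f: "is_hom M L f" and g: "is_hom N L g"
  obtains h where "is_hom (M \<oplus>\<^sub>D N) L h"
    "(*\<^sub>v) f ` mspace M \<subseteq> (*\<^sub>v) h ` mspace (M \<oplus>\<^sub>D N)"
    "(*\<^sub>v) g ` mspace N \<subseteq> (*\<^sub>v) h ` mspace (M \<oplus>\<^sub>D N)"
proof -
  let ?m = "mdim M" and ?n = "mdim N"
  define T where "T v = f *\<^sub>v vec_first v ?m + g *\<^sub>v vec_last v ?n" for v
  note cf = is_homD(1)[OF f M L] and cg = is_homD(1)[OF g N L]
  have dim: "mdim (M \<oplus>\<^sub>D N) = ?m + ?n" by (simp add: direct_sum_def)
  have first: "vec_first (u @\<^sub>v w) ?m = u" and last: "vec_last (u @\<^sub>v w) ?n = w"
    if "u \<in> mspace M" "w \<in> mspace N" for u w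
    using that by (auto simp: vec_first_def vec_last_def)
  have lin: "linear_map (mdim (M \<oplus>\<^sub>D N)) (mdim L) T"
  proof (rule linear_mapI, unfold dim)
    fix u v :: "'a vec" and c
    assume u: "u \<in> carrier_vec (?m + ?n)" and v: "v \<in> carrier_vec (?m + ?n)"
    have plus: "vec_first (u + v) ?m = vec_first u ?m + vec_first v ?m"
      "vec_last (u + v) ?n = vec_last u ?n + vec_last v ?n"
      using u v by (auto simp: vec_first_def vec_last_def)
    have smult: "vec_first (c \<cdot>\<^sub>v v) ?m = c \<cdot>\<^sub>v vec_first v ?m"
      "vec_last (c \<cdot>\<^sub>v v) ?n = c \<cdot>\<^sub>v vec_last v ?n"
      using v by (auto simp: vec_first_def vec_last_def)
    show T: "T v \<in> mspace L" using cf cg by (simp add: T_def)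
    show "T (u + v) = T u + T v"
      using cf cg by (auto simp: T_def plus mult_add_distrib_mat_vec[OF cf] mult_add_distrib_mat_vec[OF cg]
        intro!: eq_vecI)
    show "T (c \<cdot>\<^sub>v v) = c \<cdot>\<^sub>v T v"
      using cf cg by (auto simp: T_def smult mult_mat_vec[OF cf] mult_mat_vec[OF cg] algebra_simps
        intro!: eq_vecI)
  qed
  have com: "T (action (M \<oplus>\<^sub>D N) (d4_gen x) *\<^sub>v v) = action L (d4_gen x) *\<^sub>v T v"
    if v: "v \<in> mspace (M \<oplus>\<^sub>D N)" for x v
  proof -
    let ?u = "vec_first v ?m" and ?w = "vec_last v ?n"
    have "v = ?u @\<^sub>v ?w" using v by (simp add: dim)
    then have "action (M \<oplus>\<^sub>D N) (d4_gen x) *\<^sub>v v =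
        action M (d4_gen x) *\<^sub>v ?u @\<^sub>v action N (d4_gen x) *\<^sub>v ?w"
      using mult_mat_vec_split[OF is_moduleD(1)[OF M] is_moduleD(1)[OF N], of ?u ?w]
      by (simp add: direct_sum_def)
    then have "T (action (M \<oplus>\<^sub>D N) (d4_gen x) *\<^sub>v v) =
        f *\<^sub>v (action M (d4_gen x) *\<^sub>v ?u) + g *\<^sub>v (action N (d4_gen x) *\<^sub>v ?w)"
      by (simp add: T_def first last act_carrier M N)
    also have "\<dots> = action L (d4_gen x) *\<^sub>v T v"
      by (simp add: T_def is_homD(4)[OF f M L] is_homD(4)[OF g N L] act_add_vec[OF L]
          is_homD(3)[OF f M L] is_homD(3)[OF g N L])
    finally show ?thesis .
  qed
  obtain h where h: "is_hom (M \<oplus>\<^sub>D N) L h" "\<And>v. v \<in> mspace (M \<oplus>\<^sub>D N) \<Longrightarrow> h *\<^sub>v v = T v"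
    using linear_hom[OF direct_sum_module[OF M N] L lin com] by blast
  have "f *\<^sub>v u = h *\<^sub>v (u @\<^sub>v 0\<^sub>v ?n)" "u @\<^sub>v 0\<^sub>v ?n \<in> mspace (M \<oplus>\<^sub>D N)" if "u \<in> mspace M" for u
    using that cf cg by (auto simp: h(2) dim T_def first last)
  moreover have "g *\<^sub>v u = h *\<^sub>v (0\<^sub>v ?m @\<^sub>v u)" "0\<^sub>v ?m @\<^sub>v u \<in> mspace (M \<oplus>\<^sub>D N)" if "u \<in> mspace N" for u
    using that cf cg by (auto simp: h(2) dim T_def first last)
  ultimately show ?thesis using h(1) by (intro that[of h]) blast+
qed

text \<open>One summand per vector: each v in S is hit from its own copy of P, and the maps are
  glued by the universal property of the direct sum.\<close>

lemma copies_hom: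
  assumes P: "is_module P" and L: "is_module L"
    and S: "finite S" "\<And>v. v \<in> S \<Longrightarrow> \<exists>f. is_hom P L f \<and> v \<in> (*\<^sub>v) f ` mspace P"
  shows "\<exists>h. is_hom (copies (card S) P) L h \<and> S \<subseteq> (*\<^sub>v) h ` mspace (copies (card S) P)"
  using S
proof (induction S rule: finite_induct)
  case empty
  have "is_hom (copies 0 P) L (0\<^sub>m (mdim L) 0)"
    using carrier_matD(1)[OF is_moduleD(1)[OF L]] by (auto simp: is_hom_def intro!: eq_matI)
  then show ?case by auto
next
  case (insert v S)
  then obtain f h where f: "is_hom P L f" "v \<in> (*\<^sub>v) f ` mspace P"
    and h: "is_hom (copies (card S) P) L h" "S \<subseteq> (*\<^sub>v) h ` mspace (copies (card S) P)"
    by blast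
  obtain k where "is_hom (P \<oplus>\<^sub>D copies (card S) P) L k"
    "(*\<^sub>v) f ` mspace P \<subseteq> (*\<^sub>v) k ` mspace (P \<oplus>\<^sub>D copies (card S) P)"
    "(*\<^sub>v) h ` mspace (copies (card S) P) \<subseteq> (*\<^sub>v) k ` mspace (P \<oplus>\<^sub>D copies (card S) P)"
    using direct_sum_hom[OF P copies_module[OF P] L f(1) h(1)] by blast
  with f(2) h(2) insert.hyps show ?case by (intro exI[of _ k]) auto
qed

section \<open>The syzygies of the simple modules\<close>

declare One_nat_def [simp del]

text \<open>Row i has at most one nonzero entry, namely \<open>e i\<close> in column
  \<open>c i\<close>, so the matrix acts by reading off and scaling single coordinates. Where
  \<open>e i = 0\<close> the value \<open>c i\<close> is irrelevant, which makes truncated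
  subtraction in column indices harmless.\<close>

definition row_mat :: "nat \<Rightarrow> nat \<Rightarrow> (nat \<Rightarrow> nat) \<Rightarrow> (nat \<Rightarrow> 'k::field) \<Rightarrow> 'k mat" where
  "row_mat m n c e = mat m n (\<lambda>(i, j). if j = c i then e i else 0)"

lemma row_mat_carrier: "row_mat m n c e \<in> carrier_mat m n"
  by (simp add: row_mat_def)

lemma row_mat_mult_vec:
  assumes v: "v \<in> carrier_vec n" and c: "\<And>i. i < m \<Longrightarrow> e i \<noteq> 0 \<Longrightarrow> c i < n"
  shows "row_mat m n c e *\<^sub>v v = vec m (\<lambda>i. e i * v $ c i)"
proof (rule eq_vecI)
  fix i assume "i < dim_vec (vec m (\<lambda>i. e i * v $ c i))"
  then have i: "i < m" by simp
  have "(row_mat m n c e *\<^sub>v v) $ i = (\<Sum>j<n. (if j = c i then e i else 0) * v $ j)"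
    using i v by (simp add: row_mat_def scalar_prod_def atLeast0LessThan)
  also have "\<dots> = (\<Sum>j<n. if j = c i then e i * v $ j else 0)"
    by (rule sum.cong) auto
  also have "\<dots> = e i * v $ c i"
    using c[OF i] by (auto simp: sum.delta)
  finally show "(row_mat m n c e *\<^sub>v v) $ i = vec m (\<lambda>i. e i * v $ c i) $ i"
    using i by simp
qed (simp add: row_mat_def)

text \<open>
  The module \<open>\<Omega>\<^sup>s V\<close> has a basis \<open>e\<^sub>0, \<dots>, e\<^sub>s, f\<^sub>0, \<dots>, f\<^bsub>s-1\<^esub>\<close>, listed in this
  order, with \<open>a e\<^sub>i = f\<^sub>i\<close> and \<open>d e\<^sub>i = f\<^bsub>i-1\<^esub>\<close> (out of range: \<open>0\<close>); \<open>b\<close> and \<open>c\<close> act by the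
  sign \<open>\<sigma>\<close> on the \<open>e\<^sub>i\<close> and by \<open>- \<sigma>\<close> on the \<open>f\<^sub>i\<close>.
\<close>

fun syz_gen :: "nat \<Rightarrow> 'k::field \<Rightarrow> gen \<Rightarrow> 'k mat" where
  "syz_gen s \<sigma> GA = row_mat (2 * s + 1) (2 * s + 1) (\<lambda>i. i - (s + 1)) (\<lambda>i. if s < i then 1 else 0)"
| "syz_gen s \<sigma> GD = row_mat (2 * s + 1) (2 * s + 1) (\<lambda>i. i - s) (\<lambda>i. if s < i then 1 else 0)"
| "syz_gen s \<sigma> GB = row_mat (2 * s + 1) (2 * s + 1) (\<lambda>i. i) (\<lambda>i. if s < i then - \<sigma> else \<sigma>)"
| "syz_gen s \<sigma> GC = row_mat (2 * s + 1) (2 * s + 1) (\<lambda>i. i) (\<lambda>i. if s < i then - \<sigma> else \<sigma>)"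

definition syz :: "nat \<Rightarrow> 'k::field \<Rightarrow> 'k d4_module" where
  "syz s \<sigma> = module_of_gens (2 * s + 1) (syz_gen s \<sigma>)"

lemma syz_gen_carrier: "syz_gen s \<sigma> g \<in> carrier_mat (2 * s + 1) (2 * s + 1)"
  by (cases g) (simp_all add: row_mat_carrier del: One_nat_def)

lemma syz_gen_mult:
  assumes "v \<in> carrier_vec (2 * s + 1)"
  shows "syz_gen s \<sigma> GA *\<^sub>v v = vec (2 * s + 1) (\<lambda>i. if s < i then v $ (i - (s + 1)) else 0)"
    "syz_gen s \<sigma> GD *\<^sub>v v = vec (2 * s + 1) (\<lambda>i. if s < i then v $ (i - s) else 0)"
    "syz_gen s \<sigma> GB *\<^sub>v v = vec (2 * s + 1) (\<lambda>i. if s < i then - \<sigma> * v $ i else \<sigma> * v $ i)"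
    "syz_gen s \<sigma> GC *\<^sub>v v = vec (2 * s + 1) (\<lambda>i. if s < i then - \<sigma> * v $ i else \<sigma> * v $ i)"
  using assms by (auto simp: row_mat_mult_vec split: if_splits)

declare syz_gen.simps [simp del]

text \<open>Both sides of da + ad = 1 - bc vanish here: a and d kill the f_i, while bc acts by
  \<sigma> \<sigma> = 1 everywhere.\<close>

lemma syz_rep:
  fixes \<sigma> :: "'k::field"
  assumes \<sigma>: "\<sigma> * \<sigma> = 1"
  shows "d4_rep (2 * s + 1) (syz_gen s \<sigma>)"
proof -
  have \<sigma>': "\<sigma> * (\<sigma> * x) = x" for x using \<sigma> by (simp flip: mult.assoc)
  show ?thesis
    unfolding d4_rep_def
    by (intro conjI allI ballI syz_gen_carrier; intro eq_vecI)
      (auto simp: syz_gen_mult \<sigma>')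
qed

lemma syz_module:
  fixes \<sigma> :: "'k::field"
  assumes \<sigma>: "\<sigma> * \<sigma> = 1"
  shows "is_module (syz s \<sigma>)" "mdim (syz s \<sigma>) = 2 * s + 1"
    "action (syz s \<sigma>) (d4_gen g) = syz_gen s \<sigma> g"
  using module_of_gens[OF syz_rep[OF \<sigma>]] by (simp_all add: syz_def)

text \<open>
  The free module with \<open>n\<close> generators \<open>x\<^sub>i\<close> on which \<open>b\<close> and \<open>c\<close> act by \<open>\<sigma>\<close>; its
  basis consists of the four blocks \<open>x\<^sub>i\<close>, \<open>a x\<^sub>i\<close>, \<open>d x\<^sub>i\<close> and \<open>a d x\<^sub>i = - d a x\<^sub>i\<close>.
\<close>

fun proj_gen :: "nat \<Rightarrow> 'k::field \<Rightarrow> gen \<Rightarrow> 'k mat" where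
  "proj_gen n \<sigma> GA = row_mat (4 * n) (4 * n) (\<lambda>i. i - n)
    (\<lambda>i. if i < n then 0 else if i < 2 * n then 1 else if i < 3 * n then 0 else 1)"
| "proj_gen n \<sigma> GD = row_mat (4 * n) (4 * n) (\<lambda>i. i - 2 * n)
    (\<lambda>i. if i < 2 * n then 0 else if i < 3 * n then 1 else - 1)"
| "proj_gen n \<sigma> GB = row_mat (4 * n) (4 * n) (\<lambda>i. i)
    (\<lambda>i. if i < n then \<sigma> else if i < 3 * n then - \<sigma> else \<sigma>)"
| "proj_gen n \<sigma> GC = row_mat (4 * n) (4 * n) (\<lambda>i. i)
    (\<lambda>i. if i < n then \<sigma> else if i < 3 * n then - \<sigma> else \<sigma>)"

definition proj :: "nat \<Rightarrow> 'k::field \<Rightarrow> 'k d4_module" where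
  "proj n \<sigma> = module_of_gens (4 * n) (proj_gen n \<sigma>)"

lemma proj_gen_carrier: "proj_gen n \<sigma> g \<in> carrier_mat (4 * n) (4 * n)"
  by (cases g) (simp_all add: row_mat_carrier)

lemma proj_gen_mult:
  assumes "v \<in> carrier_vec (4 * n)"
  shows "proj_gen n \<sigma> GA *\<^sub>v v = vec (4 * n) (\<lambda>i. if i < n then 0 else if i < 2 * n then v $ (i - n)
      else if i < 3 * n then 0 else v $ (i - n))"
    "proj_gen n \<sigma> GD *\<^sub>v v = vec (4 * n) (\<lambda>i. if i < 2 * n then 0 else if i < 3 * n then v $ (i - 2 * n)
      else - v $ (i - 2 * n))"
    "proj_gen n \<sigma> GB *\<^sub>v v = vec (4 * n) (\<lambda>i. if i < n then \<sigma> * v $ i else if i < 3 * n then - \<sigma> * v $ i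
      else \<sigma> * v $ i)"
    "proj_gen n \<sigma> GC *\<^sub>v v = vec (4 * n) (\<lambda>i. if i < n then \<sigma> * v $ i else if i < 3 * n then - \<sigma> * v $ i
      else \<sigma> * v $ i)"
  using assms by (auto simp: row_mat_mult_vec split: if_splits)

declare proj_gen.simps [simp del]

section \<open>Block coordinates on the free modules\<close>

definition block :: "nat \<Rightarrow> nat \<Rightarrow> 'k vec \<Rightarrow> 'k vec" where
  "block q n v = vec n (\<lambda>i. v $ (q * n + i))"

lemma block_carrier: "block q n v \<in> carrier_vec n"
  by (simp add: block_def)

lemma dim_block [simp]: "dim_vec (block q n v) = n"
  by (simp add: block_def)

lemma block_linear:
  assumes "u \<in> carrier_vec (4 * n)" "v \<in> carrier_vec (4 * n)" "q < 4"
  shows "block q n (u + v) = block q n u + block q n (v :: 'k::field vec)"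
    "block q n (c \<cdot>\<^sub>v v) = c \<cdot>\<^sub>v block q n v"
proof -
  have "q * n + i < 4 * n" if "i < n" for i
  proof -
    have "q = 0 \<or> q = 1 \<or> q = 2 \<or> q = 3" using assms(3) by linarith
    then show ?thesis using that by auto
  qed
  then show "block q n (u + v) = block q n u + block q n v"
    "block q n (c \<cdot>\<^sub>v v) = c \<cdot>\<^sub>v block q n v"
    using assms(1,2) by (auto simp: block_def)
qed

text \<open>Every generator shifts or scales whole blocks, so relations can be verified block by
  block. The factor -1 for \<open>GD\<close> expresses d a x = - a d x.\<close>

lemma block_act:
  fixes v :: "'k::field vec"
  assumes v: "v \<in> carrier_vec (4 * n)"
  shows "block 0 n (proj_gen n \<sigma> GA *\<^sub>v v) = 0\<^sub>v n"
    "block 1 n (proj_gen n \<sigma> GA *\<^sub>v v) = block 0 n v"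
    "block 2 n (proj_gen n \<sigma> GA *\<^sub>v v) = 0\<^sub>v n"
    "block 3 n (proj_gen n \<sigma> GA *\<^sub>v v) = block 2 n v"
    "block 0 n (proj_gen n \<sigma> GD *\<^sub>v v) = 0\<^sub>v n"
    "block 1 n (proj_gen n \<sigma> GD *\<^sub>v v) = 0\<^sub>v n"
    "block 2 n (proj_gen n \<sigma> GD *\<^sub>v v) = block 0 n v"
    "block 3 n (proj_gen n \<sigma> GD *\<^sub>v v) = (- 1) \<cdot>\<^sub>v block 1 n v"
    "g \<in> {GB, GC} \<Longrightarrow> block 0 n (proj_gen n \<sigma> g *\<^sub>v v) = \<sigma> \<cdot>\<^sub>v block 0 n v"
    "g \<in> {GB, GC} \<Longrightarrow> block 1 n (proj_gen n \<sigma> g *\<^sub>v v) = (- \<sigma>) \<cdot>\<^sub>v block 1 n v"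
    "g \<in> {GB, GC} \<Longrightarrow> block 2 n (proj_gen n \<sigma> g *\<^sub>v v) = (- \<sigma>) \<cdot>\<^sub>v block 2 n v"
    "g \<in> {GB, GC} \<Longrightarrow> block 3 n (proj_gen n \<sigma> g *\<^sub>v v) = \<sigma> \<cdot>\<^sub>v block 3 n v"
  by (auto simp: block_def proj_gen_mult[OF v] intro!: eq_vecI)

lemma block_eqI:
  assumes "u \<in> carrier_vec (4 * n)" "v \<in> carrier_vec (4 * n)"
    and "block 0 n u = block 0 n v" "block 1 n u = block 1 n v"
      "block 2 n u = block 2 n v" "block 3 n u = block 3 n v"
  shows "u = v"
proof (rule eq_vecI)
  have *: "u $ (q * n + i) = v $ (q * n + i)" if "i < n" "block q n u = block q n v" for q i
    using arg_cong[OF that(2), of "\<lambda>v. v $ i"] that(1) by (simp add: block_def)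
  fix i assume "i < dim_vec v"
  then have "i < 4 * n" using assms(2) by simp
  then consider "i < n" | "n \<le> i" "i < 2 * n" | "2 * n \<le> i" "i < 3 * n" | "3 * n \<le> i" "i < 4 * n"
    by linarith
  then show "u $ i = v $ i"
  proof cases
    case 1 then show ?thesis using *[of i 0] assms(3) by simp
  next
    case 2 then show ?thesis using *[of "i - n" 1] assms(4) by simp
  next
    case 3 then show ?thesis using *[of "i - 2 * n" 2] assms(5) by simp
  next
    case 4 then show ?thesis using *[of "i - 3 * n" 3] assms(6) by simp
  qed
qed (use assms in simp)

lemma proj_rep:
  fixes \<sigma> :: "'k::field"
  assumes \<sigma>: "\<sigma> * \<sigma> = 1"
  shows "d4_rep (4 * n) (proj_gen n \<sigma>)"
proof -
  have \<sigma>': "\<sigma> * (\<sigma> * x) = x" for x using \<sigma> by (simp flip: mult.assoc)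
  have c: "proj_gen n \<sigma> g *\<^sub>v v \<in> carrier_vec (4 * n)" if "v \<in> carrier_vec (4 * n)" for g v
    using that mult_mat_vec_carrier[OF proj_gen_carrier] by blast
  have neg: "- v = (- 1) \<cdot>\<^sub>v v" for v :: "'k vec" by (intro eq_vecI) auto
  have zero: "block q n (0\<^sub>v (4 * n)) = (0\<^sub>v n :: 'k vec)" if "q < 4" for q
  proof -
    have "q = 0 \<or> q = 1 \<or> q = 2 \<or> q = 3" using that by linarith
    then show ?thesis by (auto simp: block_def intro!: eq_vecI)
  qed
  have minus: "v - w = v + (- 1) \<cdot>\<^sub>v w" if "v \<in> carrier_vec (4 * n)" "w \<in> carrier_vec (4 * n)" for v w :: "'k vec"
    using that by (intro eq_vecI) auto
  show ?thesis
    unfolding d4_rep_def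
    by (intro conjI allI ballI proj_gen_carrier; rule block_eqI[of _ n])
      (auto simp: c neg minus zero block_act block_linear \<sigma>' \<sigma>
        block_carrier intro!: eq_vecI)
qed

lemma proj_module:
  fixes \<sigma> :: "'k::field"
  assumes \<sigma>: "\<sigma> * \<sigma> = 1"
  shows "is_module (proj n \<sigma>)" "mdim (proj n \<sigma>) = 4 * n"
    "action (proj n \<sigma>) (d4_gen g) = proj_gen n \<sigma> g"
  using module_of_gens[OF proj_rep[OF \<sigma>]] by (simp_all add: proj_def)

lemma proj_act_carrier: "v \<in> carrier_vec (4 * n) \<Longrightarrow> proj_gen n \<sigma> g *\<^sub>v v \<in> carrier_vec (4 * n)"
  by (rule mult_mat_vec_carrier[OF proj_gen_carrier])

text \<open>A homomorphism from the free module to \<open>M\<close> is given by the images of the generators,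
  which are arbitrary vectors of sign \<open>\<sigma>\<close>, here the columns of \<open>X\<close>.\<close>

definition free_map :: "'k::field d4_module \<Rightarrow> nat \<Rightarrow> 'k mat \<Rightarrow> 'k vec \<Rightarrow> 'k vec" where
  "free_map M n X v = X *\<^sub>v block 0 n v + action M (d4_gen GA) *\<^sub>v (X *\<^sub>v block 1 n v)
    + action M (d4_gen GD) *\<^sub>v (X *\<^sub>v block 2 n v)
    + action M (d4_gen GA) *\<^sub>v (action M (d4_gen GD) *\<^sub>v (X *\<^sub>v block 3 n v))"

lemma smult_zero_vec: "k \<cdot>\<^sub>v 0\<^sub>v n = (0\<^sub>v n :: 'k::field vec)"
  by (intro eq_vecI) auto

text \<open>The module \<open>proj n \<sigma>\<close> is induced from n copies of the character of
  the group generated by b and c that sends both to \<sigma>; this is the corresponding Frobenius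
  reciprocity.\<close>

lemma proj_hom:
  fixes M :: "'k::field d4_module" and \<sigma> :: 'k
  assumes \<sigma>: "\<sigma> * \<sigma> = 1" and M: "is_module M" and X: "X \<in> carrier_mat (mdim M) n"
    and sign: "\<And>g p. g \<in> {GB, GC} \<Longrightarrow> p \<in> carrier_vec n \<Longrightarrow>
      action M (d4_gen g) *\<^sub>v (X *\<^sub>v p) = \<sigma> \<cdot>\<^sub>v (X *\<^sub>v p)"
  shows "\<exists>h. is_hom (proj n \<sigma>) M h \<and> (\<forall>v\<in>mspace (proj n \<sigma>). h *\<^sub>v v = free_map M n X v)"
proof (rule linear_hom[OF proj_module(1)[OF \<sigma>] M])
  note P = proj_module[OF \<sigma>]
  let ?A = "\<lambda>v. action M (d4_gen GA) *\<^sub>v v" and ?D = "\<lambda>v. action M (d4_gen GD) *\<^sub>v v"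
  have \<sigma>': "\<sigma> * (\<sigma> * x) = x" for x using \<sigma> by (simp flip: mult.assoc)
  have Xc: "X *\<^sub>v p \<in> mspace M" if "p \<in> carrier_vec n" for p using that X by auto
  note c = act_carrier[OF M] Xc block_carrier
  have rep: "d4_rep (mdim M) (\<lambda>g. action M (d4_gen g))" by (rule module_d4_rep[OF M])
  show "linear_map (mdim (proj n \<sigma>)) (mdim M) (free_map M n X)"
  proof (rule linear_mapI, unfold P)
    fix u v :: "'k vec" and k :: 'k
    assume uv: "u \<in> carrier_vec (4 * n)" "v \<in> carrier_vec (4 * n)"
    show "free_map M n X v \<in> mspace M" by (simp add: free_map_def c)
    show "free_map M n X (u + v) = free_map M n X u + free_map M n X v"
      using uv carrier_vecD[OF Xc[OF block_carrier]] carrier_matD[OF is_moduleD(1)[OF M]] X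
      by (simp add: free_map_def block_linear mult_add_distrib_mat_vec[OF X] act_add_vec[OF M] c)
        (auto intro!: eq_vecI)
    show "free_map M n X (k \<cdot>\<^sub>v v) = k \<cdot>\<^sub>v free_map M n X v"
      using uv carrier_vecD[OF Xc[OF block_carrier]] carrier_matD[OF is_moduleD(1)[OF M]] X
      by (simp add: free_map_def block_linear[OF uv] mult_mat_vec[OF X] act_smult_vec[OF M] c)
        (auto intro!: eq_vecI simp: algebra_simps)
  qed
  fix g and v :: "'k vec"
  assume "v \<in> mspace (proj n \<sigma>)"
  then have v: "v \<in> carrier_vec (4 * n)" by (simp add: P)
  let ?x = "X *\<^sub>v block 0 n v" and ?y = "X *\<^sub>v block 1 n v"
    and ?z = "X *\<^sub>v block 2 n v" and ?w = "X *\<^sub>v block 3 n v"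
  have X0: "X *\<^sub>v 0\<^sub>v n = 0\<^sub>v (mdim M)" using X by auto
  have A0: "action M x *\<^sub>v 0\<^sub>v (mdim M) = 0\<^sub>v (mdim M)" for x using is_moduleD(1)[OF M, of x] by auto
  have rels: "?A (?A u) = 0\<^sub>v (mdim M)" "?D (?D u) = 0\<^sub>v (mdim M)"
    "action M (d4_gen GB) *\<^sub>v (?A u) = - ?A (action M (d4_gen GB) *\<^sub>v u)"
    "action M (d4_gen GC) *\<^sub>v (?A u) = - ?A (action M (d4_gen GC) *\<^sub>v u)"
    "?D (action M (d4_gen GB) *\<^sub>v u) = - (action M (d4_gen GB) *\<^sub>v ?D u)"
    "?D (action M (d4_gen GC) *\<^sub>v u) = - (action M (d4_gen GC) *\<^sub>v ?D u)"
    "?D (?A u) + ?A (?D u) = u - action M (d4_gen GB) *\<^sub>v (action M (d4_gen GC) *\<^sub>v u)"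
    if "u \<in> mspace M" for u
    using rep that by (simp_all add: d4_rep_def)
  have bD: "action M (d4_gen g) *\<^sub>v ?D (X *\<^sub>v p) = (- \<sigma>) \<cdot>\<^sub>v ?D (X *\<^sub>v p)"
    and bA: "action M (d4_gen g) *\<^sub>v ?A (X *\<^sub>v p) = (- \<sigma>) \<cdot>\<^sub>v ?A (X *\<^sub>v p)"
    and bAD: "action M (d4_gen g) *\<^sub>v ?A (?D (X *\<^sub>v p)) = \<sigma> \<cdot>\<^sub>v ?A (?D (X *\<^sub>v p))"
    if p: "p \<in> carrier_vec n" and g: "g \<in> {GB, GC}" for p g
  proof -
    have neg: "- (k \<cdot>\<^sub>v u) = (- k) \<cdot>\<^sub>v u" for u :: "'k vec" and k by (intro eq_vecI) auto
    have D: "?D (action M (d4_gen g) *\<^sub>v u) = - (action M (d4_gen g) *\<^sub>v ?D u)"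
      and A: "action M (d4_gen g) *\<^sub>v ?A u = - ?A (action M (d4_gen g) *\<^sub>v u)" if "u \<in> mspace M" for u
      using g rels(3-6)[OF that] by auto
    have "action M (d4_gen g) *\<^sub>v ?D (X *\<^sub>v p) = - ?D (action M (d4_gen g) *\<^sub>v (X *\<^sub>v p))"
      by (subst D) (simp_all add: c p)
    then show bD: "action M (d4_gen g) *\<^sub>v ?D (X *\<^sub>v p) = (- \<sigma>) \<cdot>\<^sub>v ?D (X *\<^sub>v p)"
      by (simp add: sign[OF g p] act_smult_vec[OF M] c p neg)
    show "action M (d4_gen g) *\<^sub>v ?A (X *\<^sub>v p) = (- \<sigma>) \<cdot>\<^sub>v ?A (X *\<^sub>v p)"
      by (simp add: A sign[OF g p] act_smult_vec[OF M] c p neg)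
    show "action M (d4_gen g) *\<^sub>v ?A (?D (X *\<^sub>v p)) = \<sigma> \<cdot>\<^sub>v ?A (?D (X *\<^sub>v p))"
      by (simp add: A bD act_smult_vec[OF M] c p neg)
  qed
  \<comment> \<open>Where bc acts as the identity, da + ad = 1 - bc becomes anticommutation of a and
    d. Both X p and d X p are such vectors, as \<sigma> and -\<sigma> have square 1.\<close>
  have DA: "?D (?A u) = (- 1) \<cdot>\<^sub>v ?A (?D u)" if u: "u \<in> mspace M" and
    uu: "action M (d4_gen GB) *\<^sub>v (action M (d4_gen GC) *\<^sub>v u) = u" for u
  proof (rule eq_vecI)
    fix i assume i: "i < dim_vec ((- 1) \<cdot>\<^sub>v ?A (?D u))"
    then have "(?D (?A u) + ?A (?D u)) $ i = 0"
      using u carrier_matD[OF is_moduleD(1)[OF M]] unfolding rels(7)[OF u] uu by auto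
    then show "?D (?A u) $ i = ((- 1) \<cdot>\<^sub>v ?A (?D u)) $ i"
      using i by (simp add: eq_neg_iff_add_eq_0 del: index_mult_mat_vec)
  qed (use carrier_matD[OF is_moduleD(1)[OF M]] in auto)
  have DAy: "?D (?A (X *\<^sub>v p)) = (- 1) \<cdot>\<^sub>v ?A (?D (X *\<^sub>v p))" if p: "p \<in> carrier_vec n" for p
    by (rule DA) (use p in \<open>simp_all add: c sign act_smult_vec[OF M] smult_smult_assoc \<sigma>\<close>)
  have DADw: "?D (?A (?D (X *\<^sub>v p))) = 0\<^sub>v (mdim M)" if p: "p \<in> carrier_vec n" for p
  proof -
    have "?D (?A (?D (X *\<^sub>v p))) = (- 1) \<cdot>\<^sub>v ?A (?D (?D (X *\<^sub>v p)))"
      by (rule DA) (use p in \<open>simp_all add: c bD act_smult_vec[OF M] smult_smult_assoc \<sigma>\<close>)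
    then show ?thesis using p by (simp add: rels c A0 smult_zero_vec)
  qed
  have dims: "dim_row (action M x) = mdim M" "dim_row X = mdim M" for x
    using carrier_matD[OF is_moduleD(1)[OF M]] X by auto
  have bX: "action M (d4_gen g) *\<^sub>v (X *\<^sub>v p) = \<sigma> \<cdot>\<^sub>v (X *\<^sub>v p)"
    if "p \<in> carrier_vec n" "g \<in> {GB, GC}" for p g
    by (rule sign) (use that in auto)
  have lin: "action M x *\<^sub>v (free_map M n X v) = action M x *\<^sub>v ?x + action M x *\<^sub>v ?A ?y
      + action M x *\<^sub>v ?D ?z + action M x *\<^sub>v ?A (?D ?w)" for x
    by (simp add: free_map_def act_add_vec[OF M] c)
  show "free_map M n X (action (proj n \<sigma>) (d4_gen g) *\<^sub>v v) = action M (d4_gen g) *\<^sub>v free_map M n X v"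
  proof (cases "g \<in> {GB, GC}")
    case True
    then show ?thesis
      unfolding lin P bD[OF block_carrier True] bA[OF block_carrier True] bAD[OF block_carrier True]
        bX[OF block_carrier True]
      by (simp add: free_map_def block_act[OF v] mult_mat_vec[OF X] act_smult_vec[OF M] c)
  next
    case False
    then consider "g = GA" | "g = GD" by (cases g) auto
    then show ?thesis
    proof cases
      case 1
      show ?thesis
        unfolding 1 lin P
        by (simp add: free_map_def block_act[OF v] rels c X0 A0)
    next
      case 2
      show ?thesis
        unfolding 2 lin P
        by (simp add: free_map_def block_act[OF v] rels c X0 A0 DAy DADw mult_mat_vec[OF X] act_smult_vec[OF M])
    qed
  qed
qed

section \<open>Homomorphisms out of free modules and projectivity\<close>

definition free_gens :: "nat \<Rightarrow> 'k::field mat" where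
  "free_gens n = row_mat (4 * n) n (\<lambda>i. i) (\<lambda>i. if i < n then 1 else 0)"

lemma free_gens_mult:
  assumes "p \<in> carrier_vec n"
  shows "free_gens n *\<^sub>v p = vec (4 * n) (\<lambda>i. if i < n then p $ i else 0)"
proof -
  have "free_gens n *\<^sub>v p = vec (4 * n) (\<lambda>i. (if i < n then 1 else 0) * p $ i)"
    unfolding free_gens_def by (rule row_mat_mult_vec[OF assms]) (simp split: if_splits)
  then show ?thesis by (auto intro!: eq_vecI)
qed

text \<open>The vector is rebuilt from generators by 1, a, d and ad, one per block; this is why a
  homomorphism is determined by its values on the generators.\<close>

lemma proj_decompose:
  fixes v :: "'k::field vec"
  assumes v: "v \<in> carrier_vec (4 * n)"
  shows "v = free_gens n *\<^sub>v block 0 n v + proj_gen n \<sigma> GA *\<^sub>v (free_gens n *\<^sub>v block 1 n v)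
    + proj_gen n \<sigma> GD *\<^sub>v (free_gens n *\<^sub>v block 2 n v)
    + proj_gen n \<sigma> GA *\<^sub>v (proj_gen n \<sigma> GD *\<^sub>v (free_gens n *\<^sub>v block 3 n v))"
proof -
  have c: "free_gens n *\<^sub>v p \<in> carrier_vec (4 * n)" for p :: "'k vec"
    by (intro carrier_vecI) (simp add: free_gens_def row_mat_def)
  have b: "block 0 n (free_gens n *\<^sub>v p) = p" "block 1 n (free_gens n *\<^sub>v p) = 0\<^sub>v n"
    "block 2 n (free_gens n *\<^sub>v p) = 0\<^sub>v n" "block 3 n (free_gens n *\<^sub>v p) = 0\<^sub>v n" if "p \<in> carrier_vec n" for p :: "'k vec"
    using that by (auto simp: block_def free_gens_mult intro!: eq_vecI)
  show ?thesis
    by (rule block_eqI[of _ n])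
      (simp_all add: v c b block_act block_linear block_carrier proj_act_carrier smult_zero_vec)
qed

text \<open>Converse of \<open>proj_hom\<close>: restricting f to the generators gives Y, whose
  columns inherit the sign \<sigma> from the generators.\<close>

lemma proj_hom_free_map:
  assumes \<sigma>: "\<sigma> * \<sigma> = 1" and M: "is_module M" and f: "is_hom (proj n \<sigma>) M f"
  obtains Y where "Y \<in> carrier_mat (mdim M) n"
    "\<And>v. v \<in> mspace (proj n \<sigma>) \<Longrightarrow> f *\<^sub>v v = free_map M n Y v"
    "\<And>g p. g \<in> {GB, GC} \<Longrightarrow> p \<in> carrier_vec n \<Longrightarrow>
      action M (d4_gen g) *\<^sub>v (Y *\<^sub>v p) = \<sigma> \<cdot>\<^sub>v (Y *\<^sub>v (p :: 'k::field vec))"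
proof -
  note P = proj_module[OF \<sigma>]
  let ?inj = "free_gens n :: 'k mat"
  have inj: "?inj \<in> carrier_mat (4 * n) n" by (simp add: free_gens_def row_mat_carrier)
  have cf: "f \<in> carrier_mat (mdim M) (4 * n)" using is_homD(1)[OF f P(1) M] by (simp add: P)
  let ?Y = "f * ?inj"
  have Y: "?Y *\<^sub>v p = f *\<^sub>v (?inj *\<^sub>v p)" if "p \<in> carrier_vec n" for p
    using that by (simp add: assoc_mult_mat_vec[OF cf inj])
  have c: "?inj *\<^sub>v p \<in> carrier_vec (4 * n)" for p
    by (intro carrier_vecI) (simp add: free_gens_def row_mat_def)
  have f': "f *\<^sub>v (proj_gen n \<sigma> g *\<^sub>v v) = action M (d4_gen g) *\<^sub>v (f *\<^sub>v v)"
    if "v \<in> carrier_vec (4 * n)" for g v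
    using is_homD(4)[OF f P(1) M, of v "d4_gen g"] that by (simp add: P)
  show ?thesis
  proof (rule that[of ?Y])
    show "?Y \<in> carrier_mat (mdim M) n" by (rule mult_carrier_mat[OF cf inj])
    show "f *\<^sub>v v = free_map M n ?Y v" if "v \<in> mspace (proj n \<sigma>)" for v
    proof -
      have v: "v \<in> carrier_vec (4 * n)" using that by (simp add: P)
      show ?thesis
        by (subst proj_decompose[OF v, of \<sigma>])
          (simp add: free_map_def Y block_carrier c mult_add_distrib_mat_vec[OF cf] proj_act_carrier f')
    qed
    fix g and p :: "'k vec" assume g: "g \<in> {GB, GC}" and p: "p \<in> carrier_vec n"
    have "proj_gen n \<sigma> g *\<^sub>v (?inj *\<^sub>v p) = \<sigma> \<cdot>\<^sub>v (?inj *\<^sub>v p)"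
      using g p by (auto simp: free_gens_mult proj_gen_mult intro!: eq_vecI)
    then show "action M (d4_gen g) *\<^sub>v (?Y *\<^sub>v p) = \<sigma> \<cdot>\<^sub>v (?Y *\<^sub>v p)"
      using p by (simp add: Y mult_mat_vec[OF cf] c flip: f')
  qed
qed

text \<open>Averaging over the group generated by \<open>b\<close> and \<open>c\<close> projects onto the vectors of sign
  \<open>\<sigma>\<close>; this is where characteristic \<open>2\<close> has to be excluded.\<close>

lemma proj_projective:
  fixes \<sigma> :: "'k::field"
  assumes \<sigma>: "\<sigma> * \<sigma> = 1" and two: "(2 :: 'k) \<noteq> 0"
  shows "projective (proj n \<sigma>)"
  unfolding projective_def
proof (intro conjI allI impI, rule proj_module(1)[OF \<sigma>], elim conjE)
  fix M N :: "'k d4_module" and g f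
  assume M: "is_module M" and N: "is_module N" and gs: "surj_hom M N g" and f: "is_hom (proj n \<sigma>) N f"
  have g: "is_hom M N g" and surj: "(*\<^sub>v) g ` mspace M = mspace N" using gs by (auto simp: surj_hom_def)
  note P = proj_module[OF \<sigma>]
  note cg = is_homD(1)[OF g M N]
  obtain Y where Y: "Y \<in> carrier_mat (mdim N) n"
    "\<And>v. v \<in> mspace (proj n \<sigma>) \<Longrightarrow> f *\<^sub>v v = free_map N n Y v"
    "\<And>g p. g \<in> {GB, GC} \<Longrightarrow> p \<in> carrier_vec n \<Longrightarrow>
      action N (d4_gen g) *\<^sub>v (Y *\<^sub>v p) = \<sigma> \<cdot>\<^sub>v (Y *\<^sub>v p)"
    using proj_hom_free_map[OF \<sigma> N f] by blast
  have "\<exists>w\<in>mspace M. g *\<^sub>v w = Y *\<^sub>v v" if "v \<in> carrier_vec n" for v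
  proof -
    have "Y *\<^sub>v v \<in> mspace N" using that Y(1) by auto
    then show ?thesis using surj by (metis imageE)
  qed
  \<comment> \<open>This lift of Y through g is merely linear; its columns need not have sign
    \<sigma>, which the averaging repairs.\<close>
  then obtain Z where Z: "Z \<in> carrier_mat (mdim M) n" "g * Z = Y"
    by (rule mat_factor[OF Y(1) cg]) blast
  let ?B = "\<lambda>v. action M (d4_gen GB) *\<^sub>v v" and ?C = "\<lambda>v. action M (d4_gen GC) *\<^sub>v v"
  \<comment> \<open>The idempotent (1 + \<sigma> b)(1 + \<sigma> c) / 4; the last coefficient is
    \<sigma> \<sigma> = 1.\<close>
  define avg where "avg v = (1 / 4) \<cdot>\<^sub>v (v + \<sigma> \<cdot>\<^sub>v ?B v + \<sigma> \<cdot>\<^sub>v ?C v + ?B (?C v))" for v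
  have four: "(4 :: 'k) \<noteq> 0" using two by (metis mult_eq_0_iff numeral_Bit0 mult_2 one_add_one)
  have dims: "dim_row (action M x) = mdim M" "dim_row (action N x) = mdim N"
    "dim_row Z = mdim M" "dim_row Y = mdim N" "dim_row g = mdim N" for x
    using carrier_matD[OF is_moduleD(1)[OF M]] carrier_matD[OF is_moduleD(1)[OF N]] Y(1) Z(1) cg by auto
  note c = act_carrier[OF M]
  have Zc: "Z *\<^sub>v p \<in> mspace M" if "p \<in> carrier_vec n" for p using that Z(1) by auto
  have "linear_map n (mdim M) (\<lambda>p. avg (Z *\<^sub>v p))"
  proof (rule linear_mapI)
    fix u v :: "'k vec" and k :: 'k
    assume uv: "u \<in> carrier_vec n" "v \<in> carrier_vec n"
    show "avg (Z *\<^sub>v v) \<in> mspace M" by (simp add: avg_def c Zc uv)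
    show "avg (Z *\<^sub>v (u + v)) = avg (Z *\<^sub>v u) + avg (Z *\<^sub>v v)"
      by (simp add: avg_def mult_add_distrib_mat_vec[OF Z(1)] act_add_vec[OF M] c Zc uv)
        (auto intro!: eq_vecI simp: dims algebra_simps simp del: index_mult_mat_vec)
    show "avg (Z *\<^sub>v (k \<cdot>\<^sub>v v)) = k \<cdot>\<^sub>v avg (Z *\<^sub>v v)"
      by (simp add: avg_def mult_mat_vec[OF Z(1)] act_smult_vec[OF M] c Zc uv)
        (auto intro!: eq_vecI simp: dims algebra_simps simp del: index_mult_mat_vec)
  qed
  then obtain X where X: "X \<in> carrier_mat (mdim M) n" "\<And>p. p \<in> carrier_vec n \<Longrightarrow> X *\<^sub>v p = avg (Z *\<^sub>v p)"
    by (rule linear_map_mat) blast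
  have rels: "?B (?B u) = u" "?C (?C u) = u" "?C (?B u) = ?B (?C u)" if "u \<in> mspace M" for u
    using module_d4_rep[OF M] that by (simp_all add: d4_rep_def)
  have \<sigma>': "\<sigma> * (\<sigma> * x) = x" for x using \<sigma> by (simp flip: mult.assoc)
  have sign: "action M (d4_gen h) *\<^sub>v (X *\<^sub>v p) = \<sigma> \<cdot>\<^sub>v (X *\<^sub>v p)"
    if h: "h \<in> {GB, GC}" and p: "p \<in> carrier_vec n" for h p
  proof -
    have "?B (avg (Z *\<^sub>v p)) = \<sigma> \<cdot>\<^sub>v avg (Z *\<^sub>v p)" "?C (avg (Z *\<^sub>v p)) = \<sigma> \<cdot>\<^sub>v avg (Z *\<^sub>v p)"
      by (simp_all add: avg_def act_add_vec[OF M] act_smult_vec[OF M] c Zc p rels)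
        (auto intro!: eq_vecI simp: dims \<sigma>' algebra_simps simp del: index_mult_mat_vec)
    then show ?thesis using h p by (auto simp: X(2))
  qed
  obtain h where h: "is_hom (proj n \<sigma>) M h" "\<And>v. v \<in> mspace (proj n \<sigma>) \<Longrightarrow> h *\<^sub>v v = free_map M n X v"
    using proj_hom[OF \<sigma> M X(1) sign] by blast
  have gZ: "g *\<^sub>v (Z *\<^sub>v p) = Y *\<^sub>v p" if "p \<in> carrier_vec n" for p
    using that Z(2) by (simp flip: assoc_mult_mat_vec[OF cg Z(1)])
  have Xc: "X *\<^sub>v p \<in> mspace M" if "p \<in> carrier_vec n" for p using that X(1) by auto
  have Yc: "Y *\<^sub>v p \<in> mspace N" if "p \<in> carrier_vec n" for p using that Y(1) by auto
  \<comment> \<open>Since g commutes with b and c, which act on Y p by \<sigma>, averaging Z p does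
    not change its image under g.\<close>
  have gX: "g *\<^sub>v (X *\<^sub>v p) = Y *\<^sub>v p" if p: "p \<in> carrier_vec n" for p
  proof -
    have "g *\<^sub>v (X *\<^sub>v p) = (1 / 4) \<cdot>\<^sub>v (Y *\<^sub>v p + \<sigma> \<cdot>\<^sub>v (\<sigma> \<cdot>\<^sub>v (Y *\<^sub>v p)) + \<sigma> \<cdot>\<^sub>v (\<sigma> \<cdot>\<^sub>v (Y *\<^sub>v p))
        + \<sigma> \<cdot>\<^sub>v (\<sigma> \<cdot>\<^sub>v (Y *\<^sub>v p)))"
      by (simp add: X(2) avg_def p c Zc mult_mat_vec[OF cg] mult_add_distrib_mat_vec[OF cg]
          is_homD(4)[OF g M N] gZ Y(3) act_smult_vec[OF N] Yc)
    also have "\<dots> = Y *\<^sub>v p"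
      using four by (auto intro!: eq_vecI simp: dims \<sigma>' field_simps simp del: index_mult_mat_vec)
    finally show ?thesis .
  qed
  have "g * h = f"
  proof (rule mat_eqI_unit_vec)
    fix j
    let ?v = "unit_vec (mdim (proj n \<sigma>)) j :: 'k vec"
    have "g * h *\<^sub>v ?v = g *\<^sub>v (free_map M n X ?v)"
      using is_homD(1)[OF h(1) P(1) M] by (simp add: assoc_mult_mat_vec[OF cg] h(2))
    also have "\<dots> = free_map N n Y ?v"
      by (simp add: free_map_def mult_add_distrib_mat_vec[OF cg] c Xc block_carrier
          is_homD(4)[OF g M N] gX)
    finally show "g * h *\<^sub>v ?v = f *\<^sub>v ?v" by (simp add: Y(2))
  qed (use is_homD(1)[OF h(1) P(1) M] is_homD(1)[OF f P(1) N] cg in auto)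
  with h(1) show "\<exists>h. is_hom (proj n \<sigma>) M h \<and> g * h = f" by blast
qed

lemma is_submoduleD:
  assumes "is_submodule U M"
  shows "U \<subseteq> mspace M" "0\<^sub>v (mdim M) \<in> U" "\<And>u v. u \<in> U \<Longrightarrow> v \<in> U \<Longrightarrow> u + v \<in> U"
    "\<And>x u. u \<in> U \<Longrightarrow> action M x *\<^sub>v u \<in> U"
  using assms by (auto simp: is_submodule_def)

lemma submodule_smult:
  assumes M: "is_module M" and U: "is_submodule U M" and u: "u \<in> U"
  shows "c \<cdot>\<^sub>v u \<in> U"
  using is_submoduleD(4)[OF U u, of "d4_scalar c"] is_submoduleD(1)[OF U] u
  by (auto simp: act_scalar[OF M])

lemma submodule_minus:
  assumes M: "is_module M" and U: "is_submodule U M" and uv: "u \<in> U" "v \<in> U"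
  shows "u - v \<in> U"
proof -
  have "u - v = u + (- 1) \<cdot>\<^sub>v v"
    using is_submoduleD(1)[OF U] uv by (intro eq_vecI) auto
  then show ?thesis
    using is_submoduleD(3)[OF U uv(1) submodule_smult[OF M U uv(2)]] by simp
qed

text \<open>Nakayama's lemma: vectors whose first block vanishes lie in the radical.\<close>

lemma proj_radical_superfluous:
  fixes \<sigma> :: "'k::field"
  assumes \<sigma>: "\<sigma> * \<sigma> = 1" and U: "is_submodule U (proj n \<sigma>)"
    and sum: "\<And>p. p \<in> carrier_vec (4 * n) \<Longrightarrow> \<exists>u\<in>U. \<exists>w\<in>carrier_vec (4 * n).
      block 0 n w = 0\<^sub>v n \<and> p = u + w"
  shows "U = mspace (proj n \<sigma>)"
proof -
  note P = proj_module[OF \<sigma>]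
  let ?A = "\<lambda>v. proj_gen n \<sigma> GA *\<^sub>v v" and ?D = "\<lambda>v. proj_gen n \<sigma> GD *\<^sub>v v"
  have Uc: "u \<in> carrier_vec (4 * n)" if "u \<in> U" for u
    using that is_submoduleD(1)[OF U] by (auto simp: P)
  have Ua: "proj_gen n \<sigma> g *\<^sub>v u \<in> U" if "u \<in> U" for u g
    using is_submoduleD(4)[OF U that, of "d4_gen g"] by (simp add: P)
  note U_add = is_submoduleD(3)[OF U]
  note linear = mult_add_distrib_mat_vec[OF proj_gen_carrier]
  define ext where "ext p = free_gens n *\<^sub>v p" for p :: "'k vec"
  have ext: "ext p \<in> carrier_vec (4 * n)" for p
    by (intro carrier_vecI) (simp add: ext_def free_gens_def row_mat_def)
  have b: "block 0 n (ext p) = p" "block 1 n (ext p) = 0\<^sub>v n"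
    "block 2 n (ext p) = 0\<^sub>v n" "block 3 n (ext p) = 0\<^sub>v n" if "p \<in> carrier_vec n" for p
    using that by (auto simp: ext_def block_def free_gens_mult intro!: eq_vecI)
  \<comment> \<open>The lowest layer: ad annihilates every w with vanishing first block, so ad p =
    ad u lies in U.\<close>
  have ad: "?A (?D p) \<in> U" if p: "p \<in> carrier_vec (4 * n)" for p
  proof -
    obtain u w where u: "u \<in> U" and w: "w \<in> carrier_vec (4 * n)" "block 0 n w = 0\<^sub>v n" "p = u + w"
      using sum[OF p] by blast
    have "?A (?D w) = 0\<^sub>v (4 * n)"
    proof (rule block_eqI[of _ n])
      have "block q n (0\<^sub>v (4 * n)) = (0\<^sub>v n :: 'k vec)" if "q \<in> {0, 1, 2, 3}" for q
        using that by (auto simp: block_def intro!: eq_vecI)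
      then show "block 0 n (?A (?D w)) = block 0 n (0\<^sub>v (4 * n))"
        "block 1 n (?A (?D w)) = block 1 n (0\<^sub>v (4 * n))"
        "block 2 n (?A (?D w)) = block 2 n (0\<^sub>v (4 * n))"
        "block 3 n (?A (?D w)) = block 3 n (0\<^sub>v (4 * n))"
        using w by (simp_all add: block_act proj_act_carrier)
    qed (use w in \<open>simp_all add: proj_act_carrier\<close>)
    then have "?A (?D p) = ?A (?D u)"
      using w(1) Uc[OF u] proj_act_carrier[OF proj_act_carrier[OF Uc[OF u]]]
      by (simp add: w(3) linear proj_act_carrier)
    then show ?thesis using Ua u by simp
  qed
  \<comment> \<open>The middle layer: with w = a y + d z + ad x one has a w = ad z and d w = - ad y,
    both in U by the previous layer.\<close>
  have rad: "proj_gen n \<sigma> g *\<^sub>v p \<in> U" if p: "p \<in> carrier_vec (4 * n)" and g: "g \<in> {GA, GD}" for p g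
  proof -
    obtain u w where u: "u \<in> U" and w: "w \<in> carrier_vec (4 * n)" "block 0 n w = 0\<^sub>v n" "p = u + w"
      using sum[OF p] by blast
    have "?A w = ?A (?D (ext (block 2 n w)))"
      by (rule block_eqI[of _ n])
        (simp_all add: w block_act proj_act_carrier ext b block_carrier smult_zero_vec)
    moreover have "?D w = ?A (?D (ext ((- 1) \<cdot>\<^sub>v block 1 n w)))"
      by (rule block_eqI[of _ n])
        (simp_all add: w block_act proj_act_carrier ext b block_carrier smult_zero_vec)
    ultimately have "proj_gen n \<sigma> g *\<^sub>v w \<in> U" using g ad ext by auto
    then show ?thesis
      using U_add[OF Ua[OF u]] w(1) Uc[OF u] by (simp add: w(3) linear)
  qed
  have "p \<in> U" if p: "p \<in> carrier_vec (4 * n)" for p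
  proof -
    obtain u w where u: "u \<in> U" and w: "w \<in> carrier_vec (4 * n)" "block 0 n w = 0\<^sub>v n" "p = u + w"
      using sum[OF p] by blast
    have "w = ?A (ext (block 1 n w)) + ?D (ext (block 2 n w)) + ?A (?D (ext (block 3 n w)))"
      by (rule block_eqI[of _ n])
        (simp_all add: w block_act block_linear proj_act_carrier ext b block_carrier smult_zero_vec)
    also have "\<dots> \<in> U"
      by (intro U_add rad ad ext proj_act_carrier) auto
    finally show ?thesis using U_add u w(3) by simp
  qed
  then show ?thesis using is_submoduleD(1)[OF U] by (auto simp: P)
qed

text \<open>The generator x_i is sent to e_i. The vector f_{i-s-1} at position i > s equals both a
  e_{i-s-1} and d e_{i-s}, so it collects the coordinates of a x_{i-s-1} and d x_{i-s}, which stand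
  at positions i and i + s + 2. The first block passes through unchanged, hence it vanishes on the
  kernel, as superfluity requires.\<close>

lemma syz_cover:
  fixes \<sigma> :: "'k::field"
  assumes \<sigma>: "\<sigma> * \<sigma> = 1" and two: "(2 :: 'k) \<noteq> 0"
  obtains \<pi> where "projective_cover (proj (s + 1) \<sigma>) \<pi> (syz s \<sigma>)"
    "\<And>v. v \<in> carrier_vec (4 * (s + 1)) \<Longrightarrow>
      \<pi> *\<^sub>v v = vec (2 * s + 1) (\<lambda>i. if s < i then v $ i + v $ (i + s + 2) else v $ i)"
proof -
  note P = proj_module[OF \<sigma>] and W = syz_module[OF \<sigma>]
  let ?P = "proj (s + 1) \<sigma>" and ?W = "syz s \<sigma>"
  define X where "X = row_mat (2 * s + 1) (s + 1) (\<lambda>i. i) (\<lambda>i. if s < i then 0 else (1 :: 'k))"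
  have X: "X \<in> carrier_mat (mdim ?W) (s + 1)" by (simp add: X_def row_mat_carrier W)
  have Xp: "X *\<^sub>v p = vec (2 * s + 1) (\<lambda>i. if s < i then 0 else p $ i)" if "p \<in> carrier_vec (s + 1)" for p
  proof -
    have "X *\<^sub>v p = vec (2 * s + 1) (\<lambda>i. (if s < i then 0 else 1) * p $ i)"
      unfolding X_def by (rule row_mat_mult_vec[OF that]) (simp split: if_splits)
    then show ?thesis by (auto intro!: eq_vecI)
  qed
  obtain \<pi> where \<pi>: "is_hom ?P ?W \<pi>" "\<And>v. v \<in> mspace ?P \<Longrightarrow> \<pi> *\<^sub>v v = free_map ?W (s + 1) X v"
  proof -
    have "\<exists>h. is_hom ?P ?W h \<and> (\<forall>v\<in>mspace ?P. h *\<^sub>v v = free_map ?W (s + 1) X v)"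
      by (rule proj_hom[OF \<sigma> W(1) X]) (auto simp: W Xp syz_gen_mult intro!: eq_vecI)
    then show ?thesis using that by blast
  qed
  have \<pi>v: "\<pi> *\<^sub>v v = vec (2 * s + 1) (\<lambda>i. if s < i then v $ i + v $ (i + s + 2) else v $ i)"
    if v: "v \<in> carrier_vec (4 * (s + 1))" for v
  proof -
    have "\<pi> *\<^sub>v v = free_map ?W (s + 1) X v" using v by (intro \<pi>(2)) (simp add: P)
    also have "\<dots> = vec (2 * s + 1) (\<lambda>i. if s < i then v $ i + v $ (i + s + 2) else v $ i)"
      unfolding free_map_def W
      by (rule eq_vecI) (auto simp: Xp block_carrier syz_gen_mult block_def ac_simps)
    finally show ?thesis .
  qed
  note c\<pi> = is_homD(1)[OF \<pi>(1) P(1) W(1)]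
  have "projective_cover ?P \<pi> ?W"
    unfolding projective_cover_def
  proof (intro conjI allI impI proj_projective[OF \<sigma> two])
    have "\<exists>v\<in>mspace ?P. \<pi> *\<^sub>v v = z" if z: "z \<in> mspace ?W" for z
    proof
      \<comment> \<open>Uses the x_i and a x_0, ..., a x_{s-1} only: each f_k is reached as a
        e_k.\<close>
      let ?v = "vec (4 * (s + 1)) (\<lambda>i. if i < 2 * s + 1 then z $ i else 0)"
      show "?v \<in> mspace ?P" by (simp add: P)
      show "\<pi> *\<^sub>v ?v = z"
        using z by (subst \<pi>v) (auto simp: W intro!: eq_vecI)
    qed
    then show "surj_hom ?P ?W \<pi>"
      unfolding surj_hom_def using \<pi>(1) is_homD(3)[OF \<pi>(1) P(1) W(1)] by (auto simp: image_iff) 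
  next
    fix U assume U: "is_submodule U ?P \<and> {u + w |u w. u \<in> U \<and> w \<in> mat_kernel \<pi>} = mspace ?P"
    have ker: "w \<in> carrier_vec (4 * (s + 1))" "block 0 (s + 1) w = 0\<^sub>v (s + 1)"
      if w: "w \<in> mat_kernel \<pi>" for w
    proof -
      show wc: "w \<in> carrier_vec (4 * (s + 1))" using mat_kernelD(1)[OF c\<pi> w] by (simp add: P)
      have "\<pi> *\<^sub>v w = 0\<^sub>v (2 * s + 1)" using mat_kernelD(2)[OF c\<pi> w] by (simp add: W)
      then have "(\<pi> *\<^sub>v w) $ i = 0" if "i < s + 1" for i using that by simp
      then show "block 0 (s + 1) w = 0\<^sub>v (s + 1)"
        by (intro eq_vecI) (simp_all add: \<pi>v[OF wc] block_def)
    qed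
    have "\<exists>u\<in>U. \<exists>w\<in>carrier_vec (4 * (s + 1)). block 0 (s + 1) w = 0\<^sub>v (s + 1) \<and> p = u + w"
      if "p \<in> carrier_vec (4 * (s + 1))" for p
    proof -
      have "p \<in> {u + w |u w. u \<in> U \<and> w \<in> mat_kernel \<pi>}" using U that by (simp add: P)
      then show ?thesis using ker by blast
    qed
    then show "U = mspace ?P" using U by (intro proj_radical_superfluous[OF \<sigma>]) auto
  qed
  then show ?thesis using \<pi>v by (rule that)
qed

text \<open>The kernel is a zigzag one step longer, with top d x_0, then d x_k - a x_{k-1} for 1
  \<le> k \<le> s, then - a x_s, and with socle the vectors ad x_k. Its top lies in the blocks of
  sign -\<sigma>, hence the change of sign.\<close>

lemma syz_syzygy:
  fixes \<sigma> :: "'k::field"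
  assumes \<sigma>: "\<sigma> * \<sigma> = 1" and two: "(2 :: 'k) \<noteq> 0"
  shows "is_syzygy (syz (s + 1) (- \<sigma>)) (syz s \<sigma>)"
proof -
  have \<sigma>': "(- \<sigma>) * (- \<sigma>) = 1" using \<sigma> by simp
  note P = proj_module[OF \<sigma>] and W = syz_module[OF \<sigma>] and K = syz_module[OF \<sigma>']
  let ?P = "proj (s + 1) \<sigma>" and ?W = "syz s \<sigma>" and ?K = "syz (s + 1) (- \<sigma>)"
  obtain \<pi> where cover: "projective_cover ?P \<pi> ?W" and \<pi>: "\<And>v. v \<in> carrier_vec (4 * (s + 1)) \<Longrightarrow>
      \<pi> *\<^sub>v v = vec (2 * s + 1) (\<lambda>i. if s < i then v $ i + v $ (i + s + 2) else v $ i)"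
    using syz_cover[OF \<sigma> two] by blast
  \<comment> \<open>The four ranges are the blocks x, ax, dx and adx. In the ax block, position j =
    s + 1 + k takes - z_{k+1}; in the dx block, position 2 s + 2 + k takes z_k; in the last block,
    position 3 s + 3 + k takes the coordinate s + 2 + k of the k-th socle vector.\<close>
  define T where "T z = vec (4 * (s + 1)) (\<lambda>j. if j \<le> s then 0 else if j < 2 * s + 2 then - z $ (j - s)
    else if j < 3 * s + 3 then z $ (j - (2 * s + 2)) else z $ (j - (2 * s + 1)))" for z :: "'k vec"
  have lin: "linear_map (mdim ?K) (mdim ?P) T"
    by (rule linear_mapI) (auto simp: T_def K P algebra_simps intro!: eq_vecI)
  have "T (action ?K (d4_gen g) *\<^sub>v v) = action ?P (d4_gen g) *\<^sub>v T v" if v: "v \<in> mspace ?K" for g v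
  proof -
    have vc: "v \<in> carrier_vec (2 * (s + 1) + 1)" and Tc: "T v \<in> carrier_vec (4 * (s + 1))"
      using v by (simp_all add: K T_def)
    show ?thesis
      unfolding K P
      by (cases g; simp only: syz_gen_mult[OF vc] proj_gen_mult[OF Tc]; rule eq_vecI)
        (auto simp: T_def simp del: add_2_eq_Suc add_2_eq_Suc')
  qed
  then obtain \<iota> where \<iota>: "is_hom ?K ?P \<iota>" "\<And>v. v \<in> mspace ?K \<Longrightarrow> \<iota> *\<^sub>v v = T v"
    using linear_hom[OF K(1) P(1) lin] by blast
  have "inj_on T (mspace ?K)"
  proof (rule inj_onI, rule eq_vecI)
    fix u v i assume uv: "u \<in> mspace ?K" "v \<in> mspace ?K" "T u = T v" and i: "i < dim_vec v"
    have *: "T u $ j = T v $ j" for j using uv(3) by simp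
    \<comment> \<open>The top coordinates up to s are visible in the dx block, the socle in the adx
      block; only the coordinate s + 1, belonging to - a x_s, has to be read from the ax
      block.\<close>
    show "u $ i = v $ i"
    proof (cases "i \<le> s")
      case True
      then show ?thesis using *[of "i + (2 * s + 2)"] by (simp add: T_def)
    next
      case False
      then show ?thesis
        using *[of "i + s"] *[of "i + (2 * s + 1)"] i uv(2)
        by (cases "i = s + 1") (auto simp: T_def K)
    qed
  qed (simp add: K)
  then have inj: "inj_hom ?K ?P \<iota>"
    using \<iota> by (simp add: inj_hom_def cong: inj_on_cong)
  note c\<pi> = projective_coverD(4)[OF cover]
  have "(*\<^sub>v) \<iota> ` mspace ?K = mat_kernel \<pi>"
  proof (intro equalityI subsetI)
    fix w assume "w \<in> (*\<^sub>v) \<iota> ` mspace ?K"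
    then obtain z where z: "z \<in> mspace ?K" "w = T z" using \<iota>(2) by auto
    have Tc: "T z \<in> carrier_vec (4 * (s + 1))" by (simp add: T_def)
    have "\<pi> *\<^sub>v T z = 0\<^sub>v (mdim ?W)"
      unfolding \<pi>[OF Tc] W by (rule eq_vecI) (auto simp: T_def)
    then show "w \<in> mat_kernel \<pi>"
      unfolding z(2) using Tc by (intro mat_kernelI[OF c\<pi>]) (simp_all add: P)
  next
    fix w assume w: "w \<in> mat_kernel \<pi>"
    then have wc: "w \<in> carrier_vec (4 * (s + 1))" using mat_kernelD(1)[OF c\<pi> w] by (simp add: P)
    have "\<pi> *\<^sub>v w = 0\<^sub>v (2 * s + 1)" using mat_kernelD(2)[OF c\<pi> w] by (simp add: W)
    then have "(\<pi> *\<^sub>v w) $ i = 0" if "i < 2 * s + 1" for i using that by simp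
    then have *: "(if s < i then w $ i + w $ (i + s + 2) else w $ i) = 0" if "i < 2 * s + 1" for i
      using that by (simp add: \<pi>[OF wc])
    \<comment> \<open>The inverse reading of T. The ax coordinates it skips are fixed by the kernel
      equations w_j = - w_{j+s+2}.\<close>
    let ?z = "vec (2 * s + 3) (\<lambda>k. if k \<le> s then w $ (k + (2 * s + 2)) else
      if k = s + 1 then - w $ (2 * s + 1) else w $ (k + (2 * s + 1)))"
    have z: "?z \<in> mspace ?K" by (simp add: K)
    have "w = T ?z"
    proof (rule eq_vecI)
      fix j assume "j < dim_vec (T ?z)"
      then have j: "j < 4 * (s + 1)" by (simp add: T_def)
      consider "j \<le> s" | "s < j" "j < 2 * s + 1" | "j = 2 * s + 1"
        | "2 * s + 1 < j" "j < 3 * s + 3" | "3 * s + 3 \<le> j" by linarith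
      then show "w $ j = T ?z $ j"
      proof cases
        case 1
        then show ?thesis using *[of j] by (simp add: T_def)
      next
        case 2
        then have "j - s + (2 * s + 2) = j + s + 2" by simp
        with 2 show ?thesis using *[of j] by (simp add: T_def eq_neg_iff_add_eq_0 ac_simps)
      next
        case 3
        then show ?thesis by (simp add: T_def)
      next
        case 4
        then have "j - (2 * s + 2) \<le> s" "j - (2 * s + 2) + (2 * s + 2) = j" by simp_all
        with 4 show ?thesis by (simp add: T_def del: add_2_eq_Suc add_2_eq_Suc')
      next
        case 5
        have "T z $ j = z $ (j - (2 * s + 1))" for z
          using 5 j by (simp add: T_def)
        moreover obtain m where "j = m + (2 * s + 1)" "s + 2 \<le> m" "m < 2 * s + 3"
          using 5 j by (intro that[of "j - (2 * s + 1)"]) simp_all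
        ultimately show ?thesis by simp
      qed
    qed (use wc in \<open>simp add: T_def\<close>)
    with \<iota>(2)[OF z] have "w = \<iota> *\<^sub>v ?z" by (simp only:)
    then show "w \<in> (*\<^sub>v) \<iota> ` mspace ?K" using z by (rule image_eqI)
  qed
  then show ?thesis
    unfolding is_syzygy_def using K(1) cover inj by blast
qed

section \<open>Identification of the chosen syzygies and covers with the models\<close>

definition bit_sign :: "bit \<Rightarrow> 'k::field" where
  "bit_sign r = (if r = 0 then 1 else - 1)"

lemma bit_sign_mult [simp]: "bit_sign r * bit_sign r = (1 :: 'k::field)"
  by (simp add: bit_sign_def)

lemma bit_sign_add: "bit_sign (r + r') = bit_sign r * (bit_sign r' :: 'k::field)"
  by (cases r; cases r') (simp_all add: bit_sign_def)

lemma simple_V_eq: "simple_V r = syz 0 (bit_sign r :: 'k::field)"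
proof -
  have "(if g \<in> {GB, GC} then if r = 0 then 1 else - 1 else 0) \<cdot>\<^sub>m 1\<^sub>m 1 =
      syz_gen 0 (bit_sign r :: 'k) g" for g :: gen
    by (cases g) (auto simp: syz_gen.simps row_mat_def bit_sign_def intro!: eq_matI)
  then have "(\<lambda>g. (if g \<in> {GB, GC} then if r = 0 then 1 else - 1 else 0) \<cdot>\<^sub>m 1\<^sub>m 1) =
      syz_gen 0 (bit_sign r :: 'k)" by (rule ext)
  then show ?thesis unfolding simple_V_def syz_def by (simp only: mult_0_right add_0)
qed

text \<open>Composing \<pi> with an isomorphism keeps its kernel and its surjectivity, and
  superfluity speaks of the kernel alone.\<close>

lemma projective_cover_iso:
  fixes M :: "'k::field d4_module"
  assumes cover: "projective_cover P \<pi> M'" and M: "is_module M" and M': "is_module M'"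
    and \<phi>: "is_hom M M' \<phi>" and \<psi>: "is_hom M' M \<psi>"
    and inv: "\<psi> * \<phi> = 1\<^sub>m (mdim M)" "\<phi> * \<psi> = 1\<^sub>m (mdim M')"
  shows "mat_kernel (\<psi> * \<pi>) = mat_kernel \<pi>" "projective_cover P (\<psi> * \<pi>) M"
proof -
  note D = projective_coverD[OF cover]
  note cphi = is_homD(1)[OF \<phi> M M'] and cpsi = is_homD(1)[OF \<psi> M' M]
  have \<psi>\<phi>: "\<psi> *\<^sub>v (\<phi> *\<^sub>v v) = v" if "v \<in> mspace M" for v
    using that inv(1) by (simp flip: assoc_mult_mat_vec[OF cpsi cphi])
  have \<phi>\<psi>: "\<phi> *\<^sub>v (\<psi> *\<^sub>v v) = v" if "v \<in> mspace M'" for v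
    using that inv(2) by (simp flip: assoc_mult_mat_vec[OF cphi cpsi])
  have c: "\<psi> * \<pi> \<in> carrier_mat (mdim M) (mdim P)" by (rule mult_carrier_mat[OF cpsi D(4)])
  have v: "\<psi> * \<pi> *\<^sub>v v = \<psi> *\<^sub>v (\<pi> *\<^sub>v v)" if "v \<in> mspace P" for v
    by (rule assoc_mult_mat_vec[OF cpsi D(4) that])
  show ker: "mat_kernel (\<psi> * \<pi>) = mat_kernel \<pi>"
  proof -
    have "\<psi> *\<^sub>v (\<pi> *\<^sub>v v) = 0\<^sub>v (mdim M) \<longleftrightarrow> \<pi> *\<^sub>v v = 0\<^sub>v (mdim M')" if "v \<in> mspace P" for v
    proof
      assume "\<psi> *\<^sub>v (\<pi> *\<^sub>v v) = 0\<^sub>v (mdim M)"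
      then have "\<phi> *\<^sub>v (\<psi> *\<^sub>v (\<pi> *\<^sub>v v)) = 0\<^sub>v (mdim M')" using cphi by auto
      then show "\<pi> *\<^sub>v v = 0\<^sub>v (mdim M')" using that D(4) by (simp add: \<phi>\<psi>)
    qed (use cpsi in auto)
    moreover have "\<psi> *\<^sub>v 0\<^sub>v (mdim M') = 0\<^sub>v (mdim M)" using cpsi by auto
    ultimately show ?thesis by (auto simp: mat_kernel[OF c] mat_kernel[OF D(4)] v)
  qed
  have "\<exists>v\<in>mspace P. \<psi> * \<pi> *\<^sub>v v = m" if m: "m \<in> mspace M" for m
  proof -
    have "\<phi> *\<^sub>v m \<in> mspace M'" using cphi m by auto
    then obtain w where "w \<in> mspace P" "\<pi> *\<^sub>v w = \<phi> *\<^sub>v m" using D(5) by (metis imageE)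
    then show ?thesis using m by (intro bexI[of _ w]) (simp_all add: v \<psi>\<phi>)
  qed
  then have "(*\<^sub>v) (\<psi> * \<pi>) ` mspace P = mspace M"
    using c by (auto simp: image_iff)
  moreover have "is_hom P M (\<psi> * \<pi>)" by (rule is_hom_comp[OF D(2) M' M D(3) \<psi>])
  ultimately show "projective_cover P (\<psi> * \<pi>) M"
    using cover by (simp add: projective_cover_def ker surj_hom_def)
qed

lemma syzygy_iso:
  assumes "is_syzygy K M'" and iso: "M \<cong>\<^sub>D M'"
  shows "is_syzygy K M"
proof -
  obtain P \<pi> \<iota> where K: "is_module K" "inj_hom K P \<iota>" "(*\<^sub>v) \<iota> ` mspace K = mat_kernel \<pi>"
    and P: "projective_cover P \<pi> M'"
    using assms(1) by (auto simp: is_syzygy_def)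
  obtain \<phi> \<psi> where M: "is_module M" and M': "is_module M'"
    and h: "is_hom M M' \<phi>" "is_hom M' M \<psi>" "\<psi> * \<phi> = 1\<^sub>m (mdim M)" "\<phi> * \<psi> = 1\<^sub>m (mdim M')"
    using iso by (auto simp: module_iso_def)
  show ?thesis
    unfolding is_syzygy_def
    using K projective_cover_iso[OF P M M' h] by (metis (no_types))
qed

text \<open>The iterate \<Omega>^s V(r) is known only up to isomorphism, so the syzygy of its model
  is transported by \<open>syzygy_iso\<close> to show that the next choice has a candidate;
  \<open>Omega_iso\<close> then compares the chosen syzygy with the next model.\<close>

lemma Omega_power_simple:
  assumes two: "(2 :: 'k::field) \<noteq> 0"
  shows "(\<Omega> ^^ s) (simple_V r :: 'k d4_module) \<cong>\<^sub>D syz s ((- 1) ^ s * bit_sign r)"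
proof -
  have sq: "(- 1) ^ s * bit_sign r * ((- 1) ^ s * bit_sign r) = (1 :: 'k)" for s
    by (simp add: bit_sign_def minus_one_power_iff)
  show ?thesis
  proof (induction s)
    case 0
    show ?case by (simp add: simple_V_eq iso_refl syz_module(1))
  next
    case (Suc s)
    have syz: "is_syzygy (syz (Suc s) ((- 1) ^ Suc s * bit_sign r)) (syz s ((- 1) ^ s * bit_sign r :: 'k))"
      using syz_syzygy[OF sq two, of s s] by (simp flip: Suc_eq_plus1)
    show ?case
      using Omega_iso[OF syz Suc syzygy_iso[OF syz Suc]] by simp
  qed
qed

text \<open>The zigzag of length 0 is V(r), so its cover by one free generator is a candidate for
  the choice; uniqueness is applied over the identity of V(r).\<close>

lemma proj_P_iso:
  assumes two: "(2 :: 'k::field) \<noteq> 0"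
  shows "proj_P r \<cong>\<^sub>D (proj 1 (bit_sign r) :: 'k d4_module)"
proof -
  let ?V = "simple_V r :: 'k d4_module"
  obtain \<pi> where \<pi>: "projective_cover (proj 1 (bit_sign r)) \<pi> ?V"
    using syz_cover[OF bit_sign_mult two, of 0 r] by (auto simp: simple_V_eq)
  then have "\<exists>\<pi>. projective_cover (proj_P r) \<pi> ?V"
    unfolding proj_P_def by (intro someI[of "\<lambda>Q. \<exists>\<pi>. projective_cover Q \<pi> ?V"]) blast
  then obtain \<pi>' where \<pi>': "projective_cover (proj_P r) \<pi>' ?V" by blast
  have V: "is_module ?V" by (simp add: simple_V_eq syz_module)
  have one: "1\<^sub>m (mdim ?V) * 1\<^sub>m (mdim ?V) = (1\<^sub>m (mdim ?V) :: 'k mat)"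
    by (rule left_mult_one_mat[OF one_carrier_mat])
  obtain h h' where "is_hom (proj_P r) (proj 1 (bit_sign r)) h" "is_hom (proj 1 (bit_sign r)) (proj_P r) h'"
    "h' * h = 1\<^sub>m (mdim (proj_P r :: 'k d4_module))" "h * h' = 1\<^sub>m (mdim (proj 1 (bit_sign r) :: 'k d4_module))"
    "\<pi> * h = 1\<^sub>m (mdim ?V) * \<pi>'"
    by (rule projective_cover_unique[OF \<pi>' \<pi> V V is_hom_one[OF V] is_hom_one[OF V] one one])
  then show ?thesis
    using projective_coverD(2)[OF \<pi>] projective_coverD(2)[OF \<pi>'] unfolding module_iso_def by blast
qed

section \<open>Tensor products\<close>

lemma sum_div_mod:
  "(\<Sum>k<m * n. f (k div n) (k mod n)) = (\<Sum>i<m. \<Sum>j<n. f i j)" for m n :: nat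
proof (cases "n = 0")
  case False
  have "(\<Sum>k<m * n. f (k div n) (k mod n)) = (\<Sum>i<m. \<Sum>k\<in>{i * n..<i * n + n}. f (k div n) (k mod n))"
    by (rule sum.nat_group[symmetric])
  also have "\<dots> = (\<Sum>i<m. \<Sum>j<n. f i j)"
  proof (rule sum.cong[OF refl])
    fix i
    have "(\<Sum>k\<in>{i * n..<i * n + n}. f (k div n) (k mod n)) =
        (\<Sum>j\<in>{0..<n}. f ((j + i * n) div n) ((j + i * n) mod n))"
      using sum.shift_bounds_nat_ivl[of "\<lambda>k. f (k div n) (k mod n)" 0 "i * n" n] by (simp add: add.commute)
    also have "\<dots> = (\<Sum>j<n. f i j)"
      using False by (intro sum.cong) auto
    finally show "(\<Sum>k\<in>{i * n..<i * n + n}. f (k div n) (k mod n)) = (\<Sum>j<n. f i j)" .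
  qed
  finally show ?thesis .
qed simp

definition vtensor :: "'k::field vec \<Rightarrow> 'k vec \<Rightarrow> 'k vec" where
  "vtensor u v = vec (dim_vec u * dim_vec v) (\<lambda>k. u $ (k div dim_vec v) * v $ (k mod dim_vec v))"

lemma dim_vtensor [simp]: "dim_vec (vtensor u v) = dim_vec u * dim_vec v"
  by (simp add: vtensor_def)

lemma vtensor_carrier: "u \<in> carrier_vec m \<Longrightarrow> v \<in> carrier_vec n \<Longrightarrow> vtensor u v \<in> carrier_vec (m * n)"
  by (intro carrier_vecI) simp

lemma div_mod_less: "k < m * n \<Longrightarrow> k div n < m" "k < m * n \<Longrightarrow> k mod n < n" for k m n :: nat
  by (auto simp: less_mult_imp_div_less) (metis mod_less_divisor mult_0_right not_gr_zero not_less_zero)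

lemma index_vtensor:
  "u \<in> carrier_vec m \<Longrightarrow> v \<in> carrier_vec n \<Longrightarrow> k < m * n \<Longrightarrow>
    vtensor u v $ k = u $ (k div n) * v $ (k mod n)"
  by (simp add: vtensor_def)

lemma unit_vec_vtensor:
  "k < m * n \<Longrightarrow> unit_vec (m * n) k = vtensor (unit_vec m (k div n)) (unit_vec n (k mod n))"
  by (rule eq_vecI) (auto simp: vtensor_def div_mod_less, metis div_mult_mod_eq)

lemma kron_carrier: "A \<in> carrier_mat m m' \<Longrightarrow> B \<in> carrier_mat n n' \<Longrightarrow> kron A B \<in> carrier_mat (m * n) (m' * n')"
  by (auto simp: kron_def)

lemma kron_vtensor:
  assumes A: "A \<in> carrier_mat m m'" and B: "B \<in> carrier_mat n n'"
    and u: "u \<in> carrier_vec m'" and v: "v \<in> carrier_vec n'"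
  shows "kron A B *\<^sub>v vtensor u v = vtensor (A *\<^sub>v u) (B *\<^sub>v v)"
proof (rule eq_vecI)
  fix k assume "k < dim_vec (vtensor (A *\<^sub>v u) (B *\<^sub>v v))"
  then have k: "k < m * n" using A B by simp
  note k' = div_mod_less[OF k]
  have "(kron A B *\<^sub>v vtensor u v) $ k =
      (\<Sum>l<m' * n'. (A $$ (k div n, l div n') * B $$ (k mod n, l mod n')) * (u $ (l div n') * v $ (l mod n')))"
    using A B u v k by (simp add: kron_def vtensor_def scalar_prod_def atLeast0LessThan)
  also have "\<dots> = (\<Sum>i<m'. \<Sum>j<n'. (A $$ (k div n, i) * B $$ (k mod n, j)) * (u $ i * v $ j))"
    by (rule sum_div_mod)
  also have "\<dots> = (\<Sum>i<m'. A $$ (k div n, i) * u $ i) * (\<Sum>j<n'. B $$ (k mod n, j) * v $ j)"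
    by (simp add: sum_product ac_simps)
  also have "\<dots> = vtensor (A *\<^sub>v u) (B *\<^sub>v v) $ k"
    using A B u v k k' by (simp add: vtensor_def scalar_prod_def atLeast0LessThan)
  finally show "(kron A B *\<^sub>v vtensor u v) $ k = vtensor (A *\<^sub>v u) (B *\<^sub>v v) $ k" .
qed (use A B in \<open>simp add: kron_def\<close>)

text \<open>Unit vectors of the product space are pure tensors, so linear identities need checking
  on pure tensors only. Calculations with Kronecker products thereby move into the two
  factors.\<close>

lemma linear_eq_vtensor:
  fixes S T :: "'k::field vec \<Rightarrow> 'k vec"
  assumes S: "linear_map (m * n) l S" and T: "linear_map (m * n) l T"
    and eq: "\<And>u v. u \<in> carrier_vec m \<Longrightarrow> v \<in> carrier_vec n \<Longrightarrow> S (vtensor u v) = T (vtensor u v)"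
  shows "\<forall>v\<in>carrier_vec (m * n). S v = T v"
proof -
  obtain A where A: "A \<in> carrier_mat l (m * n)" "\<And>v. v \<in> carrier_vec (m * n) \<Longrightarrow> A *\<^sub>v v = S v"
    using S by (rule linear_map_mat) blast
  obtain B where B: "B \<in> carrier_mat l (m * n)" "\<And>v. v \<in> carrier_vec (m * n) \<Longrightarrow> B *\<^sub>v v = T v"
    using T by (rule linear_map_mat) blast
  have "A = B"
    using A B eq by (intro mat_eqI_unit_vec[OF A(1) B(1)])
      (simp add: unit_vec_vtensor vtensor_carrier)
  with A B show ?thesis by auto
qed

lemma linear_map_id: "linear_map n n (\<lambda>v. v)"
  by (simp add: linear_map_def)

lemma linear_map_comp:
  "A \<in> carrier_mat l m \<Longrightarrow> linear_map n m S \<Longrightarrow> linear_map n l (\<lambda>v. A *\<^sub>v S v)"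
  by (simp add: linear_map_def mult_add_distrib_mat_vec mult_mat_vec)

lemma linear_map_zero: "linear_map n m (\<lambda>v. 0\<^sub>v m)"
  by (auto simp: linear_map_def intro!: eq_vecI)

lemma linear_map_uminus:
  assumes "linear_map n m S"
  shows "linear_map n m (\<lambda>v. - S v)"
proof (rule linear_mapI)
  fix u v :: "'a vec" and c assume uv: "u \<in> carrier_vec n" "v \<in> carrier_vec n"
  have d: "S u \<in> carrier_vec m" "S v \<in> carrier_vec m"
    using assms uv by (auto simp: linear_map_def)
  then show "- S v \<in> carrier_vec m" by simp
  show "- S (u + v) = - S u + - S v"
    by (rule eq_vecI) (use assms uv in \<open>simp_all add: linear_map_def d[THEN carrier_vecD]\<close>)
  show "- S (c \<cdot>\<^sub>v v) = c \<cdot>\<^sub>v (- S v)"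
    by (rule eq_vecI) (use assms uv in \<open>simp_all add: linear_map_def d[THEN carrier_vecD]\<close>)
qed

lemma linear_map_add:
  assumes "linear_map n m S" "linear_map n m T"
  shows "linear_map n m (\<lambda>v. S v + T v)"
proof (rule linear_mapI)
  fix u v :: "'a vec" and c assume uv: "u \<in> carrier_vec n" "v \<in> carrier_vec n"
  have d: "S u \<in> carrier_vec m" "S v \<in> carrier_vec m" "T u \<in> carrier_vec m" "T v \<in> carrier_vec m"
    using assms uv by (auto simp: linear_map_def)
  then show "S v + T v \<in> carrier_vec m" by simp
  show "S (u + v) + T (u + v) = S u + T u + (S v + T v)"
    by (rule eq_vecI) (use assms uv in \<open>simp_all add: linear_map_def d[THEN carrier_vecD]\<close>)
  show "S (c \<cdot>\<^sub>v v) + T (c \<cdot>\<^sub>v v) = c \<cdot>\<^sub>v (S v + T v)"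
    by (rule eq_vecI) (use assms uv in \<open>simp_all add: linear_map_def d[THEN carrier_vecD] algebra_simps\<close>)
qed

lemma linear_map_minus:
  assumes "linear_map n m S" "linear_map n m T"
  shows "linear_map n m (\<lambda>v. S v - T v)"
proof (rule linear_mapI)
  fix u v :: "'a vec" and c assume uv: "u \<in> carrier_vec n" "v \<in> carrier_vec n"
  have d: "S u \<in> carrier_vec m" "S v \<in> carrier_vec m" "T u \<in> carrier_vec m" "T v \<in> carrier_vec m"
    using assms uv by (auto simp: linear_map_def)
  then show "S v - T v \<in> carrier_vec m" by simp
  show "S (u + v) - T (u + v) = S u - T u + (S v - T v)"
    by (rule eq_vecI) (use assms uv in \<open>simp_all add: linear_map_def d[THEN carrier_vecD]\<close>)
  show "S (c \<cdot>\<^sub>v v) - T (c \<cdot>\<^sub>v v) = c \<cdot>\<^sub>v (S v - T v)"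
    by (rule eq_vecI) (use assms uv in \<open>simp_all add: linear_map_def d[THEN carrier_vecD] algebra_simps\<close>)
qed

section \<open>The module structure through the comultiplication\<close>

definition tensor_gen :: "'k::field d4_module \<Rightarrow> 'k d4_module \<Rightarrow> gen \<Rightarrow> 'k mat" where
  "tensor_gen M N g = foldr (\<lambda>(x, y) A. kron (action M x) (action N y) + A) (comult_gen g)
     (0\<^sub>m (mdim M * mdim N) (mdim M * mdim N))"

lemma tensor_gen_simps:
  assumes M: "is_module M" and N: "is_module N"
  shows "tensor_gen M N GA = kron (action M (d4_gen GA)) (action N (d4_gen GB))
      + kron (1\<^sub>m (mdim M)) (action N (d4_gen GA))"
    "tensor_gen M N GB = kron (action M (d4_gen GB)) (action N (d4_gen GB))"
    "tensor_gen M N GC = kron (action M (d4_gen GC)) (action N (d4_gen GC))"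
    "tensor_gen M N GD = kron (action M (d4_gen GD)) (action N (d4_gen GC))
      + kron (1\<^sub>m (mdim M)) (action N (d4_gen GD))"
proof -
  have one: "action M 1 = 1\<^sub>m (mdim M)"
    using is_moduleD(4)[OF M, of 1] by (auto simp: d4_scalar_1 intro!: eq_matI)
  note c = kron_carrier[OF is_moduleD(1)[OF M] is_moduleD(1)[OF N]]
    kron_carrier[OF one_carrier_mat is_moduleD(1)[OF N]]
  show "tensor_gen M N GA = kron (action M (d4_gen GA)) (action N (d4_gen GB))
      + kron (1\<^sub>m (mdim M)) (action N (d4_gen GA))"
    "tensor_gen M N GB = kron (action M (d4_gen GB)) (action N (d4_gen GB))"
    "tensor_gen M N GC = kron (action M (d4_gen GC)) (action N (d4_gen GC))"
    "tensor_gen M N GD = kron (action M (d4_gen GD)) (action N (d4_gen GC))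
      + kron (1\<^sub>m (mdim M)) (action N (d4_gen GD))"
    using c by (simp_all add: tensor_gen_def one)
qed

lemma tensor_gen_carrier:
  assumes M: "is_module M" and N: "is_module N"
  shows "tensor_gen M N g \<in> carrier_mat (mdim M * mdim N) (mdim M * mdim N)"
  using kron_carrier[OF is_moduleD(1)[OF M] is_moduleD(1)[OF N]]
    kron_carrier[OF one_carrier_mat is_moduleD(1)[OF N]]
  by (cases g) (simp_all add: tensor_gen_simps[OF M N])

lemma tensor_gen_vtensor:
  assumes M: "is_module M" and N: "is_module N" and u: "u \<in> mspace M" and v: "v \<in> mspace N"
  shows "tensor_gen M N GA *\<^sub>v vtensor u v =
      vtensor (action M (d4_gen GA) *\<^sub>v u) (action N (d4_gen GB) *\<^sub>v v) + vtensor u (action N (d4_gen GA) *\<^sub>v v)"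
    "tensor_gen M N GB *\<^sub>v vtensor u v = vtensor (action M (d4_gen GB) *\<^sub>v u) (action N (d4_gen GB) *\<^sub>v v)"
    "tensor_gen M N GC *\<^sub>v vtensor u v = vtensor (action M (d4_gen GC) *\<^sub>v u) (action N (d4_gen GC) *\<^sub>v v)"
    "tensor_gen M N GD *\<^sub>v vtensor u v =
      vtensor (action M (d4_gen GD) *\<^sub>v u) (action N (d4_gen GC) *\<^sub>v v) + vtensor u (action N (d4_gen GD) *\<^sub>v v)"
  using u v
  by (simp_all add: tensor_gen_simps[OF M N] vtensor_carrier
      add_mult_distrib_mat_vec[OF kron_carrier[OF is_moduleD(1)[OF M] is_moduleD(1)[OF N]]
        kron_carrier[OF one_carrier_mat is_moduleD(1)[OF N]]]
      kron_vtensor[OF is_moduleD(1)[OF M] is_moduleD(1)[OF N]]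
      kron_vtensor[OF one_carrier_mat is_moduleD(1)[OF N]])

text \<open>This is the fact that the comultiplication respects the relations. In the relation for
  da + ad the mixed terms cancel because ca = -ac and db = -bd, and the rest is (1 - bc) \<otimes>
  bc + 1 \<otimes> (1 - bc) = 1 \<otimes> 1 - bc \<otimes> bc.\<close>

lemma tensor_rep:
  fixes M N :: "'k::field d4_module"
  assumes M: "is_module M" and N: "is_module N"
  shows "d4_rep (mdim M * mdim N) (tensor_gen M N)"
proof -
  let ?m = "mdim M" and ?n = "mdim N"
  note c = tensor_gen_carrier[OF M N]
  note lin = linear_map_comp[OF c] linear_map_uminus linear_map_add linear_map_minus
    linear_map_zero linear_map_id
  \<comment> \<open>Relations oriented for rewriting. \<open>DA\<close> solves the last one for d a,
    and has c b in place of b c because \<open>R\<close> turns the latter into the former.\<close>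
  have R: "action M (d4_gen GB) *\<^sub>v (action M (d4_gen GA) *\<^sub>v u) = - (action M (d4_gen GA) *\<^sub>v (action M (d4_gen GB) *\<^sub>v u))"
    "action M (d4_gen GD) *\<^sub>v (action M (d4_gen GB) *\<^sub>v u) = - (action M (d4_gen GB) *\<^sub>v (action M (d4_gen GD) *\<^sub>v u))"
    "action M (d4_gen GC) *\<^sub>v (action M (d4_gen GA) *\<^sub>v u) = - (action M (d4_gen GA) *\<^sub>v (action M (d4_gen GC) *\<^sub>v u))"
    "action M (d4_gen GD) *\<^sub>v (action M (d4_gen GC) *\<^sub>v u) = - (action M (d4_gen GC) *\<^sub>v (action M (d4_gen GD) *\<^sub>v u))"
    "action M (d4_gen GB) *\<^sub>v (action M (d4_gen GC) *\<^sub>v u) = action M (d4_gen GC) *\<^sub>v (action M (d4_gen GB) *\<^sub>v u)"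
    "action M (d4_gen GA) *\<^sub>v (action M (d4_gen GA) *\<^sub>v u) = 0\<^sub>v (mdim M)"
    "action M (d4_gen GB) *\<^sub>v (action M (d4_gen GB) *\<^sub>v u) = u"
    "action M (d4_gen GC) *\<^sub>v (action M (d4_gen GC) *\<^sub>v u) = u"
    "action M (d4_gen GD) *\<^sub>v (action M (d4_gen GD) *\<^sub>v u) = 0\<^sub>v (mdim M)"
    and DA: "action M (d4_gen GD) *\<^sub>v (action M (d4_gen GA) *\<^sub>v u) =
      u - action M (d4_gen GC) *\<^sub>v (action M (d4_gen GB) *\<^sub>v u) - action M (d4_gen GA) *\<^sub>v (action M (d4_gen GD) *\<^sub>v u)"
    if "is_module M" "u \<in> mspace M" for M :: "'k d4_module" and u
  proof -
    note r = module_d4_rep[OF that(1)]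
    show "action M (d4_gen GB) *\<^sub>v (action M (d4_gen GA) *\<^sub>v u) = - (action M (d4_gen GA) *\<^sub>v (action M (d4_gen GB) *\<^sub>v u))"
      "action M (d4_gen GD) *\<^sub>v (action M (d4_gen GB) *\<^sub>v u) = - (action M (d4_gen GB) *\<^sub>v (action M (d4_gen GD) *\<^sub>v u))"
      "action M (d4_gen GC) *\<^sub>v (action M (d4_gen GA) *\<^sub>v u) = - (action M (d4_gen GA) *\<^sub>v (action M (d4_gen GC) *\<^sub>v u))"
      "action M (d4_gen GD) *\<^sub>v (action M (d4_gen GC) *\<^sub>v u) = - (action M (d4_gen GC) *\<^sub>v (action M (d4_gen GD) *\<^sub>v u))"
      "action M (d4_gen GB) *\<^sub>v (action M (d4_gen GC) *\<^sub>v u) = action M (d4_gen GC) *\<^sub>v (action M (d4_gen GB) *\<^sub>v u)"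
      "action M (d4_gen GA) *\<^sub>v (action M (d4_gen GA) *\<^sub>v u) = 0\<^sub>v (mdim M)"
      "action M (d4_gen GB) *\<^sub>v (action M (d4_gen GB) *\<^sub>v u) = u"
      "action M (d4_gen GC) *\<^sub>v (action M (d4_gen GC) *\<^sub>v u) = u"
      "action M (d4_gen GD) *\<^sub>v (action M (d4_gen GD) *\<^sub>v u) = 0\<^sub>v (mdim M)"
      using r that(2) by (simp_all add: d4_rep_def)
    have e: "action M (d4_gen GD) *\<^sub>v (action M (d4_gen GA) *\<^sub>v u) + action M (d4_gen GA) *\<^sub>v (action M (d4_gen GD) *\<^sub>v u) =
        u - action M (d4_gen GC) *\<^sub>v (action M (d4_gen GB) *\<^sub>v u)"
      using r that(2) by (simp add: d4_rep_def)
    have cc: "action M (d4_gen g) *\<^sub>v (action M (d4_gen h) *\<^sub>v u) \<in> mspace M" for g h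
      by (intro act_carrier that)
    show "action M (d4_gen GD) *\<^sub>v (action M (d4_gen GA) *\<^sub>v u) =
      u - action M (d4_gen GC) *\<^sub>v (action M (d4_gen GB) *\<^sub>v u) - action M (d4_gen GA) *\<^sub>v (action M (d4_gen GD) *\<^sub>v u)"
      unfolding e[symmetric] using cc[of GD GA] cc[of GA GD]
      by (intro eq_vecI) (simp_all del: index_mult_mat_vec dim_mult_mat_vec)
  qed
  have dims: "dim_row (action M x) = mdim M" if "is_module M" for M :: "'k d4_module" and x
    using carrier_matD[OF is_moduleD(1)[OF that]] by auto
  note simps = tensor_gen_vtensor[OF M N] mult_add_distrib_mat_vec[OF c] vtensor_carrier
    act_carrier[OF M] act_carrier[OF N] R[OF M] R[OF N]
  note index = index_vtensor[of _ ?m _ ?n] div_mod_less[of _ ?m ?n] act_carrier[OF M] act_carrier[OF N]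
    dims[OF M] dims[OF N]
  have L: "linear_map (?m * ?n) (?m * ?n) (\<lambda>v. tensor_gen M N g *\<^sub>v (tensor_gen M N h *\<^sub>v v))" for g h
    by (intro lin)
  show ?thesis
    unfolding d4_rep_def ball_conj_distrib
  proof (intro conjI allI c)
    show "\<forall>v\<in>carrier_vec (?m * ?n). tensor_gen M N GB *\<^sub>v (tensor_gen M N GA *\<^sub>v v) =
        - (tensor_gen M N GA *\<^sub>v (tensor_gen M N GB *\<^sub>v v))"
      "\<forall>v\<in>carrier_vec (?m * ?n). tensor_gen M N GD *\<^sub>v (tensor_gen M N GB *\<^sub>v v) =
        - (tensor_gen M N GB *\<^sub>v (tensor_gen M N GD *\<^sub>v v))"
      "\<forall>v\<in>carrier_vec (?m * ?n). tensor_gen M N GC *\<^sub>v (tensor_gen M N GA *\<^sub>v v) =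
        - (tensor_gen M N GA *\<^sub>v (tensor_gen M N GC *\<^sub>v v))"
      "\<forall>v\<in>carrier_vec (?m * ?n). tensor_gen M N GD *\<^sub>v (tensor_gen M N GC *\<^sub>v v) =
        - (tensor_gen M N GC *\<^sub>v (tensor_gen M N GD *\<^sub>v v))"
      by (rule linear_eq_vtensor[OF L linear_map_uminus[OF L]], simp add: simps,
          rule eq_vecI, simp_all add: index dims M N del: index_mult_mat_vec)+
    show "\<forall>v\<in>carrier_vec (?m * ?n). tensor_gen M N GB *\<^sub>v (tensor_gen M N GC *\<^sub>v v) =
        tensor_gen M N GC *\<^sub>v (tensor_gen M N GB *\<^sub>v v)"
      by (rule linear_eq_vtensor[OF L L]) (simp add: simps)
    show "\<forall>v\<in>carrier_vec (?m * ?n). tensor_gen M N GB *\<^sub>v (tensor_gen M N GB *\<^sub>v v) = v"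
      "\<forall>v\<in>carrier_vec (?m * ?n). tensor_gen M N GC *\<^sub>v (tensor_gen M N GC *\<^sub>v v) = v"
      by (rule linear_eq_vtensor[OF L linear_map_id], simp add: simps)+
    show "\<forall>v\<in>carrier_vec (?m * ?n). tensor_gen M N GA *\<^sub>v (tensor_gen M N GA *\<^sub>v v) = 0\<^sub>v (?m * ?n)"
      "\<forall>v\<in>carrier_vec (?m * ?n). tensor_gen M N GD *\<^sub>v (tensor_gen M N GD *\<^sub>v v) = 0\<^sub>v (?m * ?n)"
      by (rule linear_eq_vtensor[OF L linear_map_zero], simp add: simps,
          rule eq_vecI, simp_all add: index dims M N del: index_mult_mat_vec)+
    show "\<forall>v\<in>carrier_vec (?m * ?n). tensor_gen M N GD *\<^sub>v (tensor_gen M N GA *\<^sub>v v) +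
        tensor_gen M N GA *\<^sub>v (tensor_gen M N GD *\<^sub>v v) = v - tensor_gen M N GB *\<^sub>v (tensor_gen M N GC *\<^sub>v v)"
      by (rule linear_eq_vtensor[OF linear_map_add[OF L L] linear_map_minus[OF linear_map_id L]],
          simp add: simps DA[OF M] DA[OF N],
          rule eq_vecI, simp_all add: index dims M N algebra_simps del: index_mult_mat_vec)
  qed
qed

lemma tensor_module:
  assumes M: "is_module M" and N: "is_module N"
  shows "is_module (M \<otimes>\<^sub>D N)" "mdim (M \<otimes>\<^sub>D N) = mdim M * mdim N"
    "action (M \<otimes>\<^sub>D N) (d4_gen g) = tensor_gen M N g"
proof -
  have "M \<otimes>\<^sub>D N = module_of_gens (mdim M * mdim N) (tensor_gen M N)"
    unfolding tensor_def tensor_gen_def ..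
  then show "is_module (M \<otimes>\<^sub>D N)" "mdim (M \<otimes>\<^sub>D N) = mdim M * mdim N"
    "action (M \<otimes>\<^sub>D N) (d4_gen g) = tensor_gen M N g"
    using module_of_gens[OF tensor_rep[OF M N]] by simp_all
qed

lemma tensor_hom:
  assumes M: "is_module M" "is_module M'" and N: "is_module N" "is_module N'"
    and f: "is_hom M M' f" and g: "is_hom N N' g"
  shows "is_hom (M \<otimes>\<^sub>D N) (M' \<otimes>\<^sub>D N') (kron f g)"
proof (rule is_hom_gensI[OF tensor_module(1) tensor_module(1)])
  note cf = is_homD(1)[OF f M] and cg = is_homD(1)[OF g N]
  have c: "kron f g \<in> carrier_mat (mdim M' * mdim N') (mdim M * mdim N)"
    by (rule kron_carrier[OF cf cg])
  then show "kron f g \<in> carrier_mat (mdim (M' \<otimes>\<^sub>D N')) (mdim (M \<otimes>\<^sub>D N))"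
    by (simp add: tensor_module M N)
  fix x v assume "v \<in> mspace (M \<otimes>\<^sub>D N)"
  then have v: "v \<in> carrier_vec (mdim M * mdim N)" by (simp add: tensor_module M N)
  have "\<forall>v\<in>carrier_vec (mdim M * mdim N).
    kron f g *\<^sub>v (tensor_gen M N x *\<^sub>v v) = tensor_gen M' N' x *\<^sub>v (kron f g *\<^sub>v v)"
  proof (rule linear_eq_vtensor)
    show "linear_map (mdim M * mdim N) (mdim M' * mdim N') (\<lambda>v. kron f g *\<^sub>v (tensor_gen M N x *\<^sub>v v))"
      by (intro linear_map_comp[OF c] linear_map_comp[OF tensor_gen_carrier[OF M(1) N(1)]] linear_map_id)
    show "linear_map (mdim M * mdim N) (mdim M' * mdim N') (\<lambda>v. tensor_gen M' N' x *\<^sub>v (kron f g *\<^sub>v v))"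
      by (intro linear_map_comp[OF c] linear_map_comp[OF tensor_gen_carrier[OF M(2) N(2)]] linear_map_id)
    fix u v assume uv: "u \<in> mspace M" "v \<in> mspace N"
    show "kron f g *\<^sub>v (tensor_gen M N x *\<^sub>v vtensor u v) = tensor_gen M' N' x *\<^sub>v (kron f g *\<^sub>v vtensor u v)"
      using uv
      by (cases x) (simp_all add: tensor_gen_vtensor M N kron_vtensor[OF cf cg] mult_add_distrib_mat_vec[OF c]
          vtensor_carrier act_carrier is_homD(3)[OF f M] is_homD(3)[OF g N] is_homD(4)[OF f M] is_homD(4)[OF g N])
  qed
  with v show "kron f g *\<^sub>v (action (M \<otimes>\<^sub>D N) (d4_gen x) *\<^sub>v v) =
      action (M' \<otimes>\<^sub>D N') (d4_gen x) *\<^sub>v (kron f g *\<^sub>v v)"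
    by (simp add: tensor_module M N)
qed (use M N in auto)

lemma kron_inverse:
  fixes f g :: "'k::field mat"
  assumes c: "f \<in> carrier_mat m' m" "f' \<in> carrier_mat m m'" "g \<in> carrier_mat n' n" "g' \<in> carrier_mat n n'"
    and inv: "f' * f = 1\<^sub>m m" "g' * g = 1\<^sub>m n"
  shows "kron f' g' * kron f g = 1\<^sub>m (m * n)"
proof (rule mat_eqI_unit_vec)
  note k = kron_carrier[OF c(1,3)] kron_carrier[OF c(2,4)]
  show "kron f' g' * kron f g \<in> carrier_mat (m * n) (m * n)" by (rule mult_carrier_mat[OF k(2,1)])
  fix j assume j: "j < m * n"
  note jj = div_mod_less[OF j]
  have "f' *\<^sub>v (f *\<^sub>v unit_vec m (j div n)) = unit_vec m (j div n)"
    using inv(1) by (simp flip: assoc_mult_mat_vec[OF c(2,1)])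
  moreover have "g' *\<^sub>v (g *\<^sub>v unit_vec n (j mod n)) = unit_vec n (j mod n)"
    using inv(2) by (simp flip: assoc_mult_mat_vec[OF c(4,3)])
  ultimately show "kron f' g' * kron f g *\<^sub>v unit_vec (m * n) j = 1\<^sub>m (m * n) *\<^sub>v unit_vec (m * n) j"
    using c by (simp add: assoc_mult_mat_vec[OF k(2,1)] unit_vec_vtensor[OF j] vtensor_carrier
        kron_vtensor[OF c(1,3)] kron_vtensor[OF c(2,4)] mult_mat_vec_carrier[OF c(1)] mult_mat_vec_carrier[OF c(3)])
qed simp

lemma tensor_iso:
  assumes "M \<cong>\<^sub>D M'" "N \<cong>\<^sub>D N'"
  shows "M \<otimes>\<^sub>D N \<cong>\<^sub>D M' \<otimes>\<^sub>D N'"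
proof -
  obtain f f' where m: "is_module M" "is_module M'" and h: "is_hom M M' f" "is_hom M' M f'"
    and inv: "f' * f = 1\<^sub>m (mdim M)" "f * f' = 1\<^sub>m (mdim M')"
    using assms(1) by (auto simp: module_iso_def)
  obtain g g' where m': "is_module N" "is_module N'" and h': "is_hom N N' g" "is_hom N' N g'"
    and inv': "g' * g = 1\<^sub>m (mdim N)" "g * g' = 1\<^sub>m (mdim N')"
    using assms(2) by (auto simp: module_iso_def)
  note c = is_homD(1)[OF h(1) m] is_homD(1)[OF h(2) m(2,1)]
    is_homD(1)[OF h'(1) m'] is_homD(1)[OF h'(2) m'(2,1)]
  have "is_hom (M \<otimes>\<^sub>D N) (M' \<otimes>\<^sub>D N') (kron f g)" "is_hom (M' \<otimes>\<^sub>D N') (M \<otimes>\<^sub>D N) (kron f' g')"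
    by (intro tensor_hom; fact)+
  moreover have "kron f' g' * kron f g = 1\<^sub>m (mdim (M \<otimes>\<^sub>D N))" "kron f g * kron f' g' = 1\<^sub>m (mdim (M' \<otimes>\<^sub>D N'))"
    using kron_inverse[OF c inv(1) inv'(1)] kron_inverse[OF c(2,1,4,3) inv(2) inv'(2)]
    by (simp_all add: tensor_module m m')
  ultimately show ?thesis
    using tensor_module(1)[OF m(1) m'(1)] tensor_module(1)[OF m(2) m'(2)] unfolding module_iso_def by blast
qed

section \<open>The decomposition\<close>

lemma mult_add_less:
  fixes i j m n :: nat
  assumes "i < m" "j < n"
  shows "i * n + j < m * n"
proof -
  have "i * n + j < Suc i * n" using assms by simp
  also have "\<dots> \<le> m * n" using assms by (intro mult_le_mono1) simp
  finally show ?thesis .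
qed

lemma one_mat_row_mat: "1\<^sub>m n = row_mat n n (\<lambda>i. i) (\<lambda>i. 1)"
  by (auto simp: row_mat_def intro!: eq_matI)

text \<open>A Kronecker product of two such matrices is again of the form \<open>row_mat\<close>, so
  on the tensor product each summand of a coproduct still reads a single coordinate.\<close>

lemma kron_row_mat_mult_vec:
  fixes z :: "'k::field vec"
  assumes z: "z \<in> carrier_vec (m' * n')"
    and c: "\<And>i. i < m \<Longrightarrow> e i \<noteq> 0 \<Longrightarrow> c i < m'" and c': "\<And>i. i < n \<Longrightarrow> e' i \<noteq> 0 \<Longrightarrow> c' i < n'"
  shows "kron (row_mat m m' c e) (row_mat n n' c' e') *\<^sub>v z =
    vec (m * n) (\<lambda>k. e (k div n) * e' (k mod n) * z $ (c (k div n) * n' + c' (k mod n)))"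
proof -
  have eq: "kron (row_mat m m' c e) (row_mat n n' c' e') = row_mat (m * n) (m' * n')
      (\<lambda>k. c (k div n) * n' + c' (k mod n)) (\<lambda>k. e (k div n) * e' (k mod n))" (is "?L = ?R")
  proof (rule eq_matI)
    fix k l assume "k < dim_row ?R" "l < dim_col ?R"
    then have k: "k < m * n" and l: "l < m' * n'" by (auto simp: row_mat_def)
    note kl = div_mod_less[OF k] div_mod_less[OF l]
    have "e' (k mod n) \<noteq> 0 \<Longrightarrow>
        l = c (k div n) * n' + c' (k mod n) \<longleftrightarrow> l div n' = c (k div n) \<and> l mod n' = c' (k mod n)"
      using c'[OF kl(2)] kl by auto (metis div_mult_mod_eq)
    then show "?L $$ (k, l) = ?R $$ (k, l)"
      using k l kl by (auto simp: kron_def row_mat_def)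
  qed (auto simp: kron_def row_mat_def)
  have less: "c (k div n) * n' + c' (k mod n) < m' * n'"
    if "k < m * n" "e (k div n) * e' (k mod n) \<noteq> 0" for k
  proof -
    have "c (k div n) < m'" "c' (k mod n) < n'"
      using that c c' div_mod_less[OF that(1)] by auto
    then show ?thesis by (rule mult_add_less)
  qed
  show ?thesis unfolding eq by (rule row_mat_mult_vec[OF z less])
qed

text \<open>The signs in the first summands come from the second tensor factors b and c of a
  \<otimes> b and d \<otimes> c: they act by \<tau> on the top and by -\<tau> on the socle of the
  second zigzag.\<close>

lemma tensor_syz_mult:
  fixes \<sigma> \<tau> :: "'k::field" and z :: "'k vec"
  assumes \<sigma>: "\<sigma> * \<sigma> = 1" and \<tau>: "\<tau> * \<tau> = 1"
    and m: "m = 2 * s + 1" and n: "n = 2 * t + 1" and z: "z \<in> carrier_vec (m * n)"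
  shows "tensor_gen (syz s \<sigma>) (syz t \<tau>) GA *\<^sub>v z = vec (m * n) (\<lambda>k.
      (if s < k div n then (if t < k mod n then - \<tau> else \<tau>) * z $ ((k div n - (s + 1)) * n + k mod n) else 0)
      + (if t < k mod n then z $ (k div n * n + (k mod n - (t + 1))) else 0))"
    "tensor_gen (syz s \<sigma>) (syz t \<tau>) GD *\<^sub>v z = vec (m * n) (\<lambda>k.
      (if s < k div n then (if t < k mod n then - \<tau> else \<tau>) * z $ ((k div n - s) * n + k mod n) else 0)
      + (if t < k mod n then z $ (k div n * n + (k mod n - t)) else 0))"
    "g \<in> {GB, GC} \<Longrightarrow> tensor_gen (syz s \<sigma>) (syz t \<tau>) g *\<^sub>v z = vec (m * n) (\<lambda>k.
      (if s < k div n then - \<sigma> else \<sigma>) * (if t < k mod n then - \<tau> else \<tau>) * z $ k)"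
proof -
  note W = syz_module[OF \<sigma>, of s] syz_module[OF \<tau>, of t]
  note gens = tensor_gen_simps[OF W(1,4)] W syz_gen.simps one_mat_row_mat m[symmetric] n[symmetric]
  note c = kron_carrier[OF row_mat_carrier row_mat_carrier]
  show "tensor_gen (syz s \<sigma>) (syz t \<tau>) GA *\<^sub>v z = vec (m * n) (\<lambda>k.
      (if s < k div n then (if t < k mod n then - \<tau> else \<tau>) * z $ ((k div n - (s + 1)) * n + k mod n) else 0)
      + (if t < k mod n then z $ (k div n * n + (k mod n - (t + 1))) else 0))"
    unfolding gens add_mult_distrib_mat_vec[OF c c z]
    by (subst (1 2) kron_row_mat_mult_vec[OF z]) (auto simp: m n intro!: eq_vecI)
  show "tensor_gen (syz s \<sigma>) (syz t \<tau>) GD *\<^sub>v z = vec (m * n) (\<lambda>k.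
      (if s < k div n then (if t < k mod n then - \<tau> else \<tau>) * z $ ((k div n - s) * n + k mod n) else 0)
      + (if t < k mod n then z $ (k div n * n + (k mod n - t)) else 0))"
    unfolding gens add_mult_distrib_mat_vec[OF c c z]
    by (subst (1 2) kron_row_mat_mult_vec[OF z]) (auto simp: m n intro!: eq_vecI)
  assume "g \<in> {GB, GC}"
  then have "tensor_gen (syz s \<sigma>) (syz t \<tau>) g = kron (row_mat m m (\<lambda>i. i) (\<lambda>i. if s < i then - \<sigma> else \<sigma>))
      (row_mat n n (\<lambda>i. i) (\<lambda>i. if t < i then - \<tau> else \<tau>))"
    by (auto simp: gens)
  then show "tensor_gen (syz s \<sigma>) (syz t \<tau>) g *\<^sub>v z = vec (m * n) (\<lambda>k.
      (if s < k div n then - \<sigma> else \<sigma>) * (if t < k mod n then - \<tau> else \<tau>) * z $ k)"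
    by (simp add: kron_row_mat_mult_vec[OF z])
qed

text \<open>
  The comultiplication \<open>e\<^sub>l \<mapsto> \<Sum>\<^bsub>i+j=l\<^esub> e\<^sub>i \<otimes> e\<^sub>j\<close> extends to an embedding of \<open>\<Omega>\<^bsup>s+t\<^esup>\<close>.
  On coordinates it reads off, at \<open>(i, j)\<close>, a single coordinate determined by \<open>i + j\<close>.
\<close>

lemma tensor_syz_comult:
  fixes \<sigma> \<tau> :: "'k::field"
  assumes \<sigma>: "\<sigma> * \<sigma> = 1" and \<tau>: "\<tau> * \<tau> = 1"
    and m: "m = 2 * s + 1" and n: "n = 2 * t + 1"
  shows "\<exists>h. is_hom (syz (s + t) (\<sigma> * \<tau>)) (syz s \<sigma> \<otimes>\<^sub>D syz t \<tau>) h \<and>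
    (\<forall>z\<in>carrier_vec (2 * (s + t) + 1). h *\<^sub>v z = vec (m * n) (\<lambda>k.
      if k div n \<le> s then (if k mod n \<le> t then z $ (k div n + k mod n) else z $ (s + k div n + k mod n))
      else if k mod n \<le> t then \<tau> * z $ (t + k div n + k mod n) else 0))"
proof -
  have \<sigma>\<tau>: "(\<sigma> * \<tau>) * (\<sigma> * \<tau>) = 1"
    using \<sigma> \<tau> by (metis mult.assoc mult.left_commute mult_1_right)
  note W = syz_module[OF \<sigma>, of s] syz_module[OF \<tau>, of t] and V = syz_module[OF \<sigma>\<tau>]
  note T = tensor_module[OF W(1,4)]
  \<comment> \<open>The regions are e \<otimes> e, e \<otimes> f, f \<otimes> e and f \<otimes> f.
    For e_i \<otimes> f_q with j = t + 1 + q, the index s + i + j = s + t + 1 + (i + q) is that of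
    f_{i+q} in the long zigzag; f \<otimes> e is symmetric. The factor \<tau> is forced by the b in
    a \<otimes> b.\<close>
  define \<theta> where "\<theta> z = vec (m * n) (\<lambda>k.
      if k div n \<le> s then (if k mod n \<le> t then z $ (k div n + k mod n) else z $ (s + k div n + k mod n))
      else if k mod n \<le> t then \<tau> * z $ (t + k div n + k mod n) else 0)" for z
  have bound: "k div n \<le> 2 * s" "k mod n \<le> 2 * t" if "k < m * n" for k
    using div_mod_less[OF that] m n by linarith+
  have "linear_map (2 * (s + t) + 1) (m * n) \<theta>"
  proof (rule linear_mapI)
    fix u v :: "'k vec" and c
    assume uv: "u \<in> carrier_vec (2 * (s + t) + 1)" "v \<in> carrier_vec (2 * (s + t) + 1)"
    show "\<theta> v \<in> carrier_vec (m * n)" by (simp add: \<theta>_def)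
    show "\<theta> (u + v) = \<theta> u + \<theta> v"
      using uv by (intro eq_vecI) (auto simp: \<theta>_def algebra_simps dest: bound)
    show "\<theta> (c \<cdot>\<^sub>v v) = c \<cdot>\<^sub>v \<theta> v"
      using uv by (intro eq_vecI) (auto simp: \<theta>_def algebra_simps dest: bound)
  qed
  then have lin: "linear_map (mdim (syz (s + t) (\<sigma> * \<tau>))) (mdim (syz s \<sigma> \<otimes>\<^sub>D syz t \<tau>)) \<theta>"
    by (simp add: V T W m n)
  have "\<theta> (action (syz (s + t) (\<sigma> * \<tau>)) (d4_gen g) *\<^sub>v z) =
      action (syz s \<sigma> \<otimes>\<^sub>D syz t \<tau>) (d4_gen g) *\<^sub>v \<theta> z"
    if "z \<in> mspace (syz (s + t) (\<sigma> * \<tau>))" for g z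
  proof -
    have z: "z \<in> carrier_vec (2 * (s + t) + 1)" using that by (simp add: V)
    have \<theta>z: "\<theta> z \<in> carrier_vec (m * n)" by (simp add: \<theta>_def)
    have index: "\<theta> y $ (i * n + j) =
      (if i \<le> s then (if j \<le> t then y $ (i + j) else y $ (s + i + j))
       else if j \<le> t then \<tau> * y $ (t + i + j) else 0)" if "i < m" "j < n" for i j y
    proof -
      have "i * n + j < m * n" using that by (rule mult_add_less)
      then show ?thesis using that by (simp add: \<theta>_def)
    qed
    have "\<theta> (syz_gen (s + t) (\<sigma> * \<tau>) g *\<^sub>v z) $ (i * n + j) =
        (tensor_gen (syz s \<sigma>) (syz t \<tau>) g *\<^sub>v \<theta> z) $ (i * n + j)" if ij: "i < m" "j < n" for i j
    proof -
      have k: "i * n + j < m * n" using ij by (rule mult_add_less)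
      have ij': "(i * n + j) div n = i" "(i * n + j) mod n = j" using ij by auto
      have i: "i < 2 * s + 1" and j: "j < 2 * t + 1" using ij m n by simp_all
      \<comment> \<open>Truncated differences stay in range even where their coefficient is zero, so
        \<open>index\<close> can be unfolded without a case split.\<close>
      have *: "i - (s + 1) < m" "i - s < m" "j - (t + 1) < n" "j - t < n" using ij by simp_all
      note mult = tensor_syz_mult[OF \<sigma> \<tau> m n \<theta>z]
      consider "g = GA" | "g = GD" | "g \<in> {GB, GC}" by (cases g) auto
      then show ?thesis
      proof cases
        case 1
        show ?thesis
          unfolding 1 mult index[OF ij] index_vec[OF k] ij' index[OF *(1) ij(2)] index[OF ij(1) *(3)]
            syz_gen_mult[OF z]
          using i j by auto
      next
        case 2
        show ?thesis
          unfolding 2 mult index[OF ij] index_vec[OF k] ij' index[OF *(2) ij(2)] index[OF ij(1) *(4)]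
            syz_gen_mult[OF z]
          using i j by auto
      next
        case 3
        have "syz_gen (s + t) (\<sigma> * \<tau>) g *\<^sub>v z = vec (2 * (s + t) + 1)
            (\<lambda>i. if s + t < i then - (\<sigma> * \<tau>) * z $ i else \<sigma> * \<tau> * z $ i)"
          using 3 by (auto simp: syz_gen_mult[OF z])
        then show ?thesis
          unfolding mult(3)[OF 3] index[OF ij] index_vec[OF k] ij'
          using i j by auto
      qed
    qed
    then have "\<theta> (syz_gen (s + t) (\<sigma> * \<tau>) g *\<^sub>v z) $ k =
        (tensor_gen (syz s \<sigma>) (syz t \<tau>) g *\<^sub>v \<theta> z) $ k" if "k < m * n" for k
      using div_mod_less[OF that] by (metis div_mult_mod_eq)
    moreover have "dim_row (tensor_gen (syz s \<sigma>) (syz t \<tau>) g) = m * n"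
      using carrier_matD(1)[OF tensor_gen_carrier[OF W(1,4), of g]] by (simp add: W m n)
    moreover have "dim_vec (\<theta> y) = m * n" for y by (simp add: \<theta>_def)
    ultimately show ?thesis
      unfolding V T by (intro eq_vecI) (simp_all del: index_mult_mat_vec)
  qed
  then obtain h where h: "is_hom (syz (s + t) (\<sigma> * \<tau>)) (syz s \<sigma> \<otimes>\<^sub>D syz t \<tau>) h"
    "\<And>z. z \<in> mspace (syz (s + t) (\<sigma> * \<tau>)) \<Longrightarrow> h *\<^sub>v z = \<theta> z"
    using linear_hom[OF V(1) T(1) lin] by blast
  then show ?thesis by (intro exI[of _ h]) (simp add: V \<theta>_def)
qed

section \<open>Generation of the tensor product\<close>

lemma submodule_support:
  fixes z :: "'k::field vec"
  assumes M: "is_module M" and U: "is_submodule U M" and z: "z \<in> mspace M"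
    and supp: "\<And>k. k < mdim M \<Longrightarrow> z $ k \<noteq> 0 \<Longrightarrow> unit_vec (mdim M) k \<in> U"
  shows "z \<in> U"
  using z
proof (induction rule: vec_support_induct)
  case (step x k)
  then show ?case
    by (intro is_submoduleD(3)[OF U] submodule_smult[OF M U] supp) auto
qed (rule is_submoduleD(2)[OF U])

text \<open>The case of one generator: the linear map p \<mapsto> p_0 v supplies X, and v is the
  image of the generator, the unit vector 0.\<close>

lemma proj_1_hom:
  fixes \<sigma> :: "'k::field"
  assumes \<sigma>: "\<sigma> * \<sigma> = 1" and M: "is_module M" and v: "v \<in> mspace M"
    and eigen: "\<And>g. g \<in> {GB, GC} \<Longrightarrow> action M (d4_gen g) *\<^sub>v v = \<sigma> \<cdot>\<^sub>v v"
  shows "\<exists>f. is_hom (proj 1 \<sigma>) M f \<and> v \<in> (*\<^sub>v) f ` mspace (proj 1 \<sigma>)"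
proof -
  note P = proj_module[OF \<sigma>]
  have "linear_map 1 (mdim M) (\<lambda>p. p $ 0 \<cdot>\<^sub>v v)"
    using v by (auto simp: linear_map_def algebra_simps intro!: eq_vecI)
  then obtain X where X: "X \<in> carrier_mat (mdim M) 1"
    "\<And>p. p \<in> carrier_vec 1 \<Longrightarrow> X *\<^sub>v p = p $ 0 \<cdot>\<^sub>v v"
    by (rule linear_map_mat) blast
  obtain f where f: "is_hom (proj 1 \<sigma>) M f" "\<And>v. v \<in> mspace (proj 1 \<sigma>) \<Longrightarrow> f *\<^sub>v v = free_map M 1 X v"
  proof -
    have "\<exists>f. is_hom (proj 1 \<sigma>) M f \<and> (\<forall>v\<in>mspace (proj 1 \<sigma>). f *\<^sub>v v = free_map M 1 X v)"
      by (rule proj_hom[OF \<sigma> M X(1)])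
        (auto simp: X(2) act_smult_vec[OF M] v eigen smult_smult_assoc mult.commute)
    then show ?thesis using that by blast
  qed
  have "free_map M 1 X (unit_vec 4 0) = v"
  proof -
    have b: "block 0 1 (unit_vec 4 0) $ 0 = (1 :: 'k)" "block 1 1 (unit_vec 4 0) $ 0 = (0 :: 'k)"
      "block 2 1 (unit_vec 4 0) $ 0 = (0 :: 'k)" "block 3 1 (unit_vec 4 0) $ 0 = (0 :: 'k)"
      by (simp_all add: block_def)
    have zero: "0 \<cdot>\<^sub>v v = 0\<^sub>v (mdim M)" "1 \<cdot>\<^sub>v v = v"
      "action M x *\<^sub>v 0\<^sub>v (mdim M) = 0\<^sub>v (mdim M)" for x
      using v is_moduleD(1)[OF M, of x] by auto
    show ?thesis using v by (simp add: free_map_def X(2) block_carrier b zero)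
  qed
  moreover have u: "unit_vec 4 0 \<in> mspace (proj 1 \<sigma>)" by (simp add: P)
  ultimately have "v = f *\<^sub>v unit_vec 4 0" by (simp add: f(2))
  with f(1) u show ?thesis by blast
qed

text \<open>All e_i \<otimes> e_j have sign \<sigma> \<tau>, so the zigzag and every projective
  summand share it. The submodule U is the image of the map from the direct sum; the proof fills U
  with the basis of the tensor product, in the order e \<otimes> e, e \<otimes> f, f \<otimes> e, f
  \<otimes> f.\<close>

lemma tensor_syz_decomposition:
  fixes \<sigma> \<tau> :: "'k::field"
  assumes \<sigma>: "\<sigma> * \<sigma> = 1" and \<tau>: "\<tau> * \<tau> = 1"
  shows "syz s \<sigma> \<otimes>\<^sub>D syz t \<tau> \<cong>\<^sub>D syz (s + t) (\<sigma> * \<tau>) \<oplus>\<^sub>D copies (s * t) (proj 1 (\<sigma> * \<tau>))"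
proof -
  define m n where m: "m = 2 * s + 1" and n: "n = 2 * t + 1"
  have \<sigma>\<tau>: "(\<sigma> * \<tau>) * (\<sigma> * \<tau>) = 1"
    using \<sigma> \<tau> by (metis mult.assoc mult.left_commute mult_1_right)
  note W = syz_module[OF \<sigma>, of s] syz_module[OF \<tau>, of t] and V = syz_module[OF \<sigma>\<tau>] and P = proj_module[OF \<sigma>\<tau>]
  let ?V = "syz (s + t) (\<sigma> * \<tau>)" and ?P = "proj 1 (\<sigma> * \<tau>)"
  let ?T = "syz s \<sigma> \<otimes>\<^sub>D syz t \<tau>"
  note T = tensor_module[OF W(1,4)]
  have dim: "mdim ?T = m * n" by (simp add: T W m n)
  define E where "E i j = (unit_vec (m * n) (i * n + j) :: 'k vec)" for i j
  have E: "E i j \<in> mspace ?T" for i j by (simp add: E_def dim)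
  note bound = mult_add_less[of _ m _ n]
  have pair: "i * n + j = i' * n + j' \<longleftrightarrow> i = i' \<and> j = j'" if "j < n" "j' < n" for i i' j j'
    using that by (metis add.commute div_mult_self3 mod_less mod_mult_self3 div_less add.right_neutral not_less_zero)
  have Ek: "E i j $ k = (if k div n = i \<and> k mod n = j then 1 else 0)"
    if "k < m * n" "j < n" for i j k
    using that pair[OF div_mod_less(2)[OF that(1)] that(2), of "k div n" i]
    by (auto simp: E_def unit_vec_def)
  have act: "action ?T (d4_gen g) *\<^sub>v E i j = tensor_gen (syz s \<sigma>) (syz t \<tau>) g *\<^sub>v E i j" for g i j
    by (simp add: T)
  have Ec: "E i j \<in> carrier_vec (m * n)" for i j by (simp add: E_def)
  note mult = tensor_syz_mult[OF \<sigma> \<tau> m n Ec]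
  \<comment> \<open>The grid points off the path "j = 0 or i = s"; one remaining point on each
    antidiagonal is left to the diagonal sum.\<close>
  define S where "S = (\<lambda>(i, j). E i j) ` ({..<s} \<times> {1..t})"
  have "inj_on (\<lambda>(i, j). E i j) ({..<s} \<times> {1..t})"
  proof (rule inj_onI, clarsimp)
    fix i j i' j' assume ij: "E i j = E i' j'" "i < s" "i' < s" "1 \<le> j" "j \<le> t" "1 \<le> j'" "j' \<le> t"
    then have lt: "i < m" "j < n" "j' < n" by (simp_all add: m n)
    have "i * n + j = i' * n + j'"
      using ij(1) unit_vec_eq[where 'a = 'k, OF bound[OF lt(1,2)]] by (simp add: E_def)
    then show "i = i' \<and> j = j'" by (simp add: pair[OF lt(2,3)])
  qed
  then have card: "card S = s * t" and fin: "finite S" by (simp_all add: S_def card_image)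
  have "\<exists>f. is_hom ?P ?T f \<and> v \<in> (*\<^sub>v) f ` mspace ?P" if vS: "v \<in> S" for v
  proof -
    obtain i j where v: "v = E i j" "i < s" "1 \<le> j" "j \<le> t" using vS by (auto simp: S_def)
    show ?thesis
    proof (rule proj_1_hom[OF \<sigma>\<tau> T(1)])
      show "v \<in> mspace ?T" using E v by simp
      fix g assume g: "g \<in> {GB, GC}"
      have j: "j < n" using v n by simp
      show "action ?T (d4_gen g) *\<^sub>v v = (\<sigma> * \<tau>) \<cdot>\<^sub>v v"
        unfolding v(1) act mult(3)[OF g]
        by (rule eq_vecI) (use v in \<open>auto simp: Ek[OF _ j] carrier_vecD[OF Ec]\<close>)
    qed
  qed
  then obtain p where p: "is_hom (copies (s * t) ?P) ?T p" "S \<subseteq> (*\<^sub>v) p ` mspace (copies (s * t) ?P)"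
    using copies_hom[OF P(1) T(1) fin] unfolding card by blast
  obtain \<theta> where \<theta>: "is_hom ?V ?T \<theta>"
    "\<And>z. z \<in> carrier_vec (2 * (s + t) + 1) \<Longrightarrow> \<theta> *\<^sub>v z = vec (m * n) (\<lambda>k.
      if k div n \<le> s then (if k mod n \<le> t then z $ (k div n + k mod n) else z $ (s + k div n + k mod n))
      else if k mod n \<le> t then \<tau> * z $ (t + k div n + k mod n) else 0)"
    using tensor_syz_comult[OF \<sigma> \<tau> m n] by blast
  let ?R = "?V \<oplus>\<^sub>D copies (s * t) ?P"
  note C = copies_module[OF P(1)]
  obtain h where h: "is_hom ?R ?T h" "(*\<^sub>v) \<theta> ` mspace ?V \<subseteq> (*\<^sub>v) h ` mspace ?R"
    "(*\<^sub>v) p ` mspace (copies (s * t) ?P) \<subseteq> (*\<^sub>v) h ` mspace ?R"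
    by (rule direct_sum_hom[OF V(1) C T(1) \<theta>(1) p(1)])
  have R: "is_module ?R" by (rule direct_sum_module[OF V(1) C])
  define U where "U = (*\<^sub>v) h ` mspace ?R"
  have U: "is_submodule U ?T" unfolding U_def by (rule image_submodule[OF R T(1) h(1)])
  note U_minus = submodule_minus[OF T(1) U] and U_smult = submodule_smult[OF T(1) U]
    and U_act = is_submoduleD(4)[OF U]
  have free: "E i j \<in> U" if "i < s" "1 \<le> j" "j \<le> t" for i j
  proof -
    have "E i j \<in> S" unfolding S_def using that by (intro image_eqI[of _ _ "(i, j)"]) auto
    then show ?thesis using p(2) h(3) by (auto simp: U_def)
  qed
  have \<theta>U: "\<theta> *\<^sub>v z \<in> U" if "z \<in> carrier_vec (2 * (s + t) + 1)" for z
    using that h(2) by (auto simp: U_def V)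

  \<comment> \<open>All but one of the \<open>e\<^sub>i \<otimes> e\<^sub>j\<close> with \<open>i + j = l\<close> are free generators, and their sum is \<open>\<theta> e\<^sub>l\<close>.\<close>
  have corner: "E i j \<in> U" if ij: "i \<le> s" "j \<le> t" "j = 0 \<or> i = s" for i j
  proof -
    let ?u = "unit_vec (2 * (s + t) + 1) (i + j) :: 'k vec"
    have jn: "j < n" using ij n by simp
    have u: "?u $ l = (if l = i + j then 1 else 0)" if "l < 2 * (s + t) + 1" for l
      using that ij by (simp add: unit_vec_def)
    have \<theta>u: "(\<theta> *\<^sub>v ?u) $ k = (if k div n \<le> s \<and> k mod n \<le> t \<and> k div n + k mod n = i + j then 1 else 0)"
      if k: "k < m * n" for k
    proof -
      have "k div n < 2 * s + 1" "k mod n < 2 * t + 1" using div_mod_less[OF k] m n by simp_all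
      then show ?thesis
        using k ij by (subst \<theta>(2)) (auto simp: u)
    qed
    have diff: "\<theta> *\<^sub>v ?u - E i j \<in> U"
    proof (rule submodule_support[OF T(1) U])
      show "\<theta> *\<^sub>v ?u - E i j \<in> mspace ?T"
        using E \<theta>U[of ?u] is_submoduleD(1)[OF U] by auto
      fix k assume "k < mdim ?T" and nz: "(\<theta> *\<^sub>v ?u - E i j) $ k \<noteq> 0"
      then have k: "k < m * n" by (simp add: dim)
      have "(\<theta> *\<^sub>v ?u - E i j) $ k = (\<theta> *\<^sub>v ?u) $ k - E i j $ k"
        using k by (intro index_minus_vec) (simp add: carrier_vecD[OF Ec])
      then have "(\<theta> *\<^sub>v ?u) $ k \<noteq> E i j $ k" using nz by auto
      then have "k div n < s" "1 \<le> k mod n" "k mod n \<le> t"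
        unfolding \<theta>u[OF k] Ek[OF k jn] using ij by (auto split: if_splits)
      then have "E (k div n) (k mod n) \<in> U" by (rule free)
      then show "unit_vec (mdim ?T) k \<in> U" by (simp add: E_def dim)
    qed
    have "\<theta> *\<^sub>v ?u - (\<theta> *\<^sub>v ?u - E i j) \<in> U" by (rule U_minus[OF \<theta>U diff]) simp
    moreover have "x - (x - E i j) = E i j" if "x \<in> carrier_vec (m * n)" for x
      using that Ec[of i j] by (intro eq_vecI) auto
    moreover have "\<theta> *\<^sub>v ?u \<in> carrier_vec (m * n)"
      using \<theta>U[of ?u] is_submoduleD(1)[OF U] by (auto simp: dim)
    ultimately show ?thesis by (simp only:)
  qed
  have ee: "E i j \<in> U" if "i \<le> s" "j \<le> t" for i j
    using that corner[of i j] free[of i j] by (cases "j = 0 \<or> i = s") auto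
  have eqI: "u = v" if "u \<in> carrier_vec (m * n)" "v \<in> carrier_vec (m * n)"
    "\<And>i j. i < m \<Longrightarrow> j < n \<Longrightarrow> u $ (i * n + j) = v $ (i * n + j)" for u v :: "'k vec"
  proof (rule eq_vecI)
    fix k assume "k < dim_vec v"
    then have k: "k < m * n" using that(2) by simp
    show "u $ k = v $ k" using that(3)[OF div_mod_less[OF k]] by simp
  qed (use that in simp)
  have Eij: "E i j $ (x * n + y) = (if x = i \<and> y = j then 1 else 0)" if "x < m" "y < n" "j < n" for i j x y
    using Ek[OF bound[OF that(1,2)] that(3)] that by simp
  have actc: "action ?T (d4_gen g) *\<^sub>v E i j \<in> carrier_vec (m * n)" for g i j
    using act_carrier[OF T(1) E, of "d4_gen g" i j] by (simp add: dim)
  have lincomb: "(c \<cdot>\<^sub>v E i j + c' \<cdot>\<^sub>v E i' j') $ k = c * E i j $ k + c' * E i' j' $ k" if "k < m * n"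
    for c c' i j i' j' k
    using that by (simp add: carrier_vecD[OF Ec])
  \<comment> \<open>Here j runs through the whole basis of the second factor: the formula is also
    applied to e_i \<otimes> f_q, where b acts by -\<tau>.\<close>
  have AE: "action ?T (d4_gen GA) *\<^sub>v E i j =
      (if i < s then (if t < j then - \<tau> else \<tau>) else 0) \<cdot>\<^sub>v E (s + 1 + i) j
      + (if j < t then 1 else 0) \<cdot>\<^sub>v E i (t + 1 + j)"
    if ij: "i \<le> s" "j < n" for i j
  proof (rule eqI)
    fix x y assume xy: "x < m" "y < n"
    have xy': "x - (s + 1) < m" "y - (t + 1) < n" using xy by simp_all
    have div: "(x * n + y) div n = x" "(x * n + y) mod n = y" using xy by simp_all
    have lt: "x < 2 * s + 1" "y < 2 * t + 1" "j < 2 * t + 1" using xy ij m n by simp_all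
    note entry = act mult lincomb[OF bound[OF xy]] index_vec[OF bound[OF xy]] div
      Eij[OF xy'(1) xy(2) ij(2)] Eij[OF xy(1) xy'(2) ij(2)] Eij[OF xy ij(2)]
    show "(action ?T (d4_gen GA) *\<^sub>v E i j) $ (x * n + y) =
      ((if i < s then (if t < j then - \<tau> else \<tau>) else 0) \<cdot>\<^sub>v E (s + 1 + i) j
      + (if j < t then 1 else 0) \<cdot>\<^sub>v E i (t + 1 + j)) $ (x * n + y)"
    proof (cases "j < t")
      case True
      then have "t + 1 + j < n" using n by simp
      from Eij[OF xy this] show ?thesis
        unfolding entry using True lt ij(1) by (cases "s < x"; cases "t < y"; auto)
    next
      case False
      then show ?thesis
        unfolding entry using lt ij(1) by (cases "s < x"; cases "t < y"; auto)
    qed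
  qed (use actc Ec in auto)
  have DE: "action ?T (d4_gen GD) *\<^sub>v E i j =
      (if 0 < i then \<tau> else 0) \<cdot>\<^sub>v E (s + i) j + (if 0 < j then 1 else 0) \<cdot>\<^sub>v E i (t + j)"
    if ij: "i \<le> s" "j \<le> t" for i j
  proof (rule eqI)
    fix x y assume xy: "x < m" "y < n"
    have xy': "x - s < m" "y - t < n" using xy by simp_all
    have div: "(x * n + y) div n = x" "(x * n + y) mod n = y" using xy by simp_all
    have lt: "x < 2 * s + 1" "y < 2 * t + 1" using xy m n by simp_all
    have jn: "j < n" "t + j < n" using ij n by simp_all
    show "(action ?T (d4_gen GD) *\<^sub>v E i j) $ (x * n + y) =
      ((if 0 < i then \<tau> else 0) \<cdot>\<^sub>v E (s + i) j + (if 0 < j then 1 else 0) \<cdot>\<^sub>v E i (t + j)) $ (x * n + y)"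
      unfolding act mult lincomb[OF bound[OF xy]] index_vec[OF bound[OF xy]] div
        Eij[OF xy'(1) xy(2) jn(1)] Eij[OF xy(1) xy'(2) jn(1)] Eij[OF xy jn(1)] Eij[OF xy jn(2)]
      using lt ij by (cases "s < x"; cases "t < y"; auto)
  qed (use actc Ec in auto)
  have Edim: "dim_vec (E i j) = m * n" for i j by (simp add: E_def)
  have zeroE: "0 \<cdot>\<^sub>v E i j = 0\<^sub>v (m * n)" for i j by (rule eq_vecI) (simp_all add: Edim)
  \<comment> \<open>Induction along i. First, d (e_0 \<otimes> e_{j+1}) = e_0 \<otimes> f_j. Next, a
    (e_i \<otimes> e_{j+1}) = \<tau> f_i \<otimes> e_{j+1} + e_i \<otimes> f_{j+1}, whose second
    term is known or absent, puts \<tau> f_i \<otimes> e_{j+1} into U; subtracting this from d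
    (e_{i+1} \<otimes> e_{j+1}) leaves e_{i+1} \<otimes> f_j.\<close>
  have ef: "E i (t + 1 + j) \<in> U" if "i \<le> s" "j < t" for i j
    using that
  proof (induction i arbitrary: j)
    case 0
    have "action ?T (d4_gen GD) *\<^sub>v E 0 (j + 1) \<in> U" using 0 by (intro U_act ee) simp_all
    moreover have "action ?T (d4_gen GD) *\<^sub>v E 0 (j + 1) = E 0 (t + 1 + j)"
      using 0 by (subst DE) (auto simp: Edim ac_simps intro!: eq_vecI)
    ultimately show ?case by simp
  next
    case (Suc i)
    let ?x = "(if j + 1 < t then 1 else 0) \<cdot>\<^sub>v E i (t + 1 + (j + 1))"
    have "?x \<in> U"
      using Suc is_submoduleD(2)[OF U] by (auto simp: zeroE dim)
    then have "action ?T (d4_gen GA) *\<^sub>v E i (j + 1) - ?x \<in> U"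
      using Suc by (intro U_minus U_act ee) simp_all
    also have "action ?T (d4_gen GA) *\<^sub>v E i (j + 1) - ?x = \<tau> \<cdot>\<^sub>v E (s + 1 + i) (j + 1)"
      using Suc n by (subst AE) (auto simp: Edim intro!: eq_vecI)
    finally have "action ?T (d4_gen GD) *\<^sub>v E (Suc i) (j + 1) - \<tau> \<cdot>\<^sub>v E (s + 1 + i) (j + 1) \<in> U"
      using Suc by (intro U_minus U_act ee) simp_all
    also have "action ?T (d4_gen GD) *\<^sub>v E (Suc i) (j + 1) - \<tau> \<cdot>\<^sub>v E (s + 1 + i) (j + 1) = E (Suc i) (t + 1 + j)"
      using Suc by (subst DE) (auto simp: Edim ac_simps Suc_eq_plus1 intro!: eq_vecI)
    finally show ?case .
  qed
  have \<tau>_cancel: "E i j \<in> U" if "\<tau> \<cdot>\<^sub>v E i j \<in> U" for i j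
    using U_smult[OF that, of \<tau>] \<tau> by (simp add: smult_smult_assoc)
  \<comment> \<open>Now a (e_i \<otimes> e_j) gives \<tau> f_i \<otimes> e_j after removing e_i
    \<otimes> f_j, which is zero for j = t; \<tau> is its own inverse.\<close>
  have fe: "E (s + 1 + i) j \<in> U" if "i < s" "j \<le> t" for i j
  proof (rule \<tau>_cancel)
    let ?x = "(if j < t then 1 else 0) \<cdot>\<^sub>v E i (t + 1 + j)"
    have "?x \<in> U"
      using that ef is_submoduleD(2)[OF U] by (auto simp: zeroE dim)
    then have "action ?T (d4_gen GA) *\<^sub>v E i j - ?x \<in> U"
      using that by (intro U_minus U_act ee) simp_all
    also have "action ?T (d4_gen GA) *\<^sub>v E i j - ?x = \<tau> \<cdot>\<^sub>v E (s + 1 + i) j"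
      using that n by (subst AE) (auto simp: Edim intro!: eq_vecI)
    finally show "\<tau> \<cdot>\<^sub>v E (s + 1 + i) j \<in> U" .
  qed
  \<comment> \<open>As a kills f_j, one has a (e_i \<otimes> f_j) = -\<tau> f_i \<otimes>
    f_j.\<close>
  have ff: "E (s + 1 + i) (t + 1 + j) \<in> U" if "i < s" "j < t" for i j
  proof (rule \<tau>_cancel)
    have "(- 1) \<cdot>\<^sub>v (action ?T (d4_gen GA) *\<^sub>v E i (t + 1 + j)) \<in> U"
      using that by (intro U_smult U_act ef) simp_all
    also have "(- 1) \<cdot>\<^sub>v (action ?T (d4_gen GA) *\<^sub>v E i (t + 1 + j)) = \<tau> \<cdot>\<^sub>v E (s + 1 + i) (t + 1 + j)"
      using that n by (subst AE) (auto simp: Edim intro!: eq_vecI)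
    finally show "\<tau> \<cdot>\<^sub>v E (s + 1 + i) (t + 1 + j) \<in> U" .
  qed
  have all: "E i j \<in> U" if ij: "i < m" "j < n" for i j
  proof -
    consider "i \<le> s" "j \<le> t" | "i \<le> s" "t < j" | "s < i" "j \<le> t" | "s < i" "t < j" by linarith
    then show ?thesis
    proof cases
      case 1 then show ?thesis by (rule ee)
    next
      case 2 then show ?thesis using ef[of i "j - (t + 1)"] ij n by simp
    next
      case 3 then show ?thesis using fe[of "i - (s + 1)" j] ij m by simp
    next
      case 4 then show ?thesis using ff[of "i - (s + 1)" "j - (t + 1)"] ij m n by simp
    qed
  qed
  have surj: "mspace ?T \<subseteq> U"
  proof
    fix z assume "z \<in> mspace ?T"
    then show "z \<in> U"
    proof (rule submodule_support[OF T(1) U])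
      fix k assume "k < mdim ?T"
      then have "E (k div n) (k mod n) \<in> U" using div_mod_less by (intro all) (simp_all add: dim)
      then show "unit_vec (mdim ?T) k \<in> U" by (simp add: E_def dim)
    qed
  qed
  have "mdim ?R = mdim ?T"
    by (simp add: dim m n direct_sum_def mdim_copies V P algebra_simps)
  with surj have "?R \<cong>\<^sub>D ?T"
    unfolding U_def by (intro iso_surjI[OF R T(1) h(1)])
  then show ?thesis by (rule iso_sym)
qed

theorem proposition2p14:
  fixes s t :: nat and r r' :: bit
  assumes "CHAR('k::alg_closed_field) \<noteq> 2"
    and "s \<ge> 1" and "t \<ge> 1"
  shows "(even (s + t) \<longrightarrow>
      (\<Omega> ^^ s) (simple_V r :: 'k d4_module) \<otimes>\<^sub>D (\<Omega> ^^ t) (simple_V r')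
        \<cong>\<^sub>D (\<Omega> ^^ (s + t)) (simple_V (r + r')) \<oplus>\<^sub>D copies (s * t) (proj_P (r + r'))) \<and>
    (odd (s + t) \<longrightarrow>
      (\<Omega> ^^ s) (simple_V r :: 'k d4_module) \<otimes>\<^sub>D (\<Omega> ^^ t) (simple_V r')
        \<cong>\<^sub>D (\<Omega> ^^ (s + t)) (simple_V (r + r')) \<oplus>\<^sub>D copies (s * t) (proj_P (r + r' + 1)))"
proof -
  have two: "(2 :: 'k) \<noteq> 0"
  proof
    assume "(2 :: 'k) = 0"
    then have "of_nat 2 = (0 :: 'k)" by simp
    \<comment> \<open>A characteristic dividing 2 is 1 or 2, and 1 is impossible in a nontrivial
      ring.\<close>
    then have "CHAR('k) dvd 2" by (simp only: of_nat_eq_0_iff_char_dvd)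
    then have "CHAR('k) \<le> 2" "CHAR('k) \<noteq> 0"
      by (simp add: dvd_imp_le, metis dvd_0_left_iff zero_neq_numeral)
    moreover have "CHAR('k) \<noteq> 1" by (metis CHAR_not_1 One_nat_def)
    ultimately show False using assms(1) by linarith
  qed
  let ?\<sigma> = "(- 1) ^ s * bit_sign r :: 'k" and ?\<tau> = "(- 1) ^ t * bit_sign r' :: 'k"
  have sq: "?\<sigma> * ?\<sigma> = 1" "?\<tau> * ?\<tau> = 1" by (simp_all add: bit_sign_def minus_one_power_iff)
  have \<sigma>\<tau>: "?\<sigma> * ?\<tau> = (- 1) ^ (s + t) * bit_sign (r + r')"
    unfolding bit_sign_add power_add by (simp only: ac_simps)
  \<comment> \<open>Both parities at once: q is any bit whose sign is that of the top of the tensor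
    product.\<close>
  have *: "(\<Omega> ^^ s) (simple_V r :: 'k d4_module) \<otimes>\<^sub>D (\<Omega> ^^ t) (simple_V r')
        \<cong>\<^sub>D (\<Omega> ^^ (s + t)) (simple_V (r + r')) \<oplus>\<^sub>D copies (s * t) (proj_P q)"
    if q: "bit_sign q = ?\<sigma> * ?\<tau>" for q
  proof -
    have "(\<Omega> ^^ s) (simple_V r :: 'k d4_module) \<otimes>\<^sub>D (\<Omega> ^^ t) (simple_V r') \<cong>\<^sub>D syz s ?\<sigma> \<otimes>\<^sub>D syz t ?\<tau>"
      by (intro tensor_iso Omega_power_simple[OF two])
    moreover have "syz s ?\<sigma> \<otimes>\<^sub>D syz t ?\<tau> \<cong>\<^sub>D syz (s + t) (?\<sigma> * ?\<tau>) \<oplus>\<^sub>D copies (s * t) (proj 1 (?\<sigma> * ?\<tau>))"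
      by (rule tensor_syz_decomposition[OF sq])
    moreover have "syz (s + t) (?\<sigma> * ?\<tau>) \<oplus>\<^sub>D copies (s * t) (proj 1 (?\<sigma> * ?\<tau>)) \<cong>\<^sub>D
        (\<Omega> ^^ (s + t)) (simple_V (r + r')) \<oplus>\<^sub>D copies (s * t) (proj_P q)"
    proof (intro direct_sum_iso copies_iso)
      show "syz (s + t) (?\<sigma> * ?\<tau>) \<cong>\<^sub>D (\<Omega> ^^ (s + t)) (simple_V (r + r'))"
        unfolding \<sigma>\<tau> by (rule iso_sym[OF Omega_power_simple[OF two]])
      show "proj 1 (?\<sigma> * ?\<tau>) \<cong>\<^sub>D proj_P q"
        unfolding q[symmetric] by (rule iso_sym[OF proj_P_iso[OF two]])
    qed
    ultimately show ?thesis by (blast intro: iso_trans)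
  qed
  have "bit_sign (r + r') = ?\<sigma> * ?\<tau>" if "even (s + t)"
    unfolding \<sigma>\<tau> using that by (simp add: minus_one_power_iff)
  moreover have "bit_sign (r + r' + 1) = ?\<sigma> * ?\<tau>" if "odd (s + t)"
    unfolding \<sigma>\<tau> bit_sign_add using that by (simp add: minus_one_power_iff bit_sign_def)
  ultimately show ?thesis using * by blast
qed
end
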